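(* Let $q\in L^1_{\mathrm{loc}}(\mathbb R)$ with $\rho(D(q))\ne\emptyset$ and let $z_1\in\rho(D(q))$. Then the operators $T_{z_1}$ and $S_{\overline{z_1}}$ defined in the context are bounded linear operators (on $L^2(\mathbb R)^2$, resp. on $\{\mathcal K\Phi^{(1)}(z_1)\}^{\perp_{\mathcal J}}$) and they intertwine $D(q)$ and $D(q^{(1)}_{z_1})$: $$D(q^{(1)}_{z_1})T_{z_1}=T_{z_1}D(q),\qquad S_{\overline{z_1}}D(q^{(1)}_{z_1})=D(q)S_{\overline{z_1}}$$ (equalities of operators, including domains). Moreover $$\ker(T_{z_1})=\{0\},\quad \mathrm{ran}(T_{z_1})=\{\Phi^{(1)}(z_1),\mathcal K\Phi^{(1)}(z_1)\}^{\perp_{\mathcal J}},\quad \ker(S_{\overline{z_1}})=\mathrm{span}\{\Phi^{(1)}(z_1)\},\quad \mathrm{ran}(S_{\overline{z_1}})=L^2(\mathbb R)^2,$$ and $S_{z_1,\overline{z_1}}$ is the inverse of $T_{z_1}$: $S_{z_1,\overline{z_1}}T_{z_1}=I$ on $L^2(\mathbb R)^2$ and $T_{z_1}S_{z_1,\overline{z_1}}=I$ on $\{\Phi^{(1)}(z_1),\mathcal K\Phi^{(1)}(z_1)\}^{\perp_{\mathcal J}}$.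
   Context: Let $q\in L^1_{\mathrm{loc}}(\mathbb R)$. For $z\in\mathbb C$, a $z$-wave function associated with $q$ is a function $\Psi(z,\cdot)=(\psi_1(z,\cdot),\psi_2(z,\cdot))^\top\in AC_{\mathrm{loc}}(\mathbb R)^2$, not identically zero, with $\psi_1'=-iz\psi_1+q\psi_2$, $\psi_2'=iz\psi_2-\overline{q}\psi_1$ a.e.; equivalently $M(q)\Psi=z\Psi$ with $M(q)=i\begin{pmatrix}\frac{d}{dx}&-q\\-\overline q&-\frac{d}{dx}\end{pmatrix}$. $D(q)$ is the maximal operator in $L^2(\mathbb R)^2$: $D(q)F=M(q)F$ on $\{F\in L^2(\mathbb R)^2: F\in AC_{\mathrm{loc}}(\mathbb R)^2,\ M(q)F\in L^2(\mathbb R)^2\}$. $\mathcal C$ denotes componentwise complex conjugation, $\sigma_1=\begin{pmatrix}0&1\\1&0\end{pmatrix}$, $\sigma_4=\begin{pmatrix}0&1\\-1&0\end{pmatrix}$, $\mathcal J=\sigma_1\mathcal C$, $\mathcal K=\sigma_4\mathcal C$, so $\mathcal K(a,b)^\top=(\overline b,-\overline a)^\top$. Two elements $F,G\in L^2(\mathbb R)^2$ are $\mathcal J$-orthogonal, $F\perp_{\mathcal J}G$, if $(F,\mathcal JG)_{L^2}=\int_{\mathbb R}G(x)^\top\sigma_1F(x)\,dx=0$; for a set $\mathcal V$, $\mathcal V^{\perp_{\mathcal J}}=\{F: F\perp_{\mathcal J}G\ \forall G\in\mathcal V\}$. For $z_1\in\rho(D(q))$ there exist $z_1$-wave functions $\Psi_\pm(z_1,\cdot)$,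 unique up to constant multiples and linearly independent, with $\Psi_-(z_1,\cdot)\in L^2((-\infty,R])^2$, $\Psi_+(z_1,\cdot)\in L^2([R,\infty))^2$ for all $R$; fix such a choice, put $\Psi(z_1,\cdot)=\Psi_-(z_1,\cdot)+\Psi_+(z_1,\cdot)=(\psi_1,\psi_2)^\top$, $$q^{(1)}_{z_1}=q+4\,\mathrm{Im}(z_1)\psi_1\overline{\psi_2}\,\|\Psi(z_1,\cdot)\|_{\mathbb C^2}^{-2},\qquad \Phi^{(1)}(z_1,x)=\mathrm{Im}(z_1)\|\Psi(z_1,x)\|_{\mathbb C^2}^{-2}\mathcal K\Psi(z_1,x).$$ Define, for $F\in L^2(\mathbb R)^2$, $$(T_{z_1}F)(x)=F(x)+2\Phi^{(1)}(z_1,x)\Big[\int_{-\infty}^x\Psi_-(z_1,x')^\top\sigma_1F(x')dx'-\int_x^\infty\Psi_+(z_1,x')^\top\sigma_1F(x')dx'\Big],$$ $$(\widehat S_{\overline{z_1}}F)(x)=F(x)+2\mathcal K\Psi_+(z_1,x)\int_{-\infty}^x(\mathcal K\Phi^{(1)}(z_1,x'))^\top\sigma_1F(x')dx'-2\mathcal K\Psi_-(z_1,x)\int_x^\infty(\mathcal K\Phi^{(1)}(z_1,x'))^\top\sigma_1F(x')dx'.$$ $S_{\overline{z_1}}$ is the restriction of $\widehat S_{\overline{z_1}}$ to $\{\mathcal K\Phi^{(1)}(z_1)\}^{\perp_{\mathcal J}}$, and $S_{z_1,\overline{z_1}}$ its restriction to $\{\Phi^{(1)}(z_1),\mathcal K\Phi^{(1)}(z_1)\}^{\perp_{\mathcal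 J}}$. *)

theory Defs
  imports "HOL-Analysis.Analysis"
begin

text \<open>Elements of L^2(R)^2 are represented by functions real => complex x complex,
  identified up to equality almost everywhere (Lebesgue measure).
  The pair (a,b) stands for the column vector (a,b)^T.\<close>

type_synonym vfun = "real \<Rightarrow> complex \<times> complex"

definition aeeq :: "vfun \<Rightarrow> vfun \<Rightarrow> bool" where
  "aeeq F G \<longleftrightarrow> (AE x in lborel. F x = G x)"

definition L1loc :: "(real \<Rightarrow> complex) \<Rightarrow> bool" where
  "L1loc q \<longleftrightarrow> q \<in> borel_measurable lborel \<and> (\<forall>a b. set_integrable lborel {a..b} q)"

definition L2 :: "vfun \<Rightarrow> bool" where
  "L2 F \<longleftrightarrow> F \<in> borel_measurable lborel \<and> integrable lborel (\<lambda>x. (norm (F x))\<^sup>2)"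

definition L2_on :: "real set \<Rightarrow> vfun \<Rightarrow> bool" where
  "L2_on S F \<longleftrightarrow> F \<in> borel_measurable lborel \<and> set_integrable lborel S (\<lambda>x. (norm (F x))\<^sup>2)"

definition L2norm :: "vfun \<Rightarrow> real" where
  "L2norm F = sqrt (\<integral>x. (norm (F x))\<^sup>2 \<partial>lborel)"

definition vzero :: vfun where "vzero = (\<lambda>x. (0, 0))"

definition smul :: "complex \<Rightarrow> complex \<times> complex \<Rightarrow> complex \<times> complex" where
  "smul c v = (c * fst v, c * snd v)"

definition vlin :: "complex \<Rightarrow> vfun \<Rightarrow> complex \<Rightarrow> vfun \<Rightarrow> vfun" where
  "vlin a F b G = (\<lambda>x. smul a (F x) + smul b (G x))"

definition abs_cont_on :: "real \<Rightarrow> real \<Rightarrow> (real \<Rightarrow> complex) \<Rightarrow> bool" where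
  "abs_cont_on c d f \<longleftrightarrow>
     (\<forall>\<epsilon>>0. \<exists>\<delta>>0. \<forall>(n::nat) (a::nat \<Rightarrow> real) (b::nat \<Rightarrow> real).
        (\<forall>i<n. c \<le> a i \<and> a i \<le> b i \<and> b i \<le> d) \<and>
        (\<forall>i<n. \<forall>j<n. i \<noteq> j \<longrightarrow> b i \<le> a j \<or> b j \<le> a i) \<and>
        (\<Sum>i<n. b i - a i) < \<delta>
        \<longrightarrow> (\<Sum>i<n. norm (f (b i) - f (a i))) < \<epsilon>)"

definition AC_loc :: "(real \<Rightarrow> complex) \<Rightarrow> bool" where
  "AC_loc f \<longleftrightarrow> (\<forall>c d. abs_cont_on c d f)"

definition AC_loc2 :: "vfun \<Rightarrow> bool" where
  "AC_loc2 F \<longleftrightarrow> AC_loc (\<lambda>x. fst (F x)) \<and> AC_loc (\<lambda>x. snd (F x))"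

definition wave_fun :: "(real \<Rightarrow> complex) \<Rightarrow> complex \<Rightarrow> vfun \<Rightarrow> bool" where
  "wave_fun q z P \<longleftrightarrow> AC_loc2 P \<and> P \<noteq> vzero \<and>
     (AE x in lborel.
        ((\<lambda>t. fst (P t)) has_vector_derivative (- \<i> * z * fst (P x) + q x * snd (P x))) (at x) \<and>
        ((\<lambda>t. snd (P t)) has_vector_derivative (\<i> * z * snd (P x) - cnj (q x) * fst (P x))) (at x))"

definition Dgraph :: "(real \<Rightarrow> complex) \<Rightarrow> vfun \<Rightarrow> vfun \<Rightarrow> bool" where
  "Dgraph q F G \<longleftrightarrow> L2 F \<and> L2 G \<and>
     (\<exists>Ft d1 d2. AC_loc2 Ft \<and> aeeq F Ft \<and>
        (AE x in lborel.
           ((\<lambda>t. fst (Ft t)) has_vector_derivative d1 x) (at x) \<and>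
           ((\<lambda>t. snd (Ft t)) has_vector_derivative d2 x) (at x) \<and>
           G x = (\<i> * (d1 x - q x * snd (Ft x)), \<i> * (- cnj (q x) * fst (Ft x) - d2 x))))"

definition resolvent_set :: "(real \<Rightarrow> complex) \<Rightarrow> complex set" where
  "resolvent_set q = {z.
     (\<forall>G. L2 G \<longrightarrow> (\<exists>F. Dgraph q F (\<lambda>x. G x + smul z (F x)))) \<and>
     (\<exists>C. \<forall>F G. Dgraph q F (\<lambda>x. G x + smul z (F x)) \<longrightarrow> L2norm F \<le> C * L2norm G)}"

text \<open>Bilinear form G^T sigma_1 F, and the J-orthogonality.\<close>
definition bil :: "complex \<times> complex \<Rightarrow> complex \<times> complex \<Rightarrow> complex" where
  "bil g f = fst g * snd f + snd g * fst f"

definition Jprod :: "vfun \<Rightarrow> vfun \<Rightarrow> complex" where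
  "Jprod F G = (\<integral>x. bil (G x) (F x) \<partial>lborel)"

definition Jorth :: "vfun \<Rightarrow> vfun \<Rightarrow> bool" where
  "Jorth F G \<longleftrightarrow> Jprod F G = 0"

definition Kv :: "complex \<times> complex \<Rightarrow> complex \<times> complex" where
  "Kv v = (cnj (snd v), - cnj (fst v))"

definition Kop :: "vfun \<Rightarrow> vfun" where
  "Kop F = (\<lambda>x. Kv (F x))"

text \<open>Data built from the chosen Weyl solutions Psi_- (Pm) and Psi_+ (Pp).\<close>
definition Psi_sum :: "vfun \<Rightarrow> vfun \<Rightarrow> vfun" where
  "Psi_sum Pm Pp = (\<lambda>x. Pm x + Pp x)"

definition q1 :: "(real \<Rightarrow> complex) \<Rightarrow> complex \<Rightarrow> vfun \<Rightarrow> vfun \<Rightarrow> real \<Rightarrow> complex" where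
  "q1 q z Pm Pp = (\<lambda>x. q x + 4 * complex_of_real (Im z) * fst (Psi_sum Pm Pp x) * cnj (snd (Psi_sum Pm Pp x))
                        / complex_of_real ((norm (Psi_sum Pm Pp x))\<^sup>2))"

definition Phi1 :: "complex \<Rightarrow> vfun \<Rightarrow> vfun \<Rightarrow> vfun" where
  "Phi1 z Pm Pp = (\<lambda>x. smul (complex_of_real (Im z / (norm (Psi_sum Pm Pp x))\<^sup>2)) (Kv (Psi_sum Pm Pp x)))"

definition Top :: "complex \<Rightarrow> vfun \<Rightarrow> vfun \<Rightarrow> vfun \<Rightarrow> vfun" where
  "Top z Pm Pp F = (\<lambda>x. F x + smul (2 * ((LINT x'|lborel. indicator {..x} x' *\<^sub>R bil (Pm x') (F x'))
                                       - (LINT x'|lborel. indicator {x..} x' *\<^sub>R bil (Pp x') (F x'))))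
                                  (Phi1 z Pm Pp x))"

definition Shat :: "complex \<Rightarrow> vfun \<Rightarrow> vfun \<Rightarrow> vfun \<Rightarrow> vfun" where
  "Shat z Pm Pp F = (\<lambda>x. F x
      + smul (2 * (LINT x'|lborel. indicator {..x} x' *\<^sub>R bil (Kv (Phi1 z Pm Pp x')) (F x'))) (Kv (Pp x))
      - smul (2 * (LINT x'|lborel. indicator {x..} x' *\<^sub>R bil (Kv (Phi1 z Pm Pp x')) (F x'))) (Kv (Pm x)))"

definition bounded_linear_L2 :: "(vfun \<Rightarrow> bool) \<Rightarrow> (vfun \<Rightarrow> vfun) \<Rightarrow> bool" where
  "bounded_linear_L2 A T \<longleftrightarrow>
     (\<forall>F G. L2 F \<and> A F \<and> L2 G \<and> A G \<and> aeeq F G \<longrightarrow> aeeq (T F) (T G)) \<and>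
     (\<forall>F. L2 F \<and> A F \<longrightarrow> L2 (T F)) \<and>
     (\<forall>F G a b. L2 F \<and> A F \<and> L2 G \<and> A G \<longrightarrow> aeeq (T (vlin a F b G)) (vlin a (T F) b (T G))) \<and>
     (\<exists>C. \<forall>F. L2 F \<and> A F \<longrightarrow> L2norm (T F) \<le> C * L2norm F)"

end

(*
  Write Psi = Psi_- + Psi_+,
  N = |Psi|^2, W = det (Psi_-, Psi_+).

  The derivative of |Psi|^2 does not involve q, so wave functions grow at most exponentially,
  and W <> 0 since otherwise Psi_- would be an eigenfunction. Testing the resolvent bound on
  functions supported in [R - 1, R] gives |Psi_-(R)|^2 * int_R^oo |Psi_+|^2 <= A uniformly in R.
  With |W| <= |Psi_-| |Psi_+| this is a differential inequality for the tail integral, hence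
  |Psi_+(x)| |Psi_-(y)| <= C exp (-e (x - y)) for y <= x. Since |W| <= |Psi_-| |Psi| and
  |W| <= |Psi_+| |Psi|, all kernels occurring in T and S are dominated by exp (-e |x - y|),
  and Schur's test bounds them.

  With h the bracket in the definition of T, the function -Im z h / N is an antiderivative of
  (K Phi)^T sigma_1 T F that vanishes at both ends; this gives S T = I and ran T in (K Phi)^perp.
  Similarly (Im z / W) <Psi_+ a + Psi_- b, Psi> / N, where a and b are the two integrals in T,
  is an antiderivative of Phi^T sigma_1 T F. Conversely T S G = G + c Phi for G in (K Phi)^perp, and c = 0 if
  also G is J-orthogonal to Phi because the J-product of Phi with itself is -Im z / (2 W) <> 0.

  The intertwining relations follow from the Lagrange identity
  det (P, F)' = i P^T sigma_1 M(q) F - i z P^T sigma_1 F for z-wave functions P, applied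
  to Psi_-, Psi_+ (for q) and to Phi, K Phi (for the transformed potential).
*)
theory Submission
  imports Defs
begin

section \<open>Absolutely continuous functions and the Henstock-Kurzweil integral\<close>

text \<open>With \<open>q\<close> only locally integrable, wave functions and domain elements have
  derivatives merely almost everywhere. The calculus therefore rests on integral identities: a gauge
  argument turns absolute continuity plus an a.e. derivative into such an identity, and Fubini makes
  the identities stable under products. Where an integral occurring in T or S must have a pointwise
  derivative, the argument is first replaced by its continuous representative, so that the
  derivative is classical.

  The decay estimate is the crux because square integrability of \<open>Pp\<close> on the right and
  \<open>Pm\<close> on the left says nothing about products |Psi_+(x)| |Psi_-(y)|, where one factor
  may grow. Its constants involve only Im z, \<open>W\<close> and the resolvent bound;
  \<open>q\<close> enters in no other way.

  The factor 2 in T is what makes 2 Psi^T sigma_1 Phi equal to - N'/N. The terms with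
  \<open>h\<close> then form the quotient rule for h/N, and the potential of the transformed
  operator is exactly what the remaining terms require.\<close>

lemma abs_cont_on_tagged_partial_division:
  assumes ac: "abs_cont_on a b f" and "e > 0"
  shows "\<exists>\<delta>>0. \<forall>p. p tagged_partial_division_of {a..b} \<and> (\<Sum>(x,K)\<in>p. measure lborel K) < \<delta>
            \<longrightarrow> (\<Sum>(x,K)\<in>p. norm (f (Sup K) - f (Inf K))) < e"
proof -
  obtain \<delta> where "\<delta> > 0" and \<delta>0: "\<forall>(n::nat) u v.
        (\<forall>i<n. a \<le> u i \<and> u i \<le> v i \<and> v i \<le> b) \<and>
        (\<forall>i<n. \<forall>j<n. i \<noteq> j \<longrightarrow> v i \<le> u j \<or> v j \<le> u i) \<and>
        (\<Sum>i<n. v i - u i) < \<delta>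
        \<longrightarrow> (\<Sum>i<n. norm (f (v i) - f (u i))) < e"
    using ac[unfolded abs_cont_on_def, rule_format, OF \<open>e > 0\<close>] by blast
  note \<delta> = \<delta>0[rule_format, OF conjI[OF _ conjI]]
  show ?thesis
  proof (intro exI[of _ \<delta>] conjI allI impI \<open>\<delta> > 0\<close>, elim conjE)
    fix p :: "(real \<times> real set) set"
    assume p: "p tagged_partial_division_of {a..b}" and len: "(\<Sum>(x,K)\<in>p. measure lborel K) < \<delta>"
    note pD = tagged_partial_division_ofD[OF p]
    have intv: "\<exists>u v. K = {u..v} \<and> u \<le> v" if "(x,K) \<in> p" for x K
      using pD(4)[OF that] pD(2)[OF that] by fastforce
    have cont: "measure lborel K = Sup K - Inf K" "Inf K \<le> Sup K" "K = {Inf K..Sup K}" if "(x,K) \<in> p" for x K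
      using intv[OF that] by auto
    \<comment> \<open>A degenerate piece {c} may lie inside another piece, and disjoint interiors
      then give no ordering of the two. Such pieces contribute 0 to both sums, so they are dropped
      first.\<close>
    define p' where "p' = {(x,K)\<in>p. measure lborel K \<noteq> 0}"
    have "p' \<subseteq> p" by (auto simp: p'_def)
    then have "finite p'" using pD(1) finite_subset by blast
    obtain h where h: "bij_betw h {..<card p'} p'"
      using ex_bij_betw_nat_finite[OF \<open>finite p'\<close>] by (auto simp: lessThan_atLeast0)
    define u where "u i = Inf (snd (h i))" for i
    define v where "v i = Sup (snd (h i))" for i
    have hp: "h i \<in> p'" if "i < card p'" for i using h that by (auto simp: bij_betw_def)
    have hK: "(fst (h i), {u i..v i}) \<in> p" "u i < v i" if "i < card p'" for i
    proof -
      have *: "(fst (h i), snd (h i)) \<in> p" and **: "measure lborel (snd (h i)) \<noteq> 0"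
        using hp[OF that] by (auto simp: p'_def)
      then show "(fst (h i), {u i..v i}) \<in> p" "u i < v i"
        using cont[OF *] by (auto simp: u_def v_def)
    qed
    have "(\<Sum>i<card p'. norm (f (v i) - f (u i))) < e"
    proof (rule \<delta>)
      show "\<forall>i<card p'. a \<le> u i \<and> u i \<le> v i \<and> v i \<le> b"
        using pD(3)[OF hK(1)] hK(2) by fastforce
      show "\<forall>i<card p'. \<forall>j<card p'. i \<noteq> j \<longrightarrow> v i \<le> u j \<or> v j \<le> u i"
      proof (intro allI impI)
        fix i j assume ij: "i < card p'" "j < card p'" "i \<noteq> j"
        then have "h i \<noteq> h j" using h by (auto simp: bij_betw_def inj_on_def)
        moreover have "h i = (fst (h i), {u i..v i})" "h j = (fst (h j), {u j..v j})"
          using hp[OF ij(1)] hp[OF ij(2)] cont(3)[of "fst (h i)" "snd (h i)"]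
            cont(3)[of "fst (h j)" "snd (h j)"] unfolding u_def v_def p'_def
          by (auto intro!: prod_eqI)
        ultimately have "(fst (h i), {u i..v i}) \<noteq> (fst (h j), {u j..v j})" by argo
        from pD(5)[OF hK(1)[OF ij(1)] hK(1)[OF ij(2)] this]
        have "{u i<..<v i} \<inter> {u j<..<v j} = {}" by (simp add: interior_atLeastAtMost_real)
        moreover have "(max (u i) (u j) + min (v i) (v j)) / 2 \<in> {u i<..<v i} \<inter> {u j<..<v j}"
          if "max (u i) (u j) < min (v i) (v j)"
          using that by auto
        ultimately have "\<not> max (u i) (u j) < min (v i) (v j)" by blast
        then show "v i \<le> u j \<or> v j \<le> u i" using hK(2) ij by (auto simp: max_def min_def split: if_splits)
      qed
      have "(\<Sum>i<card p'. v i - u i) = (\<Sum>(x,K)\<in>p'. Sup K - Inf K)"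
        using sum.reindex_bij_betw[OF h, of "\<lambda>(x,K). Sup K - Inf K"]
        by (simp add: u_def v_def case_prod_unfold)
      also have "\<dots> \<le> (\<Sum>(x,K)\<in>p. measure lborel K)"
        using cont(1) \<open>p' \<subseteq> p\<close> by (intro sum_le_included[of _ _ _ "\<lambda>x. x"] \<open>finite p'\<close> pD(1)) force+
      finally show "(\<Sum>i<card p'. v i - u i) < \<delta>" using len by simp
    qed
    moreover have "(\<Sum>i<card p'. norm (f (v i) - f (u i))) = (\<Sum>(x,K)\<in>p'. norm (f (Sup K) - f (Inf K)))"
      using sum.reindex_bij_betw[OF h, of "\<lambda>(x,K). norm (f (Sup K) - f (Inf K))"]
      by (simp add: u_def v_def case_prod_unfold)
    moreover have "\<dots> = (\<Sum>(x,K)\<in>p. norm (f (Sup K) - f (Inf K)))"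
    proof (rule sum.mono_neutral_left[OF pD(1) \<open>p' \<subseteq> p\<close>], safe)
      fix x K assume "(x,K) \<in> p" "(x,K) \<notin> p'"
      then show "norm (f (Sup K) - f (Inf K)) = 0" using cont(1)[of x K] by (auto simp: p'_def)
    qed
    ultimately show "(\<Sum>(x,K)\<in>p. norm (f (Sup K) - f (Inf K))) < e" by simp
  qed
qed

text \<open>Pieces may share endpoints but have disjoint interiors, and an interval has the measure
  of its interior. The total length is thus the measure of a disjoint union inside
  \<open>T\<close>.\<close>

lemma sum_content_tagged_partial_division_le:
  fixes p :: "(real \<times> real set) set"
  assumes p: "p tagged_partial_division_of S" and T: "T \<in> lmeasurable"
    and sub: "\<And>x K. (x,K) \<in> p \<Longrightarrow> K \<subseteq> T"
  shows "(\<Sum>(x,K)\<in>p. measure lborel K) \<le> measure lebesgue T"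
proof -
  note pD = tagged_partial_division_ofD[OF p]
  have c: "measure lborel K = measure lebesgue (interior K)" if "(x,K) \<in> p" for x K
    using pD(4)[OF that] by (auto simp: interior_atLeastAtMost_real)
  have "(\<Sum>(x,K)\<in>p. measure lborel K) = (\<Sum>y\<in>p. measure lebesgue (interior (snd y)))"
    using c by (intro sum.cong) auto
  also have "\<dots> = measure lebesgue (\<Union>y\<in>p. interior (snd y))"
  proof (rule measure_finite_Union[symmetric])
    show "disjoint_family_on (\<lambda>y. interior (snd y)) p"
      using pD(5) unfolding disjoint_family_on_def by (metis prod.collapse)
    show "emeasure lebesgue (interior (snd y)) \<noteq> \<infinity>" if "y \<in> p" for y
    proof -
      have "(fst y, snd y) \<in> p" using that by simp
      then obtain u v where "snd y = cbox u v" using pD(4) by metis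
      then have "interior (snd y) = box u v" by simp
      then show ?thesis using emeasure_lborel_box_finite[of u v] by simp
    qed
  qed (use pD(1) in auto)
  also have "\<dots> \<le> measure lebesgue T"
  proof (rule measure_mono_fmeasurable[OF _ _ T])
    show "(\<Union>y\<in>p. interior (snd y)) \<subseteq> T"
    proof (rule UN_least)
      fix y assume "y \<in> p"
      then show "interior (snd y) \<subseteq> T"
        using sub[of "fst y" "snd y"] interior_subset[of "snd y"] by auto
    qed
  qed (use pD(1) in \<open>intro sets.finite_UN, auto\<close>)
  finally show ?thesis .
qed

text \<open>Off \<open>N\<close> the gauge comes from the derivative; on \<open>N\<close> it is cut out by an open cover of small
  measure, where absolute continuity bounds the increments of \<open>f\<close>.\<close>

proposition abs_cont_on_has_integral:
  fixes f :: "real \<Rightarrow> complex"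
  assumes "a \<le> b" and ac: "abs_cont_on a b f" and N: "negligible N"
    and der: "\<And>x. x \<notin> N \<Longrightarrow> (f has_vector_derivative f' x) (at x)"
  shows "(f' has_integral (f b - f a)) {a..b}"
proof -
  \<comment> \<open>\<open>f'\<close> is arbitrary on \<open>N\<close>. With the value 0 there, a
    tag in \<open>N\<close> contributes only an increment of \<open>f\<close>; the spike rule at the
    end restores \<open>f'\<close>.\<close>
  define g where "g x = (if x \<in> N then 0 else f' x)" for x
  have "(g has_integral (f b - f a)) {a..b}"
  proof (cases "a = b")
    case True then show ?thesis using has_integral_refl(2)[of g b] by simp
  next
    case False
    with \<open>a \<le> b\<close> have "a < b" by simp
    show ?thesis
      unfolding has_integral_factor_content_real
    proof (intro allI impI)
      fix e :: real assume "e > 0"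
      define e1 where "e1 = e / 2"
      define e2 where "e2 = e * (b - a) / 2"
      have "e1 > 0" "e2 > 0" using \<open>e > 0\<close> \<open>a < b\<close> by (auto simp: e1_def e2_def)
      obtain \<delta> where "\<delta> > 0" and \<delta>: "\<And>p. p tagged_partial_division_of {a..b} \<Longrightarrow>
          (\<Sum>(x,K)\<in>p. measure lborel K) < \<delta> \<Longrightarrow> (\<Sum>(x,K)\<in>p. norm (f (Sup K) - f (Inf K))) < e2"
        using abs_cont_on_tagged_partial_division[OF ac \<open>e2 > 0\<close>] by metis
      obtain T where T: "open T" "N \<subseteq> T" "T \<in> lmeasurable" "measure lebesgue T < \<delta>"
      proof -
        obtain T where T: "open T" "N \<subseteq> T" "T - N \<in> lmeasurable" "emeasure lebesgue (T - N) < ennreal \<delta>"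
          using sets_lebesgue_outer_open[OF negligible_imp_sets[OF N] \<open>\<delta> > 0\<close>] by metis
        have "(T - N) \<union> N \<in> lmeasurable" using T(3) negligible_imp_measurable[OF N] by blast
        moreover have "(T - N) \<union> N = T" using T by blast
        moreover have "measure lebesgue T = measure lebesgue (T - N)"
          using T N by (simp add: measure_Diff_null_set negligible_iff_null_sets)
        moreover have "measure lebesgue (T - N) < \<delta>"
          using T(3,4) \<open>\<delta> > 0\<close> by (simp add: emeasure_eq_measure2 ennreal_less_iff)
        ultimately show ?thesis using that[of T] T by simp
      qed
      have "\<exists>d>0. (x \<in> N \<longrightarrow> ball x d \<subseteq> T) \<and>
         (x \<notin> N \<longrightarrow> (\<forall>y. norm (y-x) < d \<longrightarrow> norm (f y - f x - (y-x) *\<^sub>R f' x) \<le> e1 * norm (y-x)))" for x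
      proof (cases "x \<in> N")
        case True then show ?thesis using T by (meson openE subsetD)
      next
        case False
        then show ?thesis using der[OF False] \<open>e1 > 0\<close>
          unfolding has_vector_derivative_def has_derivative_at_alt by auto
      qed
      then obtain d where d0: "\<And>x. d x > 0" and dN: "\<And>x. x \<in> N \<Longrightarrow> ball x (d x) \<subseteq> T"
        and d: "\<And>x y. x \<notin> N \<Longrightarrow> norm (y-x) < d x \<Longrightarrow> norm (f y - f x - (y-x) *\<^sub>R f' x) \<le> e1 * norm (y-x)"
        by metis
      show "\<exists>d. gauge d \<and> (\<forall>p. p tagged_division_of {a..b} \<and> d fine p \<longrightarrow>
               norm ((\<Sum>(x, K)\<in>p. measure lborel K *\<^sub>R g x) - (f b - f a)) \<le> e * measure lborel {a..b})"
      proof (rule exI, safe)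
        show "gauge (\<lambda>x. ball x (d x))" using d0 gauge_ball_dependent by blast
      next
        fix p assume ptag: "p tagged_division_of {a..b}" and fine: "(\<lambda>x. ball x (d x)) fine p"
        have "finite p" using ptag by auto
        have ba: "b - a = (\<Sum>(x,K)\<in>p. Sup K - Inf K)" "f b - f a = (\<Sum>(x,K)\<in>p. f(Sup K) - f(Inf K))"
          using additive_tagged_division_1[where f= "\<lambda>x. x"] additive_tagged_division_1[where f= f]
            \<open>a \<le> b\<close> ptag by auto
        define pN where "pN = {(x,K)\<in>p. x \<in> N}"
        have pN: "pN \<subseteq> p" by (auto simp: pN_def)
        have partN: "pN tagged_partial_division_of {a..b}"
          using ptag pN by (meson tagged_division_of_def tagged_partial_division_subset)
        have iv: "\<exists>u v. K = {u..v} \<and> u \<le> x \<and> x \<le> v \<and> {u..v} \<subseteq> ball x (d x)" if xK: "(x,K) \<in> p" for x K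
        proof -
          obtain u v where "K = cbox u v" "x \<in> K"
            using tagged_division_ofD(2,4)[OF ptag xK] by metis
          moreover have "K \<subseteq> ball x (d x)" using fineD[OF fine xK] .
          ultimately show ?thesis by auto
        qed
        have lenN: "(\<Sum>(x,K)\<in>pN. measure lborel K) < \<delta>"
        proof -
          have "(\<Sum>(x,K)\<in>pN. measure lborel K) \<le> measure lebesgue T"
          proof (rule sum_content_tagged_partial_division_le[OF partN T(3)])
            fix x K assume "(x,K) \<in> pN"
            then show "K \<subseteq> T" using iv[of x K] dN[of x] by (auto simp: pN_def)
          qed
          then show ?thesis using T by simp
        qed
        have 1: "(\<Sum>(x,K)\<in>pN. norm (measure lborel K *\<^sub>R g x - (f (Sup K) - f (Inf K)))) \<le> e2"
        proof -
          have "(\<Sum>(x,K)\<in>pN. norm (measure lborel K *\<^sub>R g x - (f (Sup K) - f (Inf K)))) =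
              (\<Sum>(x,K)\<in>pN. norm (f (Sup K) - f (Inf K)))"
            by (intro sum.cong) (auto simp: pN_def g_def norm_minus_commute)
          then show ?thesis using \<delta>[OF partN lenN] by simp
        qed
        have 2: "(\<Sum>(x,K)\<in>p-pN. norm (measure lborel K *\<^sub>R g x - (f (Sup K) - f (Inf K)))) \<le> e1 * (b - a)"
        proof -
          have "norm (measure lborel K *\<^sub>R g x - (f (Sup K) - f (Inf K))) \<le> e1 * (Sup K - Inf K)"
            if "(x,K) \<in> p - pN" for x K
          proof -
            have "x \<notin> N" "(x,K) \<in> p" using that by (auto simp: pN_def)
            then obtain u v where uv: "K = {u..v}" "u \<le> x" "x \<le> v" "{u..v} \<subseteq> ball x (d x)"
              using iv by blast
            have "norm (u - x) < d x" "norm (v - x) < d x"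
              using uv(2-4) subsetD[OF uv(4), of u] subsetD[OF uv(4), of v] by (auto simp: dist_real_def)
            then have "norm (f u - f x - (u-x) *\<^sub>R f' x) \<le> e1 * (x - u)"
                "norm (f v - f x - (v-x) *\<^sub>R f' x) \<le> e1 * (v - x)"
              using d[OF \<open>x \<notin> N\<close>, of u] d[OF \<open>x \<notin> N\<close>, of v] uv by auto
            moreover have *: "measure lborel K *\<^sub>R g x - (f (Sup K) - f (Inf K)) =
              (f u - f x - (u-x) *\<^sub>R f' x) - (f v - f x - (v-x) *\<^sub>R f' x)"
              using uv \<open>x \<notin> N\<close> by (simp add: g_def algebra_simps)
            ultimately have "norm (measure lborel K *\<^sub>R g x - (f (Sup K) - f (Inf K))) \<le> e1 * (x - u) + e1 * (v - x)"
              using norm_triangle_ineq4[of "f u - f x - (u-x) *\<^sub>R f' x" "f v - f x - (v-x) *\<^sub>R f' x"]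
              unfolding * by linarith
            then show ?thesis using uv by (simp add: algebra_simps)
          qed
          then have "(\<Sum>(x,K)\<in>p-pN. norm (measure lborel K *\<^sub>R g x - (f (Sup K) - f (Inf K))))
             \<le> (\<Sum>(x,K)\<in>p-pN. e1 * (Sup K - Inf K))"
            by (intro sum_mono) auto
          also have "\<dots> \<le> (\<Sum>(x,K)\<in>p. e1 * (Sup K - Inf K))"
          proof (rule sum_mono2[OF \<open>finite p\<close>])
            fix y assume "y \<in> p - (p - pN)"
            then show "0 \<le> (case y of (x, K) \<Rightarrow> e1 * (Sup K - Inf K))"
              using iv[of "fst y" "snd y"] \<open>e1 > 0\<close> by (auto simp: case_prod_unfold)
          qed auto
          also have "\<dots> = e1 * (b - a)"
            by (simp add: ba(1) sum_distrib_left case_prod_unfold)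
          finally show ?thesis .
        qed
        have "norm ((\<Sum>(x, K)\<in>p. measure lborel K *\<^sub>R g x) - (f b - f a))
           = norm (\<Sum>(x, K)\<in>p. measure lborel K *\<^sub>R g x - (f (Sup K) - f (Inf K)))"
          by (simp add: ba(2) sum_subtractf case_prod_unfold)
        also have "\<dots> \<le> (\<Sum>(x,K)\<in>p. norm (measure lborel K *\<^sub>R g x - (f (Sup K) - f (Inf K))))"
          using norm_sum by (simp add: case_prod_unfold)
        also have "\<dots> = (\<Sum>(x,K)\<in>p-pN. norm (measure lborel K *\<^sub>R g x - (f (Sup K) - f (Inf K))))
           + (\<Sum>(x,K)\<in>pN. norm (measure lborel K *\<^sub>R g x - (f (Sup K) - f (Inf K))))"
          by (rule sum.subset_diff[OF pN \<open>finite p\<close>])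
        also have "\<dots> \<le> e * (b - a)" using 1 2 by (simp add: e1_def e2_def)
        finally show "norm ((\<Sum>(x, K)\<in>p. measure lborel K *\<^sub>R g x) - (f b - f a)) \<le> e * measure lborel {a..b}"
          using \<open>a \<le> b\<close> by simp
      qed
    qed
  qed
  then show ?thesis
    by (rule has_integral_spike[OF N, rotated]) (simp add: g_def)
qed

section \<open>Primitives of locally integrable functions\<close>

text \<open>Encoded by the integral identity and not by a derivative, so that total integrals,
  limits at infinity and uniqueness up to a constant can be read off without differentiating
  anything.\<close>

definition primitive :: "(real \<Rightarrow> complex) \<Rightarrow> (real \<Rightarrow> complex) \<Rightarrow> bool" where
  "primitive F f \<longleftrightarrow> L1loc f \<and> (\<forall>a b. a \<le> b \<longrightarrow> (LINT x:{a..b}|lborel. f x) = F b - F a)"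

lemma L1loc_set_integrable: "L1loc f \<Longrightarrow> set_integrable lborel {a..b} f"
  by (simp add: L1loc_def)

lemma L1loc_add: "L1loc f \<Longrightarrow> L1loc g \<Longrightarrow> L1loc (\<lambda>x. f x + g x)"
  by (auto simp: L1loc_def intro!: set_integral_add)

lemma L1loc_diff: "L1loc f \<Longrightarrow> L1loc g \<Longrightarrow> L1loc (\<lambda>x. f x - g x)"
  by (auto simp: L1loc_def intro!: set_integral_diff)

lemma L1loc_cmult: "L1loc f \<Longrightarrow> L1loc (\<lambda>x. c * f x)"
  by (auto simp: L1loc_def)

lemma borel_measurable_cnj [measurable (raw)]:
  "f \<in> borel_measurable M \<Longrightarrow> (\<lambda>x. cnj (f x)) \<in> borel_measurable M"
  by (rule borel_measurable_continuous_on[where f = cnj]) (auto intro: continuous_intros)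

lemma L1loc_cnj: "L1loc f \<Longrightarrow> L1loc (\<lambda>x. cnj (f x))"
  using integrable_cnj[of lborel "\<lambda>x. indicator {a..b} x *\<^sub>R f x" for a b]
  by (auto simp: L1loc_def set_integrable_def borel_measurable_cnj)

lemma L1loc_continuous: "continuous_on UNIV f \<Longrightarrow> L1loc f"
  by (auto simp: L1loc_def borel_measurable_continuous_onI
      intro!: borel_integrable_atLeastAtMost' elim: continuous_on_subset)

lemma L1loc_mult_continuous:
  assumes f: "L1loc f" and G: "continuous_on UNIV G"
  shows "L1loc (\<lambda>x. f x * G x)"
proof -
  have [measurable]: "f \<in> borel_measurable borel" "G \<in> borel_measurable borel"
    using f G by (auto simp: L1loc_def borel_measurable_continuous_onI)
  have "set_integrable lborel {a..b} (\<lambda>x. f x * G x)" for a b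
  proof -
    have "compact (G ` {a..b})"
      using G by (intro compact_continuous_image) (auto elim: continuous_on_subset)
    then obtain B where "\<forall>y\<in>G ` {a..b}. norm y \<le> B"
      using compact_imp_bounded bounded_iff by blast
    then have B: "norm (G x) \<le> B" if "x \<in> {a..b}" for x using that by blast
    have "set_integrable lborel {a..b} (\<lambda>x. of_real B * f x)"
      using f by (simp add: L1loc_def)
    then show ?thesis
    proof (rule set_integrable_bound)
      show "AE x in lborel. x \<in> {a..b} \<longrightarrow> norm (f x * G x) \<le> norm (of_real B * f x)"
      proof (intro AE_I2 impI)
        fix x assume "x \<in> {a..b}"
        then have "norm (G x) \<le> \<bar>B\<bar>" using B by force
        then have "norm (f x) * norm (G x) \<le> norm (f x) * \<bar>B\<bar>" by (intro mult_left_mono) auto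
        then show "norm (f x * G x) \<le> norm (of_real B * f x)"
          by (simp add: norm_mult mult.commute)
      qed
    qed (simp add: set_borel_measurable_def)
  qed
  then show ?thesis by (simp add: L1loc_def)
qed

lemma primitive_L1loc: "primitive F f \<Longrightarrow> L1loc f"
  by (simp add: primitive_def)

lemma primitive_diff_eq: "primitive F f \<Longrightarrow> a \<le> b \<Longrightarrow> (LINT x:{a..b}|lborel. f x) = F b - F a"
  by (simp add: primitive_def)

lemma primitive_const: "primitive (\<lambda>x. c) (\<lambda>x. 0)"
  by (simp add: primitive_def L1loc_def set_integrable_def)

lemma primitive_add: "primitive F f \<Longrightarrow> primitive G g \<Longrightarrow> primitive (\<lambda>x. F x + G x) (\<lambda>x. f x + g x)"
  by (simp add: primitive_def L1loc_add set_integral_add L1loc_set_integrable)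

lemma primitive_diff: "primitive F f \<Longrightarrow> primitive G g \<Longrightarrow> primitive (\<lambda>x. F x - G x) (\<lambda>x. f x - g x)"
  by (simp add: primitive_def L1loc_diff set_integral_diff L1loc_set_integrable)

lemma primitive_cmult: "primitive F f \<Longrightarrow> primitive (\<lambda>x. c * F x) (\<lambda>x. c * f x)"
  by (simp add: primitive_def L1loc_cmult right_diff_distrib)

lemma primitive_cnj: "primitive F f \<Longrightarrow> primitive (\<lambda>x. cnj (F x)) (\<lambda>x. cnj (f x))"
proof -
  assume F: "primitive F f"
  have "(LINT x:{a..b}|lborel. cnj (f x)) = cnj (LINT x:{a..b}|lborel. f x)" for a b
    using Bochner_Integration.integral_cnj[of lborel "\<lambda>x. indicator {a..b} x *\<^sub>R f x"]
    by (simp add: set_lebesgue_integral_def)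
  with F show ?thesis by (simp add: primitive_def L1loc_cnj)
qed

lemma primitive_cong:
  "primitive F f \<Longrightarrow> (\<And>x. F x = G x) \<Longrightarrow> (\<And>x. f x = g x) \<Longrightarrow> primitive G g"
  by (metis ext)

lemma primitive_has_integral:
  assumes "primitive F f" "a \<le> b"
  shows "(f has_integral F b - F a) {a..b}"
  using set_borel_integral_eq_integral[OF L1loc_set_integrable[OF primitive_L1loc[OF assms(1)]], of a b]
    primitive_diff_eq[OF assms] by (metis integrable_integral)

lemma primitive_continuous:
  assumes F: "primitive F f"
  shows "continuous_on UNIV F"
proof -
  have "isCont F x" for x
  proof -
    have *: "F y = F (x - 1) + integral {x-1..y} f" if "y \<in> {x-1..x+1}" for y
      using primitive_has_integral[OF F, of "x-1" y] that by (simp add: integral_unique)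
    have "continuous_on {x-1..x+1} (\<lambda>y. F (x - 1) + integral {x-1..y} f)"
      using primitive_has_integral[OF F, of "x-1" "x+1"]
      by (intro continuous_intros indefinite_integral_continuous_1) auto
    then have "continuous_on {x-1..x+1} F"
      by (rule continuous_on_eq) (rule *[symmetric])
    then show ?thesis
      by (rule continuous_on_interior) (simp add: interior_atLeastAtMost_real)
  qed
  then show ?thesis by (simp add: continuous_on_eq_continuous_at)
qed

lemma primitive_has_vector_derivative:
  assumes F: "primitive F f" and f: "continuous_on UNIV f"
  shows "(F has_vector_derivative f x) (at x)"
proof -
  have "((\<lambda>y. F (x - 1) + integral {x-1..y} f) has_vector_derivative 0 + f x) (at x within {x-1..x+1})"
    using f by (intro has_vector_derivative_add has_vector_derivative_const
        integral_has_vector_derivative) (auto elim: continuous_on_subset)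
  then have "(F has_vector_derivative 0 + f x) (at x within {x-1..x+1})"
  proof (rule has_vector_derivative_transform[rotated 2])
    show "F y = F (x - 1) + integral {x-1..y} f" if "y \<in> {x-1..x+1}" for y
      using primitive_has_integral[OF F, of "x-1" y] that by (simp add: integral_unique)
  qed simp
  then show ?thesis
    using at_within_Icc_at[of "x - 1" x "x + 1"] by simp
qed

lemma primitive_if_has_vector_derivative:
  assumes F: "\<And>x. (F has_vector_derivative f x) (at x)" and f: "continuous_on UNIV f"
  shows "primitive F f"
  unfolding primitive_def
proof (intro conjI allI impI L1loc_continuous[OF f])
  fix a b :: real assume "a \<le> b"
  have "(f has_integral F b - F a) {a..b}"
    using F \<open>a \<le> b\<close> by (intro fundamental_theorem_of_calculus) (auto intro: has_vector_derivative_at_within)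
  then show "(LINT x:{a..b}|lborel. f x) = F b - F a"
    using set_borel_integral_eq_integral(2)[OF L1loc_set_integrable[OF L1loc_continuous[OF f]], of a b]
    by (simp add: integral_unique)
qed

text \<open>The exceptional null set is negligible, so the gauge argument yields a Henstock-Kurzweil
  integral; local integrability of \<open>f\<close> identifies it with the Lebesgue
  integral.\<close>

lemma AC_loc_imp_primitive:
  assumes F: "AC_loc F" and f: "L1loc f"
    and der: "AE x in lborel. (F has_vector_derivative f x) (at x)"
  shows "primitive F f"
  unfolding primitive_def
proof (intro conjI allI impI f)
  fix a b :: real assume "a \<le> b"
  obtain N where N: "N \<in> null_sets lborel" "\<And>x. x \<notin> N \<Longrightarrow> (F has_vector_derivative f x) (at x)"
    using der by (elim AE_E) (auto simp: null_sets_def)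
  have "negligible N"
    using N(1) by (simp add: negligible_iff_null_sets null_sets_completionI)
  then have "(f has_integral F b - F a) {a..b}"
    using abs_cont_on_has_integral[OF \<open>a \<le> b\<close>, of F N f] F N(2) by (auto simp: AC_loc_def)
  then show "(LINT x:{a..b}|lborel. f x) = F b - F a"
    using set_borel_integral_eq_integral(2)[OF L1loc_set_integrable[OF f], of a b]
    by (simp add: integral_unique)
qed

text \<open>Absolute continuity of the integral: |f| is cut at a height above which the excess has
  integral below \<epsilon>/2, and the bounded part is controlled by the total length of the
  intervals.\<close>

lemma primitive_imp_AC_loc:
  assumes F: "primitive F f"
  shows "AC_loc F"
  unfolding AC_loc_def abs_cont_on_def
proof (intro allI impI)
  fix c d \<epsilon> :: real assume "\<epsilon> > 0"
  have [measurable]: "f \<in> borel_measurable borel"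
    using F by (auto simp: primitive_def L1loc_def)
  define g where "g x = norm (indicator {c..d} x *\<^sub>R f x)" for x
  have g: "integrable lborel g"
    using L1loc_set_integrable[OF primitive_L1loc[OF F], of c d]
    unfolding set_integrable_def g_def by (rule integrable_norm)
  have [measurable]: "g \<in> borel_measurable borel" unfolding g_def by measurable
  have g0: "g x \<ge> 0" for x by (simp add: g_def)
  have gm: "integrable lborel (\<lambda>x. min (g x) M)" if "M \<ge> 0" for M
    by (rule Bochner_Integration.integrable_bound[OF g]) (use g0 that in auto)
  have "(\<lambda>n. LINT x|lborel. min (g x) (real n)) \<longlonglongrightarrow> (LINT x|lborel. g x)"
  proof (rule integral_dominated_convergence[where w = g])
    show "AE x in lborel. (\<lambda>n. min (g x) (real n)) \<longlonglongrightarrow> g x"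
    proof (intro AE_I2 tendsto_eventually)
      fix x
      obtain m where "g x \<le> real m" using real_arch_simple by blast
      then show "\<forall>\<^sub>F n in sequentially. min (g x) (real n) = g x"
        by (intro eventually_sequentiallyI[of m]) (auto simp: min_def)
    qed
  qed (use g g0 in auto)
  then have "\<forall>\<^sub>F n in sequentially. dist (LINT x|lborel. min (g x) (real n)) (LINT x|lborel. g x) < \<epsilon>/2"
    using \<open>\<epsilon> > 0\<close> half_gt_zero unfolding tendsto_iff by blast
  then obtain n0 where n0: "dist (LINT x|lborel. min (g x) (real n0)) (LINT x|lborel. g x) < \<epsilon>/2"
    by (auto simp: eventually_sequentially)
  \<comment> \<open>The shift by 1 keeps \<open>M\<close> positive even if \<open>n0\<close> is 0,
    so that \<epsilon> / (2 M) is a legitimate \<delta>.\<close>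
  define M where "M = real n0 + 1"
  define r where "r x = g x - min (g x) (real n0)" for x
  have r: "integrable lborel r" "\<And>x. r x \<ge> 0" "(LINT x|lborel. r x) < \<epsilon>/2"
  proof -
    show "integrable lborel r" unfolding r_def using g gm[of "real n0"] by simp
    show "r x \<ge> 0" for x by (simp add: r_def)
    have "(LINT x|lborel. r x) = (LINT x|lborel. g x) - (LINT x|lborel. min (g x) (real n0))"
      unfolding r_def using g gm[of "real n0"] by simp
    then show "(LINT x|lborel. r x) < \<epsilon>/2" using n0 unfolding dist_real_def by linarith
  qed
  have "M > 0" by (simp add: M_def)
  show "\<exists>\<delta>>0. \<forall>(n::nat) a b.
        (\<forall>i<n. c \<le> a i \<and> a i \<le> b i \<and> b i \<le> d) \<and>
        (\<forall>i<n. \<forall>j<n. i \<noteq> j \<longrightarrow> b i \<le> a j \<or> b j \<le> a i) \<and>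
        (\<Sum>i<n. b i - a i) < \<delta>
        \<longrightarrow> (\<Sum>i<n. norm (F (b i) - F (a i))) < \<epsilon>"
  proof (intro exI[of _ "\<epsilon> / (2 * M)"] conjI allI impI; (elim conjE)?)
    show "0 < \<epsilon> / (2 * M)" using \<open>\<epsilon> > 0\<close> \<open>M > 0\<close> by simp
    fix n :: nat and a b :: "nat \<Rightarrow> real"
    assume 1: "\<forall>i<n. c \<le> a i \<and> a i \<le> b i \<and> b i \<le> d"
      and 2: "\<forall>i<n. \<forall>j<n. i \<noteq> j \<longrightarrow> b i \<le> a j \<or> b j \<le> a i"
      and 3: "(\<Sum>i<n. b i - a i) < \<epsilon> / (2 * M)"
    have ir: "integrable lborel (\<lambda>x. indicator {a i..<b i} x * r x)" for i
      using integrable_mult_indicator[of "{a i..<b i}" lborel r] r(1) by simp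
    have step: "norm (F (b i) - F (a i)) \<le> (LINT x|lborel. indicator {a i..<b i} x * r x) + M * (b i - a i)"
      if "i < n" for i
    proof -
      have i: "c \<le> a i" "a i \<le> b i" "b i \<le> d" using 1 that by auto
      have "F (b i) - F (a i) = (LINT x|lborel. indicator {a i..b i} x *\<^sub>R f x)"
        using primitive_diff_eq[OF F i(2)] by (simp add: set_lebesgue_integral_def)
      \<comment> \<open>Half-open intervals stay disjoint when they abut, which makes their
        indicators sum to at most 1 at every point.\<close>
      also have "\<dots> = (LINT x|lborel. indicator {a i..<b i} x *\<^sub>R f x)"
      proof (rule integral_cong_AE)
        show "AE x in lborel. indicator {a i..b i} x *\<^sub>R f x = indicator {a i..<b i} x *\<^sub>R f x"
          using AE_lborel_singleton[of "b i"] by eventually_elim (auto simp: indicator_def)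
      qed auto
      also have "norm \<dots> \<le> (LINT x|lborel. norm (indicator {a i..<b i} x *\<^sub>R f x))"
        by (rule integral_norm_bound)
      also have "\<dots> \<le> (LINT x|lborel. indicator {a i..<b i} x * r x + M * indicator {a i..<b i} x)"
      proof (rule integral_mono)
        have "set_integrable lborel {a i..<b i} f"
          using L1loc_set_integrable[OF primitive_L1loc[OF F], of "a i" "b i"]
          by (rule set_integrable_subset) auto
        then show "integrable lborel (\<lambda>x. norm (indicator {a i..<b i} x *\<^sub>R f x))"
          unfolding set_integrable_def by (rule integrable_norm)
        show "integrable lborel (\<lambda>x. indicator {a i..<b i} x * r x + M * indicator {a i..<b i} x)"
          using ir i by (intro Bochner_Integration.integrable_add integrable_mult_right) (auto simp: integrable_indicator_iff)
        show "norm (indicator {a i..<b i} x *\<^sub>R f x) \<le> indicator {a i..<b i} x * r x + M * indicator {a i..<b i} x" for x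
          using i by (auto simp: indicator_def r_def g_def M_def min_def)
      qed
      also have "\<dots> = (LINT x|lborel. indicator {a i..<b i} x * r x) + M * (b i - a i)"
        using ir i by (subst Bochner_Integration.integral_add) (auto simp: integrable_indicator_iff)
      finally show ?thesis by (simp add: norm_minus_commute)
    qed
    have "(\<Sum>i<n. norm (F (b i) - F (a i)))
        \<le> (\<Sum>i<n. (LINT x|lborel. indicator {a i..<b i} x * r x) + M * (b i - a i))"
      using step by (intro sum_mono) auto
    also have "\<dots> = (\<Sum>i<n. (LINT x|lborel. indicator {a i..<b i} x * r x)) + M * (\<Sum>i<n. b i - a i)"
      by (simp add: sum.distrib sum_distrib_left)
    also have "(\<Sum>i<n. (LINT x|lborel. indicator {a i..<b i} x * r x)) = (LINT x|lborel. (\<Sum>i<n. indicator {a i..<b i} x * r x))"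
      using ir by (intro Bochner_Integration.integral_sum[symmetric]) auto
    also have "\<dots> \<le> (LINT x|lborel. r x)"
    proof (rule integral_mono)
      fix x
      have "(\<Sum>i<n. indicator {a i..<b i} x :: real) \<le> 1"
      proof (cases "\<exists>i<n. x \<in> {a i..<b i}")
        case True
        then obtain k where k: "k < n" "x \<in> {a k..<b k}" by blast
        have "indicator {a i..<b i} x = (if i = k then 1 else 0 :: real)" if "i < n" for i
          using k 2 that by (force simp: indicator_def)
        then have "(\<Sum>i<n. indicator {a i..<b i} x :: real) = (\<Sum>i<n. if i = k then 1 else 0)"
          by (intro sum.cong) auto
        then show ?thesis using k by simp
      next
        case False
        then have "(\<Sum>i<n. indicator {a i..<b i} x :: real) = 0" by (intro sum.neutral) (auto simp: indicator_def)
        then show ?thesis by simp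
      qed
      then show "(\<Sum>i<n. indicator {a i..<b i} x * r x) \<le> r x"
        using mult_right_mono[of "\<Sum>i<n. indicator {a i..<b i} x" 1 "r x"] r(2)[of x]
        by (simp add: sum_distrib_right)
    qed (rule Bochner_Integration.integrable_sum, rule ir, rule r(1))
    also have "M * (\<Sum>i<n. b i - a i) < M * (\<epsilon> / (2 * M))"
      using 3 \<open>M > 0\<close> by (intro mult_strict_left_mono) auto
    finally show "(\<Sum>i<n. norm (F (b i) - F (a i))) < \<epsilon>"
      using r(3) \<open>M > 0\<close> by simp
  qed
qed

text \<open>Integration by parts from Fubini: \<open>F x - F a\<close> is an inner integral of
  \<open>f\<close>, so exchanging the order over a triangle in [a,b]^2 turns the integral of (F - F
  a) g into one of \<open>f\<close> against the integral of \<open>g\<close> over [x,b]. Together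
  with the integral of f (G - G a) this gives the product of the two increments; the terms with
  \<open>F a\<close> and \<open>G a\<close> are added back at the end.\<close>

lemma primitive_mult:
  assumes F: "primitive F f" and G: "primitive G g"
  shows "primitive (\<lambda>x. F x * G x) (\<lambda>x. f x * G x + F x * g x)"
  unfolding primitive_def
proof (intro conjI allI impI)
  note cF = primitive_continuous[OF F] and cG = primitive_continuous[OF G]
  have fG: "L1loc (\<lambda>x. f x * G x)"
    by (rule L1loc_mult_continuous[OF primitive_L1loc[OF F] cG])
  have gF: "L1loc (\<lambda>x. F x * g x)"
    using L1loc_mult_continuous[OF primitive_L1loc[OF G] cF] by (simp add: mult.commute)
  show "L1loc (\<lambda>x. f x * G x + F x * g x)"
    by (rule L1loc_add[OF fG gF])
  fix a b :: real assume ab: "a \<le> b"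
  have [measurable]: "f \<in> borel_measurable borel" "g \<in> borel_measurable borel"
    using F G by (auto simp: primitive_def L1loc_def)
  define f1 where "f1 x = indicator {a..b} x *\<^sub>R f x" for x
  define g1 where "g1 x = indicator {a..b} x *\<^sub>R g x" for x
  have [measurable]: "f1 \<in> borel_measurable borel" "g1 \<in> borel_measurable borel"
    unfolding f1_def g1_def by measurable
  have f1: "integrable lborel f1" and g1: "integrable lborel g1"
    using L1loc_set_integrable[OF primitive_L1loc[OF F], of a b] L1loc_set_integrable[OF primitive_L1loc[OF G], of a b]
    by (simp_all add: set_integrable_def f1_def[abs_def] g1_def[abs_def])
  have If: "(LINT x|lborel. f1 x) = F b - F a" and Ig: "(LINT x|lborel. g1 x) = G b - G a"
    using primitive_diff_eq[OF F ab] primitive_diff_eq[OF G ab]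
    by (simp_all add: set_lebesgue_integral_def f1_def[abs_def] g1_def[abs_def])
  have Gx: "(LINT y|lborel. indicator {..x} y *\<^sub>R g1 y) = G x - G a" if "x \<in> {a..b}" for x
  proof -
    have "(\<lambda>y. indicator {..x} y *\<^sub>R g1 y) = (\<lambda>y. indicator {a..x} y *\<^sub>R g y)"
      using that by (auto simp: g1_def indicator_def)
    then show ?thesis using primitive_diff_eq[OF G, of a x] that by (simp add: set_lebesgue_integral_def)
  qed
  have Fx: "(LINT y|lborel. indicator {..x} y *\<^sub>R f1 y) = F x - F a" if "x \<in> {a..b}" for x
  proof -
    have "(\<lambda>y. indicator {..x} y *\<^sub>R f1 y) = (\<lambda>y. indicator {a..x} y *\<^sub>R f y)"
      using that by (auto simp: f1_def indicator_def)
    then show ?thesis using primitive_diff_eq[OF F, of a x] that by (simp add: set_lebesgue_integral_def)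
  qed
  have ig: "integrable lborel (\<lambda>y. indicator A y *\<^sub>R g1 y)" if "A \<in> sets borel" for A
    using integrable_mult_indicator[of A lborel g1] that g1 by simp
  have "integrable (lborel \<Otimes>\<^sub>M lborel) (\<lambda>(x, y). f1 x * g1 y)"
  proof (rule lborel_pair.Fubini_integrable)
    show "integrable lborel (\<lambda>x. LINT y|lborel. norm (case (x, y) of (x, y) \<Rightarrow> f1 x * g1 y))"
      using f1 by (simp add: norm_mult)
  qed (use g1 in auto)
  then have int2: "integrable (lborel \<Otimes>\<^sub>M lborel) (\<lambda>(x, y). indicator {..y} x *\<^sub>R (f1 x * g1 y))"
  proof (rule Bochner_Integration.integrable_bound)
    have "(\<lambda>(x, y). indicator {..y} x *\<^sub>R (f1 x * g1 y)) = (\<lambda>p. if fst p \<le> snd p then f1 (fst p) * g1 (snd p) else 0)"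
      by (auto simp: indicator_def)
    also have "\<dots> \<in> borel_measurable (lborel \<Otimes>\<^sub>M lborel)" by measurable
    finally show "(\<lambda>(x, y). indicator {..y} x *\<^sub>R (f1 x * g1 y)) \<in> borel_measurable (lborel \<Otimes>\<^sub>M lborel)" .
  qed (auto simp: indicator_def)
  have A: "(LINT x:{a..b}|lborel. f x * (G x - G a)) = (LINT x|lborel. f1 x * (LINT y|lborel. indicator {..x} y *\<^sub>R g1 y))"
    unfolding set_lebesgue_integral_def
  proof (rule Bochner_Integration.integral_cong[OF refl])
    show "indicator {a..b} x *\<^sub>R (f x * (G x - G a)) = f1 x * (LINT y|lborel. indicator {..x} y *\<^sub>R g1 y)" for x
      by (cases "x \<in> {a..b}") (simp_all only: f1_def Gx, auto)
  qed
  have "(LINT x:{a..b}|lborel. (F x - F a) * g x) = (LINT y|lborel. (LINT x|lborel. indicator {..y} x *\<^sub>R (f1 x * g1 y)))"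
    unfolding set_lebesgue_integral_def
  proof (rule Bochner_Integration.integral_cong)
    fix y
    have "(LINT x|lborel. indicator {..y} x *\<^sub>R (f1 x * g1 y)) = (LINT x|lborel. indicator {..y} x *\<^sub>R f1 x) * g1 y"
      by (subst integral_mult_left_zero[symmetric]) (simp add: scaleR_conv_of_real mult_ac)
    then show "indicator {a..b} y *\<^sub>R ((F y - F a) * g y) = (LINT x|lborel. indicator {..y} x *\<^sub>R (f1 x * g1 y))"
      by (cases "y \<in> {a..b}") (simp_all only: g1_def Fx, auto)
  qed simp
  also have "\<dots> = (LINT x|lborel. (LINT y|lborel. indicator {..y} x *\<^sub>R (f1 x * g1 y)))"
    by (rule lborel_pair.Fubini_integral[OF int2])
  also have "\<dots> = (LINT x|lborel. f1 x * (LINT y|lborel. indicator {x..} y *\<^sub>R g1 y))"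
  proof (rule Bochner_Integration.integral_cong[OF refl])
    fix x
    show "(LINT y|lborel. indicator {..y} x *\<^sub>R (f1 x * g1 y)) = f1 x * (LINT y|lborel. indicator {x..} y *\<^sub>R g1 y)"
      by (subst integral_mult_right_zero[symmetric], rule Bochner_Integration.integral_cong) (auto simp: indicator_def)
  qed
  finally have B: "(LINT x:{a..b}|lborel. (F x - F a) * g x) = (LINT x|lborel. f1 x * (LINT y|lborel. indicator {x..} y *\<^sub>R g1 y))" .
  have half: "(LINT y|lborel. indicator {..x} y *\<^sub>R g1 y) + (LINT y|lborel. indicator {x..} y *\<^sub>R g1 y) = G b - G a" for x
  proof -
    have "(LINT y|lborel. indicator {..x} y *\<^sub>R g1 y) + (LINT y|lborel. indicator {x..} y *\<^sub>R g1 y)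
       = (LINT y|lborel. indicator {..x} y *\<^sub>R g1 y + indicator {x..} y *\<^sub>R g1 y)"
      by (rule Bochner_Integration.integral_add[symmetric]) (auto intro!: ig)
    also have "\<dots> = (LINT y|lborel. g1 y)"
    proof (rule integral_cong_AE)
      show "AE y in lborel. indicator {..x} y *\<^sub>R g1 y + indicator {x..} y *\<^sub>R g1 y = g1 y"
        using AE_lborel_singleton[of x] by eventually_elim (auto simp: indicator_def)
    qed auto
    finally show ?thesis using Ig by simp
  qed
  have i1: "set_integrable lborel {a..b} (\<lambda>x. f x * (G x - G a))"
    by (intro L1loc_set_integrable L1loc_mult_continuous primitive_L1loc[OF F] continuous_intros cG)
  have i2: "set_integrable lborel {a..b} (\<lambda>x. (F x - F a) * g x)"
    using L1loc_set_integrable[OF L1loc_mult_continuous[OF primitive_L1loc[OF G], of "\<lambda>x. F x - F a"], of a b] cF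
    by (simp add: mult.commute continuous_on_diff)
  have iA: "integrable lborel (\<lambda>x. f1 x * (LINT y|lborel. indicator {..x} y *\<^sub>R g1 y))"
  proof -
    have "(\<lambda>x. f1 x * (LINT y|lborel. indicator {..x} y *\<^sub>R g1 y)) = (\<lambda>x. indicator {a..b} x *\<^sub>R (f x * (G x - G a)))"
    proof
      show "f1 x * (LINT y|lborel. indicator {..x} y *\<^sub>R g1 y) = indicator {a..b} x *\<^sub>R (f x * (G x - G a))" for x
        by (cases "x \<in> {a..b}") (simp_all only: f1_def Gx, auto)
    qed
    then show ?thesis using i1 by (simp add: set_integrable_def)
  qed
  have eqB: "(\<lambda>x. f1 x * (LINT y|lborel. indicator {x..} y *\<^sub>R g1 y)) = 
      (\<lambda>x. f1 x * (G b - G a) - f1 x * (LINT y|lborel. indicator {..x} y *\<^sub>R g1 y))"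
  proof
    fix x
    have "(LINT y|lborel. indicator {x..} y *\<^sub>R g1 y) = (G b - G a) - (LINT y|lborel. indicator {..x} y *\<^sub>R g1 y)"
      using half[of x] by (simp add: eq_diff_eq add.commute)
    then show "f1 x * (LINT y|lborel. indicator {x..} y *\<^sub>R g1 y) =
        f1 x * (G b - G a) - f1 x * (LINT y|lborel. indicator {..x} y *\<^sub>R g1 y)"
      by (simp only: right_diff_distrib)
  qed
  have AB: "(LINT x:{a..b}|lborel. f x * (G x - G a)) + (LINT x:{a..b}|lborel. (F x - F a) * g x) = (F b - F a) * (G b - G a)"
    unfolding A B eqB using f1 iA by (subst Bochner_Integration.integral_diff) (auto simp: If)
  have "(LINT x:{a..b}|lborel. f x * G x + F x * g x) =
     (LINT x:{a..b}|lborel. (f x * (G x - G a) + (F x - F a) * g x) + (G a * f x + F a * g x))"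
    by (simp add: algebra_simps)
  also have "\<dots> = (LINT x:{a..b}|lborel. f x * (G x - G a) + (F x - F a) * g x) + (LINT x:{a..b}|lborel. G a * f x + F a * g x)"
    using F G by (intro set_integral_add) (auto intro!: i1 i2 set_integral_add set_integrable_mult_right L1loc_set_integrable L1loc_cmult simp: primitive_def)
  also have "(LINT x:{a..b}|lborel. f x * (G x - G a) + (F x - F a) * g x) = (F b - F a) * (G b - G a)"
    using set_integral_add(2)[OF i1 i2] AB by simp
  also have "(LINT x:{a..b}|lborel. G a * f x + F a * g x) = G a * (F b - F a) + F a * (G b - G a)"
    using primitive_diff_eq[OF primitive_add[OF primitive_cmult[OF F, of "G a"] primitive_cmult[OF G, of "F a"]] ab]
    by (simp add: algebra_simps)
  finally show "(LINT x:{a..b}|lborel. f x * G x + F x * g x) = F b * G b - F a * G a"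
    by (simp add: algebra_simps)
qed

section \<open>Half-line integrals and boundary values at infinity\<close>

lemma primitive_integral_atMost:
  assumes F: "primitive F f" and int: "set_integrable lborel {..x} f" and l: "(F \<longlongrightarrow> l) at_bot"
  shows "(LINT y:{..x}|lborel. f y) = F x - l"
proof -
  have "((\<lambda>a. LINT y:{a..x}|lborel. f y) \<longlongrightarrow> (LINT y:{..x}|lborel. f y)) at_bot"
    by (rule tendsto_set_lebesgue_integral_at_bot) (use int in auto)
  moreover have "((\<lambda>a. LINT y:{a..x}|lborel. f y) \<longlongrightarrow> F x - l) at_bot"
  proof (rule Lim_transform_eventually)
    show "((\<lambda>a. F x - F a) \<longlongrightarrow> F x - l) at_bot" by (intro tendsto_intros l)
    show "\<forall>\<^sub>F a in at_bot. F x - F a = (LINT y:{a..x}|lborel. f y)"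
      using eventually_le_at_bot[of x] by eventually_elim (simp add: primitive_diff_eq[OF F])
  qed
  ultimately show ?thesis by (rule tendsto_unique[rotated]) simp
qed

lemma primitive_integral_atLeast:
  assumes F: "primitive F f" and int: "set_integrable lborel {x..} f" and l: "(F \<longlongrightarrow> l) at_top"
  shows "(LINT y:{x..}|lborel. f y) = l - F x"
proof -
  have "((\<lambda>a. LINT y:{x..a}|lborel. f y) \<longlongrightarrow> (LINT y:{x..}|lborel. f y)) at_top"
    by (rule tendsto_set_lebesgue_integral_at_top) (use int in auto)
  moreover have "((\<lambda>a. LINT y:{x..a}|lborel. f y) \<longlongrightarrow> l - F x) at_top"
  proof (rule Lim_transform_eventually)
    show "((\<lambda>a. F a - F x) \<longlongrightarrow> l - F x) at_top" by (intro tendsto_intros l)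
    show "\<forall>\<^sub>F a in at_top. F a - F x = (LINT y:{x..a}|lborel. f y)"
      using eventually_ge_at_top[of x] by eventually_elim (simp add: primitive_diff_eq[OF F])
  qed
  ultimately show ?thesis by (rule tendsto_unique[rotated]) simp
qed

lemma integral_split_at:
  fixes f :: "real \<Rightarrow> 'a::{banach, second_countable_topology}"
  assumes f: "integrable lborel f"
  shows "(LINT y|lborel. f y) = (LINT y:{..x}|lborel. f y) + (LINT y:{x..}|lborel. f y)"
proof -
  have [measurable]: "f \<in> borel_measurable borel" using f by auto
  have i: "integrable lborel (\<lambda>y. indicator {..x} y *\<^sub>R f y)" "integrable lborel (\<lambda>y. indicator {x..} y *\<^sub>R f y)"
    using integrable_mult_indicator[of "{..x}" lborel f] integrable_mult_indicator[of "{x..}" lborel f] f by auto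
  have "(LINT y|lborel. f y) = (LINT y|lborel. indicator {..x} y *\<^sub>R f y + indicator {x..} y *\<^sub>R f y)"
  proof (rule integral_cong_AE)
    show "AE y in lborel. f y = indicator {..x} y *\<^sub>R f y + indicator {x..} y *\<^sub>R f y"
      using AE_lborel_singleton[of x] by eventually_elim (auto simp: indicator_def)
  qed auto
  also have "\<dots> = (LINT y:{..x}|lborel. f y) + (LINT y:{x..}|lborel. f y)"
    unfolding set_lebesgue_integral_def by (rule Bochner_Integration.integral_add[OF i])
  finally show ?thesis .
qed

lemma set_integrable_UNIV_subset:
  fixes f :: "real \<Rightarrow> 'a::{banach, second_countable_topology}"
  shows "integrable lborel f \<Longrightarrow> A \<in> sets borel \<Longrightarrow> set_integrable lborel A f"
  using integrable_mult_indicator[of A lborel f] by (simp add: set_integrable_def)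

lemma primitive_integral_UNIV:
  assumes F: "primitive F f" and int: "integrable lborel f"
    and "(F \<longlongrightarrow> l) at_bot" "(F \<longlongrightarrow> m) at_top"
  shows "(LINT y|lborel. f y) = m - l"
  using integral_split_at[OF int, of 0] primitive_integral_atMost[OF F _ assms(3), of 0]
    primitive_integral_atLeast[OF F _ assms(4), of 0] set_integrable_UNIV_subset[OF int]
  by simp

lemma primitive_indefinite_atMost:
  assumes f: "f \<in> borel_measurable borel" and int: "\<And>x. set_integrable lborel {..x} f"
  shows "primitive (\<lambda>x. LINT y:{..x}|lborel. f y) f"
  unfolding primitive_def
proof (intro conjI allI impI)
  have i: "set_integrable lborel {a..b} f" for a b
    using int[of b] by (rule set_integrable_subset) auto
  then show "L1loc f" using f by (simp add: L1loc_def)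
  fix a b :: real assume "a \<le> b"
  then have "{..b} = {..a} \<union> {a..b}" by auto
  moreover have "(LINT y:{..a} \<union> {a..b}|lborel. f y) = (LINT y:{..a}|lborel. f y) + (LINT y:{a..b}|lborel. f y)"
  proof (rule set_integral_Un_AE)
    show "AE x in lborel. \<not> (x \<in> {..a} \<and> x \<in> {a..b})"
      using AE_lborel_singleton[of a] by eventually_elim auto
  qed (use int i in auto)
  ultimately show "(LINT x:{a..b}|lborel. f x) = (LINT y:{..b}|lborel. f y) - (LINT y:{..a}|lborel. f y)"
    by simp
qed

lemma primitive_indefinite_atLeast:
  assumes f: "f \<in> borel_measurable borel" and int: "\<And>x. set_integrable lborel {x..} f"
  shows "primitive (\<lambda>x. LINT y:{x..}|lborel. f y) (\<lambda>x. - f x)"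
  unfolding primitive_def
proof (intro conjI allI impI)
  have i: "set_integrable lborel {a..b} f" for a b
    using int[of a] by (rule set_integrable_subset) auto
  then have "L1loc f" using f by (simp add: L1loc_def)
  from L1loc_cmult[OF this, of "-1"] show "L1loc (\<lambda>x. - f x)" by simp
  fix a b :: real assume "a \<le> b"
  then have "{a..} = {a..b} \<union> {b..}" by auto
  moreover have "(LINT y:{a..b} \<union> {b..}|lborel. f y) = (LINT y:{a..b}|lborel. f y) + (LINT y:{b..}|lborel. f y)"
  proof (rule set_integral_Un_AE)
    show "AE x in lborel. \<not> (x \<in> {a..b} \<and> x \<in> {b..})"
      using AE_lborel_singleton[of b] by eventually_elim auto
  qed (use int i in auto)
  ultimately show "(LINT x:{a..b}|lborel. - f x) = (LINT y:{b..}|lborel. f y) - (LINT y:{a..}|lborel. f y)"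
    using set_integral_uminus[OF i, of a b] by simp
qed

lemma not_set_integrable_atLeast:
  fixes f :: "real \<Rightarrow> 'a::{banach, second_countable_topology}"
  assumes "set_integrable lborel {a..} f" "c > 0" "\<And>x. x \<ge> a \<Longrightarrow> c \<le> norm (f x)"
  shows False
proof -
  have "set_integrable lborel {a..} (\<lambda>x. c)"
    by (rule set_integrable_bound[OF assms(1)]) (use assms in \<open>auto simp: set_borel_measurable_def\<close>)
  then have "integrable lborel (\<lambda>x. indicator {a..} x *\<^sub>R c)" by (simp add: set_integrable_def)
  then have "integrable lborel (\<lambda>x. indicator {a..} x :: real)"
    using \<open>c > 0\<close> by simp
  then have "emeasure lborel {a..} < \<infinity>" by (simp add: integrable_indicator_iff)
  moreover have "emeasure lborel {a..} \<ge> ennreal (real n)" for n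
    using emeasure_mono[of "{a..a + real n}" "{a..}" lborel] by simp
  ultimately have "ennreal (real n) < \<infinity> \<and> real n \<le> enn2real (emeasure lborel {a..})" for n
    by (metis enn2real_mono enn2real_ennreal of_nat_0_le_iff ennreal_less_top infinity_ennreal_def)
  then show False using reals_Archimedean2 by (meson leD)
qed

lemma not_set_integrable_atMost:
  fixes f :: "real \<Rightarrow> 'a::{banach, second_countable_topology}"
  assumes "set_integrable lborel {..a} f" "c > 0" "\<And>x. x \<le> a \<Longrightarrow> c \<le> norm (f x)"
  shows False
proof -
  have "set_integrable lborel {..a} (\<lambda>x. c)"
    by (rule set_integrable_bound[OF assms(1)]) (use assms in \<open>auto simp: set_borel_measurable_def\<close>)
  then have "integrable lborel (\<lambda>x. indicator {..a} x *\<^sub>R c)" by (simp add: set_integrable_def)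
  then have "integrable lborel (\<lambda>x. indicator {..a} x :: real)"
    using \<open>c > 0\<close> by simp
  then have "emeasure lborel {..a} < \<infinity>" by (simp add: integrable_indicator_iff)
  moreover have "emeasure lborel {..a} \<ge> ennreal (real n)" for n
    using emeasure_mono[of "{a - real n..a}" "{..a}" lborel] by simp
  ultimately have "ennreal (real n) < \<infinity> \<and> real n \<le> enn2real (emeasure lborel {..a})" for n
    by (metis enn2real_mono enn2real_ennreal of_nat_0_le_iff ennreal_less_top infinity_ennreal_def)
  then show False using reals_Archimedean2 by (meson leD)
qed

text \<open>Integrability of \<open>f\<close> gives \<open>F\<close> a limit, and integrability of
  \<open>F\<close> excludes a nonzero one. Applied to the determinant of two square-integrable
  functions, this removes the boundary terms of the Lagrange identity.\<close>

lemma primitive_tendsto_0_at_top: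
  assumes F: "primitive F f" and f: "set_integrable lborel {a..} f" and iF: "set_integrable lborel {a..} F"
  shows "(F \<longlongrightarrow> 0) at_top"
proof -
  have "((\<lambda>b. LINT y:{a..b}|lborel. f y) \<longlongrightarrow> (LINT y:{a..}|lborel. f y)) at_top"
    by (rule tendsto_set_lebesgue_integral_at_top) (use f in auto)
  then have "((\<lambda>b. F a + (LINT y:{a..b}|lborel. f y)) \<longlongrightarrow> F a + (LINT y:{a..}|lborel. f y)) at_top"
    by (intro tendsto_intros)
  then have L: "(F \<longlongrightarrow> F a + (LINT y:{a..}|lborel. f y)) at_top" (is "(F \<longlongrightarrow> ?L) at_top")
  proof (rule Lim_transform_eventually)
    show "\<forall>\<^sub>F b in at_top. F a + (LINT y:{a..b}|lborel. f y) = F b"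
      using eventually_ge_at_top[of a] by eventually_elim (simp add: primitive_diff_eq[OF F])
  qed
  have "?L = 0"
  proof (rule ccontr)
    assume "?L \<noteq> 0"
    then have "\<forall>\<^sub>F b in at_top. norm ?L / 2 < norm (F b)"
      using order_tendstoD(1)[OF tendsto_norm[OF L], of "norm ?L / 2"] by simp
    then obtain b where b: "\<And>x. x \<ge> b \<Longrightarrow> norm ?L / 2 < norm (F x)"
      by (auto simp: eventually_at_top_linorder)
    have "set_integrable lborel {max a b..} F" using iF by (rule set_integrable_subset) auto
    then show False
      by (rule not_set_integrable_atLeast[where c = "norm ?L / 2"]) (use b \<open>?L \<noteq> 0\<close> in \<open>auto intro: less_imp_le\<close>)
  qed
  with L show ?thesis by simp
qed

lemma primitive_tendsto_0_at_bot:
  assumes F: "primitive F f" and f: "set_integrable lborel {..a} f" and iF: "set_integrable lborel {..a} F"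
  shows "(F \<longlongrightarrow> 0) at_bot"
proof -
  have "((\<lambda>b. LINT y:{b..a}|lborel. f y) \<longlongrightarrow> (LINT y:{..a}|lborel. f y)) at_bot"
    by (rule tendsto_set_lebesgue_integral_at_bot) (use f in auto)
  then have "((\<lambda>b. F a - (LINT y:{b..a}|lborel. f y)) \<longlongrightarrow> F a - (LINT y:{..a}|lborel. f y)) at_bot"
    by (intro tendsto_intros)
  then have L: "(F \<longlongrightarrow> F a - (LINT y:{..a}|lborel. f y)) at_bot" (is "(F \<longlongrightarrow> ?L) at_bot")
  proof (rule Lim_transform_eventually)
    show "\<forall>\<^sub>F b in at_bot. F a - (LINT y:{b..a}|lborel. f y) = F b"
      using eventually_le_at_bot[of a] by eventually_elim (simp add: primitive_diff_eq[OF F])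
  qed
  have "?L = 0"
  proof (rule ccontr)
    assume "?L \<noteq> 0"
    then have "\<forall>\<^sub>F b in at_bot. norm ?L / 2 < norm (F b)"
      using order_tendstoD(1)[OF tendsto_norm[OF L], of "norm ?L / 2"] by simp
    then obtain b where b: "\<And>x. x \<le> b \<Longrightarrow> norm ?L / 2 < norm (F x)"
      by (auto simp: eventually_at_bot_linorder)
    have "set_integrable lborel {..min a b} F" using iF by (rule set_integrable_subset) auto
    then show False
      by (rule not_set_integrable_atMost[where c = "norm ?L / 2"]) (use b \<open>?L \<noteq> 0\<close> in \<open>auto intro: less_imp_le\<close>)
  qed
  with L show ?thesis by simp
qed

section \<open>Wave functions\<close>

lemma AC_loc_continuous:
  assumes F: "AC_loc F"
  shows "continuous_on UNIV F"
  unfolding continuous_on_iff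
proof (intro ballI allI impI)
  fix x e :: real assume "e > 0"
  have "abs_cont_on (x-1) (x+1) F" using F by (simp add: AC_loc_def)
  then obtain \<delta> where "\<delta> > 0" and \<delta>0: "\<forall>(n::nat) u v.
        (\<forall>i<n. x-1 \<le> u i \<and> u i \<le> v i \<and> v i \<le> x+1) \<and>
        (\<forall>i<n. \<forall>j<n. i \<noteq> j \<longrightarrow> v i \<le> u j \<or> v j \<le> u i) \<and>
        (\<Sum>i<n. v i - u i) < \<delta>
        \<longrightarrow> (\<Sum>i<n. norm (F (v i) - F (u i))) < e"
    unfolding abs_cont_on_def using \<open>e > 0\<close> by blast
  have *: "norm (F t - F s) < e" if "x-1 \<le> s" "s \<le> t" "t \<le> x+1" "t - s < \<delta>" for s t
    using \<delta>0[rule_format, of "1::nat" "\<lambda>_. s" "\<lambda>_. t"] that by auto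
  show "\<exists>d>0. \<forall>x'\<in>UNIV. dist x' x < d \<longrightarrow> dist (F x') (F x) < e"
  proof (intro exI[of _ "min \<delta> 1"] conjI ballI impI)
    fix y assume "dist y x < min \<delta> 1"
    then show "dist (F y) (F x) < e"
      using *[of x y] *[of y x] by (cases "x \<le> y") (auto simp: dist_norm norm_minus_commute abs_if split: if_splits)
  qed (use \<open>\<delta> > 0\<close> in simp)
qed

text \<open>The a.e. derivative demanded by \<open>Dgraph\<close> is carried along with the integral
  identity. Both survive sums, products and conjugation, so the Lebesgue differentiation theorem
  never has to be invoked.\<close>

definition ac_deriv :: "(real \<Rightarrow> complex) \<Rightarrow> (real \<Rightarrow> complex) \<Rightarrow> bool" where
  "ac_deriv F f \<longleftrightarrow> primitive F f \<and> (AE x in lborel. (F has_vector_derivative f x) (at x))"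

lemma ac_deriv_primitive: "ac_deriv F f \<Longrightarrow> primitive F f"
  by (simp add: ac_deriv_def)

lemma ac_deriv_AE: "ac_deriv F f \<Longrightarrow> AE x in lborel. (F has_vector_derivative f x) (at x)"
  by (simp add: ac_deriv_def)

lemma ac_derivI: "AC_loc F \<Longrightarrow> L1loc f \<Longrightarrow> AE x in lborel. (F has_vector_derivative f x) (at x) \<Longrightarrow> ac_deriv F f"
  by (simp add: ac_deriv_def AC_loc_imp_primitive)

lemma ac_deriv_const: "ac_deriv (\<lambda>x. c) (\<lambda>x. 0)"
  by (simp add: ac_deriv_def primitive_const)

lemma ac_deriv_add:
  assumes "ac_deriv F f" "ac_deriv G g"
  shows "ac_deriv (\<lambda>x. F x + G x) (\<lambda>x. f x + g x)"
proof -
  have "AE x in lborel. ((\<lambda>x. F x + G x) has_vector_derivative f x + g x) (at x)"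
    using assms[THEN ac_deriv_AE] by eventually_elim (rule has_vector_derivative_add)
  with assms show ?thesis by (simp add: ac_deriv_def primitive_add)
qed

lemma ac_deriv_mult:
  assumes "ac_deriv F f" "ac_deriv G g"
  shows "ac_deriv (\<lambda>x. F x * G x) (\<lambda>x. f x * G x + F x * g x)"
proof -
  have "AE x in lborel. ((\<lambda>x. F x * G x) has_vector_derivative F x * g x + f x * G x) (at x)"
    using assms[THEN ac_deriv_AE] by eventually_elim (rule has_vector_derivative_mult)
  then have "AE x in lborel. ((\<lambda>x. F x * G x) has_vector_derivative f x * G x + F x * g x) (at x)"
    by (simp add: add.commute)
  with assms show ?thesis by (simp add: ac_deriv_def primitive_mult)
qed

lemma ac_deriv_cmult: "ac_deriv F f \<Longrightarrow> ac_deriv (\<lambda>x. c * F x) (\<lambda>x. c * f x)"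
  using ac_deriv_mult[OF ac_deriv_const[of c], of F f] by simp

lemma ac_deriv_diff: "ac_deriv F f \<Longrightarrow> ac_deriv G g \<Longrightarrow> ac_deriv (\<lambda>x. F x - G x) (\<lambda>x. f x - g x)"
  using ac_deriv_add[of F f "\<lambda>x. -1 * G x" "\<lambda>x. -1 * g x"] ac_deriv_cmult[of G g "-1"] by simp

lemma ac_deriv_cnj:
  assumes "ac_deriv F f"
  shows "ac_deriv (\<lambda>x. cnj (F x)) (\<lambda>x. cnj (f x))"
proof -
  have "AE x in lborel. ((\<lambda>x. cnj (F x)) has_vector_derivative cnj (f x)) (at x)"
    using assms[THEN ac_deriv_AE] by eventually_elim (rule has_vector_derivative_cnj)
  with assms show ?thesis by (simp add: ac_deriv_def primitive_cnj)
qed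

lemma ac_deriv_C1: "(\<And>x. (F has_vector_derivative f x) (at x)) \<Longrightarrow> continuous_on UNIV f \<Longrightarrow> ac_deriv F f"
  by (simp add: ac_deriv_def primitive_if_has_vector_derivative)

text \<open>The way in which integrals with continuous integrand, as they occur in T and S, acquire
  the pointwise half of \<open>ac_deriv\<close>.\<close>

lemma primitive_ac_deriv: "primitive F f \<Longrightarrow> continuous_on UNIV f \<Longrightarrow> ac_deriv F f"
  by (simp add: ac_deriv_C1 primitive_has_vector_derivative)

lemma ac_deriv_continuous: "ac_deriv F f \<Longrightarrow> continuous_on UNIV F"
  using ac_deriv_primitive primitive_continuous by blast

lemma ac_deriv_AC_loc: "ac_deriv F f \<Longrightarrow> AC_loc F"
  using ac_deriv_primitive primitive_imp_AC_loc by blast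

lemma ac_deriv_cong:
  "ac_deriv F f \<Longrightarrow> (\<And>x. F x = G x) \<Longrightarrow> (\<And>x. f x = g x) \<Longrightarrow> ac_deriv G g"
  by (metis ext)

lemma continuous_vfun_iff:
  fixes P :: vfun
  shows "continuous_on UNIV P \<longleftrightarrow> continuous_on UNIV (\<lambda>x. fst (P x)) \<and> continuous_on UNIV (\<lambda>x. snd (P x))"
  using continuous_on_Pair[of UNIV "\<lambda>x. fst (P x)" "\<lambda>x. snd (P x)"]
  by (auto intro: continuous_on_fst continuous_on_snd)

lemma ac_deriv_continuous_vfun:
  "ac_deriv (\<lambda>x. fst (P x)) f \<Longrightarrow> ac_deriv (\<lambda>x. snd (P x)) g \<Longrightarrow> continuous_on UNIV P"
  by (simp add: continuous_vfun_iff ac_deriv_continuous)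

section \<open>Determinant, Hermitian and sigma_1 pairings on C^2\<close>

definition dt :: "complex \<times> complex \<Rightarrow> complex \<times> complex \<Rightarrow> complex" where
  "dt u v = fst u * snd v - snd u * fst v"

definition hp :: "complex \<times> complex \<Rightarrow> complex \<times> complex \<Rightarrow> complex" where
  "hp u v = fst u * cnj (fst v) + snd u * cnj (snd v)"

lemma norm_prod_square: "(norm v)\<^sup>2 = (norm (fst v))\<^sup>2 + (norm (snd v))\<^sup>2"
  by (simp add: norm_prod_def)

lemma norm_mult_add_le:
  fixes u v :: "complex \<times> complex"
  shows "norm (fst u) * norm (fst v) + norm (snd u) * norm (snd v) \<le> norm u * norm v"
proof (rule power2_le_imp_le)
  have "0 \<le> (norm (fst u) * norm (snd v) - norm (snd u) * norm (fst v))\<^sup>2" by simp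
  then show "(norm (fst u) * norm (fst v) + norm (snd u) * norm (snd v))\<^sup>2 \<le> (norm u * norm v)\<^sup>2"
    unfolding power_mult_distrib norm_prod_square[of u] norm_prod_square[of v]
    by (simp add: power2_eq_square algebra_simps)
qed simp

lemma norm_hp_le: "norm (hp u v) \<le> norm u * norm v"
  unfolding hp_def
  by (rule order_trans[OF norm_triangle_ineq order_trans[OF _ norm_mult_add_le]]) (simp add: norm_mult)

lemma norm_bil_le: "norm (bil u v) \<le> norm u * norm v"
proof -
  have "norm (bil u v) \<le> norm u * norm (snd v, fst v)"
    unfolding bil_def
    by (rule order_trans[OF norm_triangle_ineq order_trans[OF _ norm_mult_add_le]]) (simp add: norm_mult)
  then show ?thesis by (simp add: norm_prod_def add.commute)
qed

lemma norm_dt_le: "norm (dt u v) \<le> norm u * norm v"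
proof -
  have "norm (dt u v) \<le> norm u * norm (snd v, fst v)"
    unfolding dt_def
    by (rule order_trans[OF norm_triangle_ineq4 order_trans[OF _ norm_mult_add_le]]) (simp add: norm_mult)
  then show ?thesis by (simp add: norm_prod_def add.commute)
qed

lemma norm_Kv [simp]: "norm (Kv v) = norm v"
  by (simp add: Kv_def norm_prod_def add.commute)

lemma norm_smul [simp]: "norm (smul c v) = norm c * norm v"
proof -
  have "(norm (smul c v))\<^sup>2 = (norm c * norm v)\<^sup>2"
    unfolding norm_prod_square[of "smul c v"] power_mult_distrib norm_prod_square[of v]
    by (simp add: smul_def norm_mult power_mult_distrib algebra_simps)
  then show ?thesis by (simp add: power2_eq_iff_nonneg)
qed

lemma hp_self: "hp v v = of_real ((norm v)\<^sup>2)"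
  unfolding hp_def norm_prod_square of_real_add complex_norm_square ..

definition wave_system :: "(real \<Rightarrow> complex) \<Rightarrow> complex \<Rightarrow> vfun \<Rightarrow> bool" where
  "wave_system q z P \<longleftrightarrow>
     ac_deriv (\<lambda>x. fst (P x)) (\<lambda>x. - \<i> * z * fst (P x) + q x * snd (P x)) \<and>
     ac_deriv (\<lambda>x. snd (P x)) (\<lambda>x. \<i> * z * snd (P x) - cnj (q x) * fst (P x))"

lemma wave_system_fst:
    "wave_system q z P \<Longrightarrow> ac_deriv (\<lambda>x. fst (P x)) (\<lambda>x. - \<i> * z * fst (P x) + q x * snd (P x))"
  and wave_system_snd:
    "wave_system q z P \<Longrightarrow> ac_deriv (\<lambda>x. snd (P x)) (\<lambda>x. \<i> * z * snd (P x) - cnj (q x) * fst (P x))"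
  by (simp_all add: wave_system_def)

lemma wave_fun_wave_system:
  assumes q: "L1loc q" and P: "wave_fun q z P"
  shows "wave_system q z P"
proof -
  have P1: "AC_loc (\<lambda>x. fst (P x))" and P2: "AC_loc (\<lambda>x. snd (P x))"
    using P by (auto simp: wave_fun_def AC_loc2_def)
  note c = AC_loc_continuous[OF P1] AC_loc_continuous[OF P2]
  have "L1loc (\<lambda>x. - \<i> * z * fst (P x) + q x * snd (P x))"
    by (intro L1loc_add L1loc_continuous[of "\<lambda>x. - \<i> * z * fst (P x)"] L1loc_mult_continuous q c continuous_intros)
  moreover have "L1loc (\<lambda>x. \<i> * z * snd (P x) - cnj (q x) * fst (P x))"
    by (intro L1loc_diff L1loc_continuous[of "\<lambda>x. \<i> * z * snd (P x)"] L1loc_mult_continuous L1loc_cnj q c continuous_intros)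
  moreover have "AE x in lborel. ((\<lambda>t. fst (P t)) has_vector_derivative (- \<i> * z * fst (P x) + q x * snd (P x))) (at x)"
    "AE x in lborel. ((\<lambda>t. snd (P t)) has_vector_derivative (\<i> * z * snd (P x) - cnj (q x) * fst (P x))) (at x)"
    using P unfolding wave_fun_def AE_conj_iff by blast+
  ultimately show ?thesis
    using P1 P2 unfolding wave_system_def by (intro conjI ac_derivI)
qed

lemma wave_system_add:
  assumes "wave_system q z P" "wave_system q z Q"
  shows "wave_system q z (\<lambda>x. P x + Q x)"
  unfolding wave_system_def
  by (intro conjI; rule ac_deriv_cong[OF ac_deriv_add[OF wave_system_fst wave_system_fst, OF assms]]
        ac_deriv_cong[OF ac_deriv_add[OF wave_system_snd wave_system_snd, OF assms]])
    (simp_all add: algebra_simps)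

lemma wave_system_smul:
  assumes "wave_system q z P"
  shows "wave_system q z (\<lambda>x. smul c (P x))"
  unfolding wave_system_def
  by (intro conjI; rule ac_deriv_cong[OF ac_deriv_cmult[OF wave_system_fst[OF assms], of c]]
        ac_deriv_cong[OF ac_deriv_cmult[OF wave_system_snd[OF assms], of c]])
    (simp_all add: algebra_simps smul_def)

lemma wave_system_Kv:
  assumes "wave_system q z P"
  shows "wave_system q (cnj z) (\<lambda>x. Kv (P x))"
proof -
  have 1: "ac_deriv (\<lambda>x. cnj (snd (P x))) (\<lambda>x. cnj (\<i> * z * snd (P x) - cnj (q x) * fst (P x)))"
    by (intro ac_deriv_cnj wave_system_snd assms)
  have 2: "ac_deriv (\<lambda>x. -1 * cnj (fst (P x))) (\<lambda>x. -1 * cnj (- \<i> * z * fst (P x) + q x * snd (P x)))"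
    by (intro ac_deriv_cmult ac_deriv_cnj wave_system_fst assms)
  show ?thesis unfolding wave_system_def
    by (intro conjI; rule ac_deriv_cong[OF 1] ac_deriv_cong[OF 2]) (auto simp: Kv_def algebra_simps)
qed

lemma wave_system_continuous: "wave_system q z P \<Longrightarrow> continuous_on UNIV P"
  unfolding wave_system_def using ac_deriv_continuous_vfun by blast

text \<open>The off-diagonal part of the coefficient matrix, with entries \<open>q\<close> and
  \<open>- cnj q\<close>, is skew-Hermitian, so it cancels in the Hermitian product and only Im z is
  left. The resulting derivative is continuous.\<close>

lemma ac_deriv_hp:
  assumes P: "wave_system q z P" and Q: "wave_system q z Q"
  shows "ac_deriv (\<lambda>x. hp (P x) (Q x))
     (\<lambda>x. of_real (2 * Im z) * (fst (P x) * cnj (fst (Q x)) - snd (P x) * cnj (snd (Q x))))"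
proof -
  have "\<i> * cnj z - \<i> * z = of_real (2 * Im z)" by (simp add: complex_eq_iff)
  then have z: "of_real (2 * Im z) * w = \<i> * cnj z * w - \<i> * z * w" for w
    by (metis left_diff_distrib)
  show ?thesis
    unfolding hp_def
    by (rule ac_deriv_cong[OF ac_deriv_add[OF ac_deriv_mult[OF wave_system_fst[OF P] 
          ac_deriv_cnj[OF wave_system_fst[OF Q]]]
          ac_deriv_mult[OF wave_system_snd[OF P] 
          ac_deriv_cnj[OF wave_system_snd[OF Q]]]] refl])
      (simp only: z, simp add: algebra_simps)
qed

lemma ac_deriv_dt:
  assumes "ac_deriv (\<lambda>x. fst (P x)) p1" "ac_deriv (\<lambda>x. snd (P x)) p2"
    and "ac_deriv (\<lambda>x. fst (Q x)) r1" "ac_deriv (\<lambda>x. snd (Q x)) r2"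
  shows "ac_deriv (\<lambda>x. dt (P x) (Q x)) (\<lambda>x. p1 x * snd (Q x) + fst (P x) * r2 x - (p2 x * fst (Q x) + snd (P x) * r1 x))"
  unfolding dt_def by (intro ac_deriv_diff ac_deriv_mult assms)

text \<open>The coefficient matrix has trace 0 (Liouville's formula).\<close>

lemma dt_wave_constant:
  assumes P: "wave_system q z P" and Q: "wave_system q z Q"
  shows "dt (P x) (Q x) = dt (P y) (Q y)"
proof -
  have "ac_deriv (\<lambda>x. dt (P x) (Q x)) (\<lambda>x. 0)"
    by (rule ac_deriv_cong[OF ac_deriv_dt[OF wave_system_fst[OF P] wave_system_snd[OF P]
          wave_system_fst[OF Q] wave_system_snd[OF Q]]]) (simp_all add: algebra_simps)
  then have pr: "primitive (\<lambda>x. dt (P x) (Q x)) (\<lambda>x. 0)" by (rule ac_deriv_primitive)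
  show ?thesis
    using primitive_diff_eq[OF pr, of x y] primitive_diff_eq[OF pr, of y x] by (cases "x \<le> y") auto
qed

text \<open>The derivative is continuous because \<open>q\<close> is absent from it; hence it exists
  at every point and monotonicity arguments apply.\<close>

lemma wave_norm_deriv:
  assumes P: "wave_system q z P"
  shows "((\<lambda>x. (norm (P x))\<^sup>2) has_real_derivative 2 * Im z * ((norm (fst (P x)))\<^sup>2 - (norm (snd (P x)))\<^sup>2)) (at x)"
proof -
  have c: "continuous_on UNIV (\<lambda>x. fst (P x))" "continuous_on UNIV (\<lambda>x. snd (P x))"
    using wave_system_continuous[OF P] by (auto simp: continuous_vfun_iff)
  have "((\<lambda>x. hp (P x) (P x)) has_vector_derivative
     of_real (2 * Im z) * (fst (P x) * cnj (fst (P x)) - snd (P x) * cnj (snd (P x)))) (at x)"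
    by (rule primitive_has_vector_derivative[OF ac_deriv_primitive[OF ac_deriv_hp[OF P P]]])
      (intro continuous_intros c)
  then have "((\<lambda>x. Re (hp (P x) (P x))) has_vector_derivative
     Re (of_real (2 * Im z) * (fst (P x) * cnj (fst (P x)) - snd (P x) * cnj (snd (P x))))) (at x)"
    by (rule bounded_linear.has_vector_derivative[OF bounded_linear_Re])
  moreover have "Re (of_real (2 * Im z) * (fst (P x) * cnj (fst (P x)) - snd (P x) * cnj (snd (P x))))
     = 2 * Im z * ((norm (fst (P x)))\<^sup>2 - (norm (snd (P x)))\<^sup>2)"
    unfolding cmod_power2 by (simp add: power2_eq_square)
  ultimately show ?thesis
    by (simp only: hp_self has_real_derivative_iff_has_vector_derivative Re_complex_of_real)
qed

text \<open>The coefficient \<open>q\<close> drops out of the derivative of the norm, so this Gronwall estimate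
  involves the spectral parameter only.\<close>

lemma wave_norm_le:
  assumes P: "wave_system q z P"
  shows "(norm (P x))\<^sup>2 \<le> exp (2 * \<bar>Im z\<bar> * \<bar>x - y\<bar>) * (norm (P y))\<^sup>2"
proof -
  let ?N = "\<lambda>x. (norm (P x))\<^sup>2"
  let ?k = "2 * \<bar>Im z\<bar>"
  let ?D = "\<lambda>x. 2 * Im z * ((norm (fst (P x)))\<^sup>2 - (norm (snd (P x)))\<^sup>2)"
  have D: "\<bar>?D x\<bar> \<le> ?k * ?N x" for x
  proof -
    have "\<bar>(norm (fst (P x)))\<^sup>2 - (norm (snd (P x)))\<^sup>2\<bar> \<le> ?N x"
      by (simp add: norm_prod_square abs_le_iff)
    then have "?k * \<bar>(norm (fst (P x)))\<^sup>2 - (norm (snd (P x)))\<^sup>2\<bar> \<le> ?k * ?N x"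
      by (intro mult_left_mono) auto
    then show ?thesis by (simp add: abs_mult)
  qed
  show ?thesis
  proof (cases "x \<le> y")
    case True
    have "exp (?k * x) * ?N x \<le> exp (?k * y) * ?N y"
    proof (rule DERIV_nonneg_imp_nondecreasing[OF True, of "\<lambda>x. exp (?k * x) * ?N x"])
      fix t
      have "((\<lambda>x. exp (?k * x) * ?N x) has_real_derivative exp (?k * t) * ?D t + (exp (?k * t) * ?k) * ?N t) (at t)"
        by (rule DERIV_mult'[OF _ wave_norm_deriv[OF P]]) (auto intro!: derivative_eq_intros)
      moreover have "exp (?k * t) * ?D t + (exp (?k * t) * ?k) * ?N t = exp (?k * t) * (?D t + ?k * ?N t)"
        by (simp add: algebra_simps)
      moreover have "exp (?k * t) * (?D t + ?k * ?N t) \<ge> 0"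
        using D[of t] by (intro mult_nonneg_nonneg) auto
      ultimately show "\<exists>y. ((\<lambda>x. exp (?k * x) * ?N x) has_real_derivative y) (at t) \<and> 0 \<le> y"
        by (intro exI conjI) (assumption, simp only:)
    qed
    then have "exp (- (?k * x)) * (exp (?k * x) * ?N x) \<le> exp (- (?k * x)) * (exp (?k * y) * ?N y)"
      by (intro mult_left_mono) auto
    then have "?N x \<le> exp (- (?k * x)) * (exp (?k * y) * ?N y)"
      by (simp only: mult.assoc[symmetric] exp_add[symmetric]) simp
    also have "\<dots> = exp (?k * \<bar>x - y\<bar>) * ?N y"
      using True by (simp only: mult.assoc[symmetric] exp_add[symmetric]) (simp add: algebra_simps)
    finally show ?thesis .
  next
    case False
    then have yx: "y \<le> x" by simp
    have "exp (- ?k * y) * ?N y \<ge> exp (- ?k * x) * ?N x"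
    proof (rule DERIV_nonpos_imp_nonincreasing[OF yx, of "\<lambda>x. exp (- ?k * x) * ?N x"])
      fix t
      have "((\<lambda>x. exp (- ?k * x) * ?N x) has_real_derivative exp (- ?k * t) * ?D t + (exp (- ?k * t) * (- ?k)) * ?N t) (at t)"
        by (rule DERIV_mult'[OF _ wave_norm_deriv[OF P]]) (auto intro!: derivative_eq_intros)
      moreover have "exp (- ?k * t) * ?D t + (exp (- ?k * t) * (- ?k)) * ?N t = exp (- ?k * t) * (?D t - ?k * ?N t)"
        by (simp add: algebra_simps)
      moreover have "exp (- ?k * t) * (?D t - ?k * ?N t) \<le> 0"
        using D[of t] by (intro mult_nonneg_nonpos) auto
      ultimately show "\<exists>y. ((\<lambda>x. exp (- ?k * x) * ?N x) has_real_derivative y) (at t) \<and> y \<le> 0"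
        by (intro exI conjI) (assumption, simp only:)
    qed
    then have "exp (?k * x) * (exp (- ?k * x) * ?N x) \<le> exp (?k * x) * (exp (- ?k * y) * ?N y)"
      by (intro mult_left_mono) auto
    then have "?N x \<le> exp (?k * x) * (exp (- ?k * y) * ?N y)"
      by (simp only: mult.assoc[symmetric] exp_add[symmetric]) simp
    also have "\<dots> = exp (?k * \<bar>x - y\<bar>) * ?N y"
      using yx by (simp only: mult.assoc[symmetric] exp_add[symmetric]) (simp add: algebra_simps)
    finally show ?thesis .
  qed
qed

text \<open>Comparability over distance 1 lets the mass in a window of fixed length bound a point
  value, with a factor independent of \<open>q\<close>.\<close>

lemma wave_norm_ge:
  assumes P: "wave_system q z P" and xy: "\<bar>x - y\<bar> \<le> 1"
  shows "exp (- (2 * \<bar>Im z\<bar>)) * (norm (P x))\<^sup>2 \<le> (norm (P y))\<^sup>2"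
proof -
  have "(norm (P x))\<^sup>2 \<le> exp (2 * \<bar>Im z\<bar> * \<bar>x - y\<bar>) * (norm (P y))\<^sup>2" by (rule wave_norm_le[OF P])
  also have "\<dots> \<le> exp (2 * \<bar>Im z\<bar>) * (norm (P y))\<^sup>2"
    using xy by (intro mult_right_mono) (auto intro!: mult_left_le)
  finally have "exp (- (2 * \<bar>Im z\<bar>)) * (norm (P x))\<^sup>2 \<le> exp (- (2 * \<bar>Im z\<bar>)) * (exp (2 * \<bar>Im z\<bar>) * (norm (P y))\<^sup>2)"
    by (intro mult_left_mono) auto
  then show ?thesis by (simp add: mult.assoc[symmetric] exp_minus)
qed

text \<open>The exponential norm bound stands in for uniqueness of the initial value problem with a
  merely integrable coefficient.\<close>

lemma wave_nonzero:
  assumes P: "wave_system q z P" and "P x \<noteq> 0"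
  shows "P y \<noteq> 0"
proof
  assume "P y = 0"
  then show False using wave_norm_le[OF P, of x y] \<open>P x \<noteq> 0\<close> by simp
qed

section \<open>Square-integrable vector functions and the maximal operator\<close>

lemma borel_measurable_fst_vfun:
  "F \<in> borel_measurable M \<Longrightarrow> (\<lambda>x. fst (F x :: complex \<times> complex)) \<in> borel_measurable M"
  by (rule borel_measurable_continuous_on[where f = fst]) (auto intro: continuous_intros)

lemma borel_measurable_snd_vfun:
  "F \<in> borel_measurable M \<Longrightarrow> (\<lambda>x. snd (F x :: complex \<times> complex)) \<in> borel_measurable M"
  by (rule borel_measurable_continuous_on[where f = snd]) (auto intro: continuous_intros)

lemma borel_measurable_bil [measurable (raw)]:
  "F \<in> borel_measurable M \<Longrightarrow> G \<in> borel_measurable M \<Longrightarrow> (\<lambda>x. bil (F x) (G x)) \<in> borel_measurable M"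
  unfolding bil_def by (intro borel_measurable_add borel_measurable_times borel_measurable_fst_vfun borel_measurable_snd_vfun)

lemma borel_measurable_dt [measurable (raw)]:
  "F \<in> borel_measurable M \<Longrightarrow> G \<in> borel_measurable M \<Longrightarrow> (\<lambda>x. dt (F x) (G x)) \<in> borel_measurable M"
  unfolding dt_def by (intro borel_measurable_diff borel_measurable_times borel_measurable_fst_vfun borel_measurable_snd_vfun)

lemma borel_measurable_smul [measurable (raw)]:
  "c \<in> borel_measurable M \<Longrightarrow> G \<in> borel_measurable M \<Longrightarrow> (\<lambda>x. smul (c x) (G x)) \<in> borel_measurable M"
  unfolding smul_def by (intro borel_measurable_Pair borel_measurable_times borel_measurable_fst_vfun borel_measurable_snd_vfun)

lemma borel_measurable_Kv [measurable (raw)]: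
  "G \<in> borel_measurable M \<Longrightarrow> (\<lambda>x. Kv (G x)) \<in> borel_measurable M"
  unfolding Kv_def by (intro borel_measurable_Pair borel_measurable_uminus borel_measurable_cnj borel_measurable_fst_vfun borel_measurable_snd_vfun)

lemma L2_measurable: "L2 F \<Longrightarrow> F \<in> borel_measurable borel"
  by (simp add: L2_def)

lemma L2_on_UNIV: "L2_on UNIV F \<longleftrightarrow> L2 F"
  by (simp add: L2_def L2_on_def set_integrable_def)

lemma L2_imp_L2_on: "L2 F \<Longrightarrow> S \<in> sets borel \<Longrightarrow> L2_on S F"
  by (auto simp: L2_def L2_on_def intro: set_integrable_UNIV_subset)

lemma L2_on_halves:
  assumes "L2_on {..a} F" "L2_on {a..} F"
  shows "L2 F"
proof -
  have "set_integrable lborel ({..a} \<union> {a..}) (\<lambda>x. (norm (F x))\<^sup>2)"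
    using assms by (intro set_integrable_Un) (auto simp: L2_on_def)
  moreover have "{..a} \<union> {a..} = UNIV" by auto
  ultimately show ?thesis using assms by (simp add: L2_on_def L2_def set_integrable_def)
qed

lemma L2_on_mono:
  assumes F: "L2_on S F" and G: "G \<in> borel_measurable borel" and S: "S \<in> sets borel"
    and le: "\<And>x. x \<in> S \<Longrightarrow> norm (G x) \<le> c * norm (F x)"
  shows "L2_on S G"
proof -
  have [measurable]: "G \<in> borel_measurable borel" "S \<in> sets borel" by fact+
  have "set_integrable lborel S (\<lambda>x. c\<^sup>2 * (norm (F x))\<^sup>2)"
    using F by (simp add: L2_on_def)
  then have "set_integrable lborel S (\<lambda>x. (norm (G x))\<^sup>2)"
  proof (rule set_integrable_bound)
    show "AE x in lborel. x \<in> S \<longrightarrow> norm ((norm (G x))\<^sup>2) \<le> norm (c\<^sup>2 * (norm (F x))\<^sup>2)"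
      using power_mono[OF le norm_ge_zero, of _ 2] by (auto simp: power_mult_distrib)
  qed (simp add: set_borel_measurable_def)
  then show ?thesis using G by (simp add: L2_on_def)
qed

lemma norm_add_square_le:
  fixes u v :: "'a::real_normed_vector"
  shows "(norm (u + v))\<^sup>2 \<le> 2 * (norm u)\<^sup>2 + 2 * (norm v)\<^sup>2"
  using power_mono[OF norm_triangle_ineq[of u v] norm_ge_zero, of 2] sum_squares_bound[of "norm u" "norm v"]
  by (simp add: power2_sum)

lemma L2_on_add:
  assumes F: "L2_on S F" and G: "L2_on S G" and S: "S \<in> sets borel"
  shows "L2_on S (\<lambda>x. F x + G x)"
proof -
  have [measurable]: "F \<in> borel_measurable borel" "G \<in> borel_measurable borel" "S \<in> sets borel"
    using F G S by (auto simp: L2_on_def)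
  have "set_integrable lborel S (\<lambda>x. 2 * (norm (F x))\<^sup>2 + 2 * (norm (G x))\<^sup>2)"
    using F G by (auto simp: L2_on_def intro!: set_integral_add)
  then have "set_integrable lborel S (\<lambda>x. (norm (F x + G x))\<^sup>2)"
  proof (rule set_integrable_bound)
    show "AE x in lborel. x \<in> S \<longrightarrow> norm ((norm (F x + G x))\<^sup>2) \<le> norm (2 * (norm (F x))\<^sup>2 + 2 * (norm (G x))\<^sup>2)"
      by (intro AE_I2 impI) (simp add: norm_add_square_le)
  qed (simp add: set_borel_measurable_def)
  then show ?thesis by (simp add: L2_on_def)
qed

lemma L2_mono: "L2 F \<Longrightarrow> G \<in> borel_measurable borel \<Longrightarrow> (\<And>x. norm (G x) \<le> c * norm (F x)) \<Longrightarrow> L2 G"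
  using L2_on_mono[of UNIV F G c] by (simp add: L2_on_UNIV)

lemma L2_add: "L2 F \<Longrightarrow> L2 G \<Longrightarrow> L2 (\<lambda>x. F x + G x)"
  using L2_on_add[of UNIV F G] by (simp add: L2_on_UNIV)

lemma L2_smul: "L2 F \<Longrightarrow> L2 (\<lambda>x. smul c (F x))"
  by (rule L2_mono[of F _ "norm c"]) (auto simp: L2_def intro: borel_measurable_smul)

lemma L2_cong_AE:
  assumes F: "L2 F" and G: "G \<in> borel_measurable borel" and eq: "aeeq F G"
  shows "L2 G"
proof -
  have [measurable]: "F \<in> borel_measurable borel" "G \<in> borel_measurable borel" using F G by (auto simp: L2_def)
  have "integrable lborel (\<lambda>x. (norm (F x))\<^sup>2) \<longleftrightarrow> integrable lborel (\<lambda>x. (norm (G x))\<^sup>2)"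
    using eq unfolding aeeq_def by (intro integrable_cong_AE) (auto elim!: AE_mp)
  with F G show ?thesis by (simp add: L2_def)
qed

lemma L2_on_product_integrable:
  fixes g :: "real \<Rightarrow> 'a::{banach, second_countable_topology}"
  assumes F: "L2_on S F" and G: "L2_on S G" and g: "g \<in> borel_measurable borel" and S: "S \<in> sets borel"
    and le: "\<And>x. norm (g x) \<le> norm (F x) * norm (G x)"
  shows "set_integrable lborel S g"
proof -
  have [measurable]: "g \<in> borel_measurable borel" "S \<in> sets borel" by fact+
  have "set_integrable lborel S (\<lambda>x. (norm (F x))\<^sup>2 + (norm (G x))\<^sup>2)"
    using F G by (auto simp: L2_on_def intro!: set_integral_add)
  then show ?thesis
  proof (rule set_integrable_bound)
    show "AE x in lborel. x \<in> S \<longrightarrow> norm (g x) \<le> norm ((norm (F x))\<^sup>2 + (norm (G x))\<^sup>2)"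
    proof (intro AE_I2 impI)
      fix x
      have "norm (g x) \<le> norm (F x) * norm (G x)" by (rule le)
      also have "\<dots> \<le> (norm (F x))\<^sup>2 + (norm (G x))\<^sup>2"
        using sum_squares_bound[of "norm (F x)" "norm (G x)"] mult_nonneg_nonneg[OF norm_ge_zero[of "F x"] norm_ge_zero[of "G x"]]
        by linarith
      finally show "norm (g x) \<le> norm ((norm (F x))\<^sup>2 + (norm (G x))\<^sup>2)" by simp
    qed
  qed (simp add: set_borel_measurable_def)
qed

lemma L2_on_bil_integrable:
  "L2_on S F \<Longrightarrow> L2_on S G \<Longrightarrow> S \<in> sets borel \<Longrightarrow> set_integrable lborel S (\<lambda>x. bil (F x) (G x))"
  by (rule L2_on_product_integrable[of S F G])
    (auto simp: norm_bil_le L2_on_def intro: borel_measurable_bil)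

lemma L2_on_dt_integrable:
  "L2_on S F \<Longrightarrow> L2_on S G \<Longrightarrow> S \<in> sets borel \<Longrightarrow> set_integrable lborel S (\<lambda>x. dt (F x) (G x))"
  by (rule L2_on_product_integrable[of S F G])
    (auto simp: norm_dt_le L2_on_def intro: borel_measurable_dt)

lemma L2_bil_integrable: "L2 F \<Longrightarrow> L2 G \<Longrightarrow> integrable lborel (\<lambda>x. bil (F x) (G x))"
  using L2_on_bil_integrable[of UNIV F G] by (simp add: L2_on_UNIV set_integrable_def)

lemma continuous_vfun_measurable: "continuous_on UNIV (P::vfun) \<Longrightarrow> P \<in> borel_measurable borel"
  by (rule borel_measurable_continuous_onI)

lemma continuous_imp_L2_on:
  assumes P: "continuous_on UNIV (P::vfun)"
  shows "L2_on {a..b} P"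
  unfolding L2_on_def
proof
  show "P \<in> borel_measurable lborel" using continuous_vfun_measurable[OF P] by simp
  have "continuous_on {a..b} (\<lambda>x. (norm (P x))\<^sup>2)"
    by (intro continuous_intros continuous_on_subset[OF P]) simp
  then show "set_integrable lborel {a..b} (\<lambda>x. (norm (P x))\<^sup>2)" by (rule borel_integrable_atLeastAtMost')
qed

lemma L2_L1loc:
  assumes F: "L2 F"
  shows "L1loc (\<lambda>x. fst (F x))" "L1loc (\<lambda>x. snd (F x))"
proof -
  have [measurable]: "F \<in> borel_measurable borel" using F by (simp add: L2_def)
  have 1: "L2_on {a..b} (\<lambda>x. (1, 0))" for a b by (rule continuous_imp_L2_on) simp
  have nf: "norm (fst v) \<le> norm v" "norm (snd v) \<le> norm v" for v :: "complex \<times> complex"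
    by (metis norm_fst_le prod.collapse, metis norm_snd_le prod.collapse)
  show "L1loc (\<lambda>x. fst (F x))" "L1loc (\<lambda>x. snd (F x))"
    unfolding L1loc_def
    by (auto intro!: borel_measurable_fst_vfun borel_measurable_snd_vfun L2_on_product_integrable[OF 1 L2_imp_L2_on[OF F]] simp: norm_prod_def nf[unfolded norm_prod_def])
qed

lemma L2norm_power2: "(L2norm F)\<^sup>2 = (LINT x|lborel. (norm (F x))\<^sup>2)"
  by (simp add: L2norm_def)

lemma L2norm_nonneg: "0 \<le> L2norm F"
  by (simp add: L2norm_def)

lemma L2norm_le_iff: "0 \<le> c \<Longrightarrow> L2norm F \<le> c \<longleftrightarrow> (LINT x|lborel. (norm (F x))\<^sup>2) \<le> c\<^sup>2"
  unfolding L2norm_power2[symmetric] using abs_le_square_iff[of "L2norm F" c] L2norm_nonneg[of F] by simp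

text \<open>Only some constant is wanted for boundedness, so the elementary (a + b)^2 \<le> 2 a^2 +
  2 b^2 suffices in place of Minkowski's inequality.\<close>

lemma L2norm_add_le:
  assumes F: "L2 F" and G: "L2 G" and G2: "(LINT x|lborel. (norm (G x))\<^sup>2) \<le> c\<^sup>2 * (LINT x|lborel. (norm (F x))\<^sup>2)"
  shows "L2norm (\<lambda>x. F x + G x) \<le> sqrt (2 + 2 * c\<^sup>2) * L2norm F"
proof -
  have "(LINT x|lborel. (norm (F x + G x))\<^sup>2) \<le> (LINT x|lborel. 2 * (norm (F x))\<^sup>2 + 2 * (norm (G x))\<^sup>2)"
  proof (rule integral_mono)
    show "integrable lborel (\<lambda>x. (norm (F x + G x))\<^sup>2)" using L2_add[OF F G] by (simp add: L2_def)
    show "integrable lborel (\<lambda>x. 2 * (norm (F x))\<^sup>2 + 2 * (norm (G x))\<^sup>2)" using F G by (simp add: L2_def)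
  qed (rule norm_add_square_le)
  also have "\<dots> = 2 * (LINT x|lborel. (norm (F x))\<^sup>2) + 2 * (LINT x|lborel. (norm (G x))\<^sup>2)"
    using F G by (simp add: L2_def)
  also have "\<dots> \<le> (2 + 2 * c\<^sup>2) * (LINT x|lborel. (norm (F x))\<^sup>2)"
    using G2 by (simp add: algebra_simps)
  also have "\<dots> = (sqrt (2 + 2 * c\<^sup>2) * L2norm F)\<^sup>2"
    by (simp add: power_mult_distrib L2norm_power2)
  finally show ?thesis
    by (subst L2norm_le_iff) (auto intro!: mult_nonneg_nonneg simp: L2norm_nonneg)
qed

text \<open>The first row of M(q) F = G, solved for the derivative; \<open>dirac_snd\<close> is the
  second row.\<close>

abbreviation dirac_fst :: "(real \<Rightarrow> complex) \<Rightarrow> vfun \<Rightarrow> vfun \<Rightarrow> bool" where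
  "dirac_fst q F G \<equiv> ac_deriv (\<lambda>x. fst (F x)) (\<lambda>x. - \<i> * fst (G x) + q x * snd (F x))"

abbreviation dirac_snd :: "(real \<Rightarrow> complex) \<Rightarrow> vfun \<Rightarrow> vfun \<Rightarrow> bool" where
  "dirac_snd q F G \<equiv> ac_deriv (\<lambda>x. snd (F x)) (\<lambda>x. \<i> * snd (G x) - cnj (q x) * fst (F x))"

text \<open>The unspecified derivatives \<open>d1\<close>, \<open>d2\<close> are determined a.e. by
  \<open>G\<close> and \<open>Ft\<close>. Their explicit form is locally integrable, because
  \<open>G\<close> is square integrable and \<open>Ft\<close> continuous, which is what
  \<open>ac_deriv\<close> requires.\<close>

lemma Dgraph_iff:
  assumes q: "L1loc q"
  shows "Dgraph q F G \<longleftrightarrow> L2 F \<and> L2 G \<and> (\<exists>Ft. aeeq F Ft \<and>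
     dirac_fst q Ft G \<and>
     dirac_snd q Ft G)"
proof
  assume D: "Dgraph q F G"
  then obtain Ft d1 d2 where Ft: "AC_loc2 Ft" "aeeq F Ft" and
    ae: "AE x in lborel.
           ((\<lambda>t. fst (Ft t)) has_vector_derivative d1 x) (at x) \<and>
           ((\<lambda>t. snd (Ft t)) has_vector_derivative d2 x) (at x) \<and>
           G x = (\<i> * (d1 x - q x * snd (Ft x)), \<i> * (- cnj (q x) * fst (Ft x) - d2 x))"
    unfolding Dgraph_def by blast
  have G: "L2 G" using D by (simp add: Dgraph_def)
  have ac: "AC_loc (\<lambda>x. fst (Ft x))" "AC_loc (\<lambda>x. snd (Ft x))" using Ft by (auto simp: AC_loc2_def)
  note c = ac[THEN AC_loc_continuous]
  have i: "- \<i> * (\<i> * (a - b)) + b = a" "\<i> * (\<i> * (- b * d - a)) - b * d = a" for a b d :: complex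
    by (simp_all add: right_diff_distrib mult.assoc[symmetric])
  have "AE x in lborel. ((\<lambda>t. fst (Ft t)) has_vector_derivative - \<i> * fst (G x) + q x * snd (Ft x)) (at x)"
    using ae by eventually_elim (elim conjE, simp only: fst_conv i)
  moreover have "AE x in lborel. ((\<lambda>t. snd (Ft t)) has_vector_derivative \<i> * snd (G x) - cnj (q x) * fst (Ft x)) (at x)"
    using ae by eventually_elim (elim conjE, simp only: snd_conv i)
  moreover have "L1loc (\<lambda>x. - \<i> * fst (G x) + q x * snd (Ft x))"
    by (intro L1loc_add L1loc_cmult L2_L1loc G L1loc_mult_continuous q c)
  moreover have "L1loc (\<lambda>x. \<i> * snd (G x) - cnj (q x) * fst (Ft x))"
    by (intro L1loc_diff L1loc_cmult L2_L1loc G L1loc_mult_continuous L1loc_cnj q c)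
  ultimately show "L2 F \<and> L2 G \<and> (\<exists>Ft. aeeq F Ft \<and>
     dirac_fst q Ft G \<and>
     dirac_snd q Ft G)"
    using D Ft(2) ac unfolding Dgraph_def
    by (intro conjI exI[of _ Ft] ac_derivI) simp_all
next
  assume "L2 F \<and> L2 G \<and> (\<exists>Ft. aeeq F Ft \<and>
     dirac_fst q Ft G \<and>
     dirac_snd q Ft G)"
  then obtain Ft where L: "L2 F" "L2 G" "aeeq F Ft" and
     1: "dirac_fst q Ft G" and
     2: "dirac_snd q Ft G" by blast
  have i: "\<i> * (- \<i> * a + b - b) = a" "\<i> * (- b * d - (\<i> * a - b * d)) = a" for a b d :: complex
    by (simp_all add: right_diff_distrib mult.assoc[symmetric])
  show "Dgraph q F G"
    unfolding Dgraph_def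
  proof (intro conjI L, rule exI[of _ Ft])
    have AC: "AC_loc2 Ft" using ac_deriv_AC_loc[OF 1] ac_deriv_AC_loc[OF 2] by (simp add: AC_loc2_def)
    show "\<exists>d1 d2. AC_loc2 Ft \<and> aeeq F Ft \<and> (AE x in lborel. ((\<lambda>t. fst (Ft t)) has_vector_derivative d1 x) (at x) \<and>
           ((\<lambda>t. snd (Ft t)) has_vector_derivative d2 x) (at x) \<and>
           G x = (\<i> * (d1 x - q x * snd (Ft x)), \<i> * (- cnj (q x) * fst (Ft x) - d2 x)))"
    proof (intro exI conjI AC L(3))
      show "AE x in lborel. ((\<lambda>t. fst (Ft t)) has_vector_derivative - \<i> * fst (G x) + q x * snd (Ft x)) (at x) \<and>
           ((\<lambda>t. snd (Ft t)) has_vector_derivative \<i> * snd (G x) - cnj (q x) * fst (Ft x)) (at x) \<and>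
           G x = (\<i> * (- \<i> * fst (G x) + q x * snd (Ft x) - q x * snd (Ft x)),
                  \<i> * (- cnj (q x) * fst (Ft x) - (\<i> * snd (G x) - cnj (q x) * fst (Ft x))))"
        using ac_deriv_AE[OF 1] ac_deriv_AE[OF 2]
        by eventually_elim (intro conjI, assumption, assumption, simp only: i prod.collapse)
    qed
  qed
qed

section \<open>Schur's test for exponentially decaying kernels\<close>

abbreviation expk :: "real \<Rightarrow> real \<Rightarrow> real \<Rightarrow> real" where
  "expk e x y \<equiv> exp (- (e * \<bar>x - y\<bar>))"

lemma nn_integral_exp_abs:
  assumes e: "e > 0"
  shows "(\<integral>\<^sup>+y. ennreal (expk e x y) \<partial>lborel) = ennreal (2 / e)"
proof -
  have half: "(\<integral>\<^sup>+y. ennreal (exp (- (e * y))) * indicator {0..} y \<partial>lborel) = ennreal (1 / e)"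
  proof -
    have "(\<integral>\<^sup>+y. ennreal (exp (- (e * y))) * indicator {0..} y \<partial>lborel) = ennreal (0 - (- (exp (- (e * 0)) / e)))"
    proof (rule nn_integral_FTC_atLeast)
      show "((\<lambda>y. - (exp (- (e * y)) / e)) has_real_derivative exp (- (e * y))) (at y)" for y
        using e by (auto intro!: derivative_eq_intros)
      have "((\<lambda>y. exp (- (e * y))) \<longlongrightarrow> 0) at_top"
        using e by (intro filterlim_compose[OF exp_at_bot] filterlim_uminus_at_bot_at_top[THEN filterlim_compose] filterlim_tendsto_pos_mult_at_top[OF tendsto_const] filterlim_ident)
      then show "((\<lambda>y. - (exp (- (e * y)) / e)) \<longlongrightarrow> 0) at_top"
        using tendsto_mult_left[of _ 0 at_top "- (1 / e)"] by fastforce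
    qed auto
    then show ?thesis by simp
  qed
  have "(\<integral>\<^sup>+y. ennreal (expk e x y) \<partial>lborel) = (\<integral>\<^sup>+y. ennreal (exp (- (e * \<bar>y\<bar>))) \<partial>lborel)"
    using nn_integral_real_affine[of "\<lambda>y. ennreal (expk e x y)" 1 x] by simp
  also have "\<dots> = (\<integral>\<^sup>+y. ennreal (exp (- (e * y))) * indicator {0..} y + ennreal (exp (- (e * (- y)))) * indicator {0..} (- y) \<partial>lborel)"
    by (intro nn_integral_cong_AE, use AE_lborel_singleton[of 0] in eventually_elim) (auto simp: indicator_def)
  also have "\<dots> = (\<integral>\<^sup>+y. ennreal (exp (- (e * y))) * indicator {0..} y \<partial>lborel) + (\<integral>\<^sup>+y. ennreal (exp (- (e * (- y)))) * indicator {0..} (- y) \<partial>lborel)"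
    by (intro nn_integral_add) auto
  also have "(\<integral>\<^sup>+y. ennreal (exp (- (e * (- y)))) * indicator {0..} (- y) \<partial>lborel) = (\<integral>\<^sup>+y. ennreal (exp (- (e * y))) * indicator {0..} y \<partial>lborel)"
    using nn_integral_real_affine[of "\<lambda>y. ennreal (exp (- (e * y))) * indicator {0..} y" "-1" 0] by simp
  finally show ?thesis using e by (simp add: half flip: ennreal_plus)
qed

text \<open>The second bound does not depend on \<open>x\<close>; it supplies uniform pointwise
  control where Schur's test would give only an L2 bound. It comes from e^(-s) |F| \<le> e^(-s) +
  |F|^2, split according to whether |F| exceeds 1.\<close>

lemma exp_kernel_integrable:
  assumes e: "e > 0" and F: "L2 F"
  shows "integrable lborel (\<lambda>y. expk e x y * norm (F y))"
    and "(LINT y|lborel. expk e x y * norm (F y)) \<le> 2 / e + (LINT y|lborel. (norm (F y))\<^sup>2)"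
proof -
  have [measurable]: "F \<in> borel_measurable borel" using F by (simp add: L2_def)
  have ie: "integrable lborel (\<lambda>y. expk e x y)"
    using nn_integral_exp_abs[OF e, of x] by (intro integrableI_bounded) auto
  have Ie: "(LINT y|lborel. expk e x y) = 2 / e"
    using nn_integral_exp_abs[OF e, of x] e by (subst integral_eq_nn_integral) auto
  have iF: "integrable lborel (\<lambda>y. (norm (F y))\<^sup>2)" using F by (simp add: L2_def)
  have le: "expk e x y * norm (F y) \<le> expk e x y + (norm (F y))\<^sup>2" for y
  proof (cases "norm (F y) \<le> 1")
    case True
    then have "expk e x y * norm (F y) \<le> expk e x y" by (intro mult_left_le) auto
    then show ?thesis using zero_le_power2[of "norm (F y)"] by linarith
  next
    case False
    have "expk e x y * norm (F y) \<le> norm (F y) * norm (F y)"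
    proof (intro mult_right_mono)
      have "expk e x y \<le> 1" using e by simp
      then show "expk e x y \<le> norm (F y)" using False by linarith
    qed simp
    then show ?thesis using exp_gt_zero[of "- (e * \<bar>x - y\<bar>)"] unfolding power2_eq_square by linarith
  qed
  show i: "integrable lborel (\<lambda>y. expk e x y * norm (F y))"
    by (rule Bochner_Integration.integrable_bound[OF Bochner_Integration.integrable_add[OF ie iF]])
      (use le in auto)
  show "(LINT y|lborel. expk e x y * norm (F y)) \<le> 2 / e + (LINT y|lborel. (norm (F y))\<^sup>2)"
    using integral_mono[OF i Bochner_Integration.integrable_add[OF ie iF] le] ie iF Ie by simp
qed

lemma exp_kernel_L2_bound:
  assumes e: "e > 0" and F: "L2 F" and C: "C \<ge> 0" and H: "H \<in> borel_measurable borel"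
    and le: "\<And>x. norm (H x) \<le> C * (LINT y|lborel. expk e x y * norm (F y))"
  shows "L2 H" and "(LINT x|lborel. (norm (H x))\<^sup>2) \<le> (C * (2 / e))\<^sup>2 * (LINT x|lborel. (norm (F x))\<^sup>2)"
proof -
  have [measurable]: "F \<in> borel_measurable borel" "H \<in> borel_measurable borel" using F H by (auto simp: L2_def)
  let ?K = "\<lambda>x y. ennreal (expk e x y)"
  let ?G = "\<lambda>y. ennreal ((norm (F y))\<^sup>2)"
  have 1: "ennreal (LINT y|lborel. expk e x y * norm (F y)) = (\<integral>\<^sup>+y. ennreal (expk e x y * norm (F y)) \<partial>lborel)" for x
    by (rule nn_integral_eq_integral[symmetric]) (use exp_kernel_integrable[OF e F] in auto)
  have 2: "(\<integral>\<^sup>+y. ennreal (expk e x y * norm (F y)) \<partial>lborel)\<^sup>2 \<le> ennreal (2 / e) * (\<integral>\<^sup>+y. ?K x y * ?G y \<partial>lborel)" for x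
  proof -
    \<comment> \<open>The square root of the kernel: one copy is squared alone and integrates to
      2/e, the other stays with \<open>F\<close>. Fubini then produces the second factor
      2/e.\<close>
    let ?k = "\<lambda>y. ennreal (exp (- (e * \<bar>x - y\<bar> / 2)))"
    have k2: "exp (- (e * \<bar>x - y\<bar> / 2)) * exp (- (e * \<bar>x - y\<bar> / 2)) = expk e x y" for y
      by (simp flip: exp_add)
    have "(\<integral>\<^sup>+y. ?k y * (?k y * ennreal (norm (F y))) \<partial>lborel)\<^sup>2 \<le>
       (\<integral>\<^sup>+y. (?k y)\<^sup>2 \<partial>lborel) * (\<integral>\<^sup>+y. (?k y * ennreal (norm (F y)))\<^sup>2 \<partial>lborel)"
      by (rule Cauchy_Schwarz_nn_integral) auto
    moreover have "?k y * (?k y * ennreal (norm (F y))) = ennreal (expk e x y * norm (F y))" for y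
      unfolding k2[of y, symmetric] by (simp add: mult.assoc flip: ennreal_mult)
    moreover have "(?k y)\<^sup>2 = ?K x y" for y
      unfolding k2[of y, symmetric] by (simp add: power2_eq_square flip: ennreal_mult)
    moreover have "(?k y * ennreal (norm (F y)))\<^sup>2 = ?K x y * ?G y" for y
    proof -
      have "(exp (- (e * \<bar>x - y\<bar> / 2)) * norm (F y))\<^sup>2 = expk e x y * (norm (F y))\<^sup>2"
        unfolding k2[of y, symmetric] by (simp add: power2_eq_square mult_ac)
      then show ?thesis by (simp add: ennreal_power flip: ennreal_mult)
    qed
    ultimately show ?thesis by (simp add: nn_integral_exp_abs[OF e])
  qed
  have "(\<integral>\<^sup>+x. ennreal ((norm (H x))\<^sup>2) \<partial>lborel) \<le> (\<integral>\<^sup>+x. ennreal (C\<^sup>2) * (ennreal (2 / e) * (\<integral>\<^sup>+y. ?K x y * ?G y \<partial>lborel)) \<partial>lborel)"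
  proof (intro nn_integral_mono)
    fix x
    have "ennreal ((norm (H x))\<^sup>2) \<le> ennreal ((C * (LINT y|lborel. expk e x y * norm (F y)))\<^sup>2)"
      by (intro ennreal_leI power_mono le) simp
    also have "\<dots> = ennreal (C\<^sup>2) * (ennreal (LINT y|lborel. expk e x y * norm (F y)))\<^sup>2"
      by (simp add: power_mult_distrib ennreal_mult ennreal_power integral_nonneg_AE)
    also have "\<dots> \<le> ennreal (C\<^sup>2) * (ennreal (2 / e) * (\<integral>\<^sup>+y. ?K x y * ?G y \<partial>lborel))"
      using 2[of x] unfolding 1 by (intro mult_left_mono) auto
    finally show "ennreal ((norm (H x))\<^sup>2) \<le> ennreal (C\<^sup>2) * (ennreal (2 / e) * (\<integral>\<^sup>+y. ?K x y * ?G y \<partial>lborel))" .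
  qed
  also have "\<dots> = ennreal (C\<^sup>2) * (ennreal (2 / e) * (\<integral>\<^sup>+x. (\<integral>\<^sup>+y. ?K x y * ?G y \<partial>lborel) \<partial>lborel))"
    by (simp add: nn_integral_cmult)
  also have "(\<integral>\<^sup>+x. (\<integral>\<^sup>+y. ?K x y * ?G y \<partial>lborel) \<partial>lborel) = (\<integral>\<^sup>+y. (\<integral>\<^sup>+x. ?K x y * ?G y \<partial>lborel) \<partial>lborel)"
    by (rule lborel_pair.Fubini') measurable
  also have "\<dots> = (\<integral>\<^sup>+y. ennreal (2 / e) * ?G y \<partial>lborel)"
  proof (intro nn_integral_cong)
    fix y
    show "(\<integral>\<^sup>+x. ?K x y * ?G y \<partial>lborel) = ennreal (2 / e) * ?G y"
      using nn_integral_exp_abs[OF e, of y] by (simp add: nn_integral_multc abs_minus_commute)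
  qed
  also have "\<dots> = ennreal (2 / e) * (\<integral>\<^sup>+y. ?G y \<partial>lborel)"
    by (simp add: nn_integral_cmult)
  also have "(\<integral>\<^sup>+y. ?G y \<partial>lborel) = ennreal (LINT y|lborel. (norm (F y))\<^sup>2)"
    by (rule nn_integral_eq_integral) (use F in \<open>auto simp: L2_def\<close>)
  also have "ennreal (C\<^sup>2) * (ennreal (2 / e) * (ennreal (2 / e) * ennreal (LINT y|lborel. (norm (F y))\<^sup>2)))
     = ennreal ((C * (2 / e))\<^sup>2 * (LINT x|lborel. (norm (F x))\<^sup>2))"
    using e by (simp add: power_mult_distrib power2_eq_square mult_ac flip: ennreal_mult)
  finally have main: "(\<integral>\<^sup>+x. ennreal ((norm (H x))\<^sup>2) \<partial>lborel) \<le> ennreal ((C * (2 / e))\<^sup>2 * (LINT x|lborel. (norm (F x))\<^sup>2))" .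
  then have "(\<integral>\<^sup>+x. ennreal ((norm (H x))\<^sup>2) \<partial>lborel) < \<infinity>"
    by (rule le_less_trans) simp
  then have i: "integrable lborel (\<lambda>x. (norm (H x))\<^sup>2)"
    by (intro integrableI_bounded) auto
  then show "L2 H" by (simp add: L2_def)
  show "(LINT x|lborel. (norm (H x))\<^sup>2) \<le> (C * (2 / e))\<^sup>2 * (LINT x|lborel. (norm (F x))\<^sup>2)"
    using main nn_integral_eq_integral[OF i] by (simp add: integral_nonneg_AE)
qed

section \<open>Exponential decay of the Weyl solutions\<close>

lemma dt_eq_0_imp_proportional:
  assumes "u \<noteq> 0" "dt u v = 0"
  shows "\<exists>c. v = smul c u"
proof (cases "fst u = 0")
  case True
  then have "snd u \<noteq> 0" using assms(1) by (simp add: prod_eq_iff)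
  then show ?thesis using assms(2) True
    by (intro exI[of _ "snd v / snd u"]) (auto simp: dt_def smul_def prod_eq_iff)
next
  case False
  then show ?thesis using assms(2)
    by (intro exI[of _ "fst v / fst u"]) (auto simp: dt_def smul_def prod_eq_iff field_simps)
qed

lemma L2_continuous_tails:
  assumes u: "continuous_on UNIV (u::vfun)" and "L2_on {..a} u" "L2_on {b..} u"
  shows "L2 u"
proof -
  have "set_integrable lborel ({..a} \<union> ({a..b} \<union> {b..})) (\<lambda>x. (norm (u x))\<^sup>2)"
    using assms continuous_imp_L2_on[OF u, of a b] by (intro set_integrable_Un) (auto simp: L2_on_def)
  moreover have "{..a} \<union> ({a..b} \<union> {b..}) = UNIV" by auto
  ultimately show ?thesis using continuous_vfun_measurable[OF u] by (simp add: L2_def set_integrable_def)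
qed

text \<open>The hypotheses of the theorem after conversion: each \<open>wave_fun\<close> has become
  a \<open>wave_system\<close> together with nonvanishing at some point.\<close>

locale weyl_pair =
  fixes q :: "real \<Rightarrow> complex" and z :: complex and Pm Pp :: vfun
  assumes q: "L1loc q" and resolvent: "z \<in> resolvent_set q"
    and wave_m: "wave_system q z Pm" and wave_p: "wave_system q z Pp"
    and Pm_nz: "\<exists>x. Pm x \<noteq> 0" and Pp_nz: "\<exists>x. Pp x \<noteq> 0"
    and Pm_L2: "\<And>R. L2_on {..R} Pm" and Pp_L2: "\<And>R. L2_on {R..} Pp"
begin

lemma Pm_nonzero: "Pm x \<noteq> 0" and Pp_nonzero: "Pp x \<noteq> 0"
  using wave_nonzero[OF wave_m] wave_nonzero[OF wave_p] Pm_nz Pp_nz by blast+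

lemmas cont_m = wave_system_continuous[OF wave_m] and cont_p = wave_system_continuous[OF wave_p]

text \<open>For real \<open>z\<close> the norm of a wave function is constant, which contradicts
  square integrability on a half-line.\<close>

lemma Im_z_nonzero: "Im z \<noteq> 0"
proof
  assume "Im z = 0"
  then have "(norm (Pm 0))\<^sup>2 \<le> (norm (Pm x))\<^sup>2" for x
    using wave_norm_le[OF wave_m, of 0 x] by simp
  moreover have "set_integrable lborel {..0} (\<lambda>x. (norm (Pm x))\<^sup>2)"
    using Pm_L2[of 0] by (simp add: L2_on_def)
  ultimately show False
    using not_set_integrable_atMost[of 0 "\<lambda>x. (norm (Pm x))\<^sup>2" "(norm (Pm 0))\<^sup>2"] Pm_nonzero[of 0] by simp
qed

lemma resolvent_bound:
  obtains C where "C \<ge> 0" "\<And>F G. Dgraph q F (\<lambda>x. G x + smul z (F x)) \<Longrightarrow> L2norm F \<le> C * L2norm G"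
proof -
  obtain C where C: "\<And>F G. Dgraph q F (\<lambda>x. G x + smul z (F x)) \<Longrightarrow> L2norm F \<le> C * L2norm G"
    using resolvent unfolding resolvent_set_def by blast
  have "L2norm F \<le> \<bar>C\<bar> * L2norm G" if "Dgraph q F (\<lambda>x. G x + smul z (F x))" for F G
    using C[OF that] mult_right_mono[OF abs_ge_self[of C] L2norm_nonneg[of G]] by linarith
  then show ?thesis using that[of "\<bar>C\<bar>"] by simp
qed

definition W :: complex where "W = dt (Pm 0) (Pp 0)"

lemma dt_m_p: "dt (Pm x) (Pp x) = W"
  unfolding W_def by (rule dt_wave_constant[OF wave_m wave_p])

lemma W_nonzero: "W \<noteq> 0"
proof
  assume "W = 0"
  then obtain c where c: "Pp 0 = smul c (Pm 0)"
    using dt_eq_0_imp_proportional[OF Pm_nonzero[of 0], of "Pp 0"] by (auto simp: W_def)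
  have "c \<noteq> 0" using c Pp_nonzero[of 0] by (auto simp: smul_def zero_prod_def)
  have D: "wave_system q z (\<lambda>x. Pp x + smul (-c) (Pm x))"
    by (intro wave_system_add wave_system_smul wave_m wave_p)
  have "Pp 0 + smul (-c) (Pm 0) = 0" by (simp add: c smul_def prod_eq_iff)
  then have "Pp x + smul (-c) (Pm x) = 0" for x
    using wave_nonzero[OF D, of x 0] by blast
  then have "Pp x = smul c (Pm x)" for x
    by (simp add: smul_def prod_eq_iff eq_neg_iff_add_eq_0)
  then have "norm (Pp x) = norm c * norm (Pm x)" for x by simp
  then have n: "norm (Pm x) \<le> (1 / norm c) * norm (Pp x)" for x
    using \<open>c \<noteq> 0\<close> by (simp add: field_simps)
  have "L2_on {0..} Pm"
    by (rule L2_on_mono[OF Pp_L2[of 0], of _ "1 / norm c"]) (use n continuous_vfun_measurable[OF cont_m] in auto)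
  then have L2: "L2 Pm" using Pm_L2 L2_on_halves by blast
  obtain C where C: "\<And>F G. Dgraph q F (\<lambda>x. G x + smul z (F x)) \<Longrightarrow> L2norm F \<le> C * L2norm G"
    using resolvent_bound by metis
  \<comment> \<open>The right-hand side is written as \<open>G\<close> plus z \<open>Pm\<close> with
    \<open>G\<close> = 0, so that the resolvent bound forces the norm of \<open>Pm\<close> to
    vanish.\<close>
  have "Dgraph q Pm (\<lambda>x. 0 + smul z (Pm x))"
    unfolding Dgraph_iff[OF q]
  proof (intro conjI exI[of _ Pm] L2)
    show "L2 (\<lambda>x. 0 + smul z (Pm x))" using L2_smul[OF L2] by simp
    show "ac_deriv (\<lambda>x. fst (Pm x)) (\<lambda>x. - \<i> * fst (0 + smul z (Pm x)) + q x * snd (Pm x))"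
      by (rule ac_deriv_cong[OF wave_system_fst[OF wave_m]]) (simp_all add: smul_def)
    show "ac_deriv (\<lambda>x. snd (Pm x)) (\<lambda>x. \<i> * snd (0 + smul z (Pm x)) - cnj (q x) * fst (Pm x))"
      by (rule ac_deriv_cong[OF wave_system_snd[OF wave_m]]) (simp_all add: smul_def)
  qed (simp add: aeeq_def)
  from C[OF this] have "L2norm Pm \<le> C * L2norm (\<lambda>x. 0)" .
  moreover have "L2norm (\<lambda>x. 0) = 0" by (simp add: L2norm_def)
  ultimately have "L2norm Pm = 0" using L2norm_nonneg[of Pm] by simp
  then have "(LINT x|lborel. (norm (Pm x))\<^sup>2) = 0" using L2norm_power2[of Pm] by simp
  then have "AE x in lborel. (norm (Pm x))\<^sup>2 = 0"
    using L2 integral_nonneg_eq_0_iff_AE[of lborel "\<lambda>x. (norm (Pm x))\<^sup>2"] by (simp add: L2_def)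
  then show False by (simp add: Pm_nonzero eventually_False ae_filter_eq_bot_iff)
qed

text \<open>The tail mass of Psi_+: an integrated quantity on which the resolvent bound acts
  directly and which still controls point values.\<close>

definition U :: "real \<Rightarrow> real" where "U R = (LINT x:{R..}|lborel. (norm (Pp x))\<^sup>2)"

lemma Pp_sq_integrable: "set_integrable lborel {R..} (\<lambda>x. (norm (Pp x))\<^sup>2)"
  using Pp_L2[of R] by (simp add: L2_on_def)

text \<open>\<open>primitive\<close> is complex valued, hence the detour through
  \<open>of_real\<close> and \<open>Re\<close>.\<close>

lemma U_deriv: "(U has_real_derivative - (norm (Pp x))\<^sup>2) (at x)"
proof -
  let ?f = "\<lambda>x. complex_of_real ((norm (Pp x))\<^sup>2)"
  have i: "set_integrable lborel {R..} ?f" for R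
    using Pp_sq_integrable[of R] integrable_of_real[of lborel "\<lambda>x. indicator {R..} x *\<^sub>R (norm (Pp x))\<^sup>2", where ?'a = complex]
    by (simp add: set_integrable_def scaleR_conv_of_real)
  have c: "continuous_on UNIV ?f" by (intro continuous_intros cont_p)
  have "primitive (\<lambda>x. LINT y:{x..}|lborel. ?f y) (\<lambda>x. - ?f x)"
    by (rule primitive_indefinite_atLeast[OF borel_measurable_continuous_onI[OF c] i])
  then have "((\<lambda>x. LINT y:{x..}|lborel. ?f y) has_vector_derivative - ?f x) (at x)"
    by (rule primitive_has_vector_derivative) (intro continuous_intros cont_p)
  then have "((\<lambda>x. complex_of_real (U x)) has_vector_derivative - ?f x) (at x)"
    by (simp only: set_integral_complex_of_real U_def)
  then have "((\<lambda>x. Re (complex_of_real (U x))) has_vector_derivative Re (- ?f x)) (at x)"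
    by (rule bounded_linear.has_vector_derivative[OF bounded_linear_Re])
  then show ?thesis by (simp add: has_real_derivative_iff_has_vector_derivative del: of_real_power)
qed

lemma U_nonneg: "0 \<le> U R"
  unfolding U_def set_lebesgue_integral_def by (intro integral_nonneg_AE AE_I2) (simp add: indicator_def)

text \<open>Already the window [R, R + 1] carries this much mass, by comparability over distance
  1.\<close>

lemma U_lower: "exp (- (2 * \<bar>Im z\<bar>)) * (norm (Pp R))\<^sup>2 \<le> U R"
proof -
  have "exp (- (2 * \<bar>Im z\<bar>)) * (norm (Pp R))\<^sup>2 = (LINT x:{R..R+1}|lborel. exp (- (2 * \<bar>Im z\<bar>)) * (norm (Pp R))\<^sup>2)"
    by (simp add: set_lebesgue_integral_def)
  also have "\<dots> \<le> U R"
    unfolding U_def set_lebesgue_integral_def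
  proof (rule integral_mono)
    show "integrable lborel (\<lambda>x. indicator {R..R+1} x *\<^sub>R (exp (- (2 * \<bar>Im z\<bar>)) * (norm (Pp R))\<^sup>2))"
      by (intro integrable_scaleR_left) (simp add: integrable_indicator_iff)
    show "integrable lborel (\<lambda>x. indicator {R..} x *\<^sub>R (norm (Pp x))\<^sup>2)"
      using Pp_sq_integrable[of R] by (simp add: set_integrable_def)
    fix x
    have "exp (- (2 * \<bar>Im z\<bar>)) * (norm (Pp R))\<^sup>2 \<le> (norm (Pp x))\<^sup>2" if "R \<le> x" "x \<le> R + 1"
      using that by (intro wave_norm_ge[OF wave_p]) auto
    then show "indicator {R..R+1} x *\<^sub>R (exp (- (2 * \<bar>Im z\<bar>)) * (norm (Pp R))\<^sup>2) \<le> indicator {R..} x *\<^sub>R (norm (Pp x))\<^sup>2"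
      by (auto simp: indicator_def)
  qed
  finally show ?thesis .
qed

text \<open>The resolvent bound is applied to a tent function supported in \<open>[R - 1, R]\<close> times
  \<open>\<sigma>\<^sub>1\<close> times the conjugate of \<open>\<Psi>\<^sub>-\<close>: to the right of \<open>R\<close> the solution is a multiple of \<open>\<Psi>\<^sub>+\<close>.\<close>

lemma resolvent_estimate: "\<exists>A>0. \<forall>R. (norm (Pm R))\<^sup>2 * U R \<le> A"
proof -
  obtain C where "C \<ge> 0" and C: "\<And>F G. Dgraph q F (\<lambda>x. G x + smul z (F x)) \<Longrightarrow> L2norm F \<le> C * L2norm G"
    using resolvent_bound by metis
  \<comment> \<open>The 8 is 2 times 4: on a window of length 1/2 the tent is at least 1/4, and
    |Psi_-|^2 is at least the exponential factor times its value at \<open>R\<close>.\<close>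
  define k where "k = exp (- (2 * \<bar>Im z\<bar>)) / 8"
  have "k > 0" by (simp add: k_def)
  have main: "k * (norm (Pm R))\<^sup>2 * U R \<le> (C * norm W)\<^sup>2" for R
  proof -
    define t where "t x = max 0 (min (x - R + 1) (R - x))" for x
    have t0: "0 \<le> t x" "t x \<le> 1" for x by (auto simp: t_def)
    have ts: "t x = 0" if "x \<notin> {R-1..R}" for x using that by (auto simp: t_def)
    have ct: "continuous_on UNIV t" unfolding t_def by (intro continuous_intros)
    define F where "F x = smul (of_real (t x)) (cnj (snd (Pm x)), cnj (fst (Pm x)))" for x
    have cF: "continuous_on UNIV F"
      unfolding F_def smul_def by (intro continuous_intros ct cont_m)
    have F0: "F x = 0" if "x \<notin> {R-1..R}" for x
      using ts[OF that] by (simp add: F_def smul_def zero_prod_def)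
    have normF: "norm (F x) = t x * norm (Pm x)" for x
      unfolding F_def norm_smul using t0[of x] by (simp add: norm_prod_def add.commute)
    have bF: "bil (Pm x) (F x) = of_real (t x * (norm (Pm x))\<^sup>2)" for x
      unfolding bil_def F_def smul_def norm_prod_square of_real_mult of_real_add complex_norm_square
      by (simp add: algebra_simps)
    have L2F: "L2 F"
      by (rule L2_continuous_tails[OF cF, of "R-1" R])
        (auto intro!: L2_on_mono[OF Pm_L2[of "R-1"], of _ 1] L2_on_mono[OF Pp_L2[of R], of _ 0]
          continuous_vfun_measurable[OF cF] simp: normF intro: mult_left_le_one_le t0, auto simp: t_def)
    have cbil: "continuous_on UNIV (\<lambda>x. bil (P x) (F x))" if "continuous_on UNIV P" for P :: vfun
      unfolding bil_def by (intro continuous_intros that cF)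
    have ibil: "integrable lborel (\<lambda>x. bil (P x) (F x))" if "continuous_on UNIV P" for P :: vfun
    proof -
      have "set_integrable lborel {R-1..R} (\<lambda>x. bil (P x) (F x))"
        by (rule borel_integrable_atLeastAtMost'[OF continuous_on_subset[OF cbil[OF that]]]) simp
      moreover have "(\<lambda>x. indicator {R-1..R} x *\<^sub>R bil (P x) (F x)) = (\<lambda>x. bil (P x) (F x))"
        using F0 by (auto simp: indicator_def bil_def)
      ultimately show ?thesis by (simp add: set_integrable_def)
    qed
    define A where "A x = (LINT y:{..x}|lborel. bil (Pm y) (F y))" for x
    define B where "B x = (LINT y:{x..}|lborel. bil (Pp y) (F y))" for x
    have A: "ac_deriv A (\<lambda>x. bil (Pm x) (F x))"
      unfolding A_def[abs_def]
      by (intro primitive_ac_deriv primitive_indefinite_atMost borel_measurable_continuous_onI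
          cbil cont_m set_integrable_UNIV_subset ibil) simp
    have B: "ac_deriv B (\<lambda>x. - bil (Pp x) (F x))"
      unfolding B_def[abs_def]
      by (intro primitive_ac_deriv primitive_indefinite_atLeast borel_measurable_continuous_onI continuous_intros
          cbil cont_p set_integrable_UNIV_subset ibil) simp
    define I where "I = (LINT x|lborel. t x * (norm (Pm x))\<^sup>2)"
    have It: "integrable lborel (\<lambda>x. t x * (norm (Pm x))\<^sup>2)"
      using integrable_Re[OF ibil[OF cont_m]] unfolding bF by simp
    have AR: "A x = of_real I" if "x \<ge> R" for x
    proof -
      have "A x = (LINT y|lborel. bil (Pm y) (F y))"
        unfolding A_def set_lebesgue_integral_def
        using that F0 by (intro Bochner_Integration.integral_cong) (auto simp: indicator_def bil_def)
      then show ?thesis unfolding bF I_def by (simp del: of_real_mult of_real_power)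
    qed
    have A0: "A x = 0" if "x \<le> R - 1" for x
    proof -
      have "A x = (LINT y:{..x}|lborel. 0)"
        unfolding A_def using that by (intro set_lebesgue_integral_cong) (auto simp: bF t_def)
      then show ?thesis by simp
    qed
    have BR: "B x = B (R - 1)" if "x \<le> R - 1" for x
      unfolding B_def set_lebesgue_integral_def
      using that F0 by (intro Bochner_Integration.integral_cong) (auto simp: indicator_def bil_def)
    have B0: "B x = 0" if "x \<ge> R" for x
    proof -
      have "B x = (LINT y:{x..}|lborel. 0)"
        unfolding B_def using that by (intro set_lebesgue_integral_cong) (auto simp: bil_def F_def smul_def t_def)
      then show ?thesis by simp
    qed
    \<comment> \<open>Variation of parameters: (M(q) - z) u = - i W F. Keeping \<open>W\<close> on
      the right avoids dividing by it. Left of the support \<open>A\<close> vanishes, right of it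
      \<open>B\<close> does, so \<open>u\<close> is a multiple of the square-integrable Weyl
      solution at each end.\<close>
    define u where "u x = smul (A x) (Pp x) + smul (B x) (Pm x)" for x
    have W_eq: "fst (Pm x) * snd (Pp x) = W + snd (Pm x) * fst (Pp x)" for x
      using dt_m_p[of x] by (simp add: dt_def algebra_simps)
    have u1: "ac_deriv (\<lambda>x. fst (u x)) (\<lambda>x. - \<i> * fst (smul (- \<i> * W) (F x) + smul z (u x)) + q x * snd (u x))"
    proof (rule ac_deriv_cong[OF ac_deriv_add[OF ac_deriv_mult[OF A wave_system_fst[OF wave_p]] ac_deriv_mult[OF B wave_system_fst[OF wave_m]]]])
      fix x
      have "bil (Pm x) (F x) * fst (Pp x) - bil (Pp x) (F x) * fst (Pm x)
         = fst (F x) * (snd (Pm x) * fst (Pp x)) - fst (F x) * (fst (Pm x) * snd (Pp x))"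
        by (simp add: bil_def algebra_simps)
      also have "\<dots> = - W * fst (F x)" unfolding W_eq by (simp add: algebra_simps)
      finally have *: "bil (Pm x) (F x) * fst (Pp x) = bil (Pp x) (F x) * fst (Pm x) - W * fst (F x)" by (simp add: algebra_simps)
      show "bil (Pm x) (F x) * fst (Pp x) + A x * (- \<i> * z * fst (Pp x) + q x * snd (Pp x)) +
         (- bil (Pp x) (F x) * fst (Pm x) + B x * (- \<i> * z * fst (Pm x) + q x * snd (Pm x))) =
         - \<i> * fst (smul (- \<i> * W) (F x) + smul z (u x)) + q x * snd (u x)"
        unfolding * u_def smul_def by (simp add: algebra_simps)
    qed (simp add: u_def smul_def)
    have u2: "ac_deriv (\<lambda>x. snd (u x)) (\<lambda>x. \<i> * snd (smul (- \<i> * W) (F x) + smul z (u x)) - cnj (q x) * fst (u x))"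
    proof (rule ac_deriv_cong[OF ac_deriv_add[OF ac_deriv_mult[OF A wave_system_snd[OF wave_p]] ac_deriv_mult[OF B wave_system_snd[OF wave_m]]]])
      fix x
      have "bil (Pm x) (F x) * snd (Pp x) - bil (Pp x) (F x) * snd (Pm x)
         = snd (F x) * (fst (Pm x) * snd (Pp x)) - snd (F x) * (snd (Pm x) * fst (Pp x))"
        by (simp add: bil_def algebra_simps)
      also have "\<dots> = W * snd (F x)" unfolding W_eq by (simp add: algebra_simps)
      finally have *: "bil (Pm x) (F x) * snd (Pp x) = bil (Pp x) (F x) * snd (Pm x) + W * snd (F x)" by (simp add: algebra_simps)
      show "bil (Pm x) (F x) * snd (Pp x) + A x * (\<i> * z * snd (Pp x) - cnj (q x) * fst (Pp x)) +
         (- bil (Pp x) (F x) * snd (Pm x) + B x * (\<i> * z * snd (Pm x) - cnj (q x) * fst (Pm x))) =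
         \<i> * snd (smul (- \<i> * W) (F x) + smul z (u x)) - cnj (q x) * fst (u x)"
        unfolding * u_def smul_def by (simp add: algebra_simps)
    qed (simp add: u_def smul_def)
    have cu: "continuous_on UNIV u" using ac_deriv_continuous_vfun[OF u1 u2] .
    have uR: "norm (u x) = I * norm (Pp x)" if "x \<ge> R" for x
    proof -
      have "u x = smul (of_real I) (Pp x)" using that by (simp add: u_def AR B0 smul_def zero_prod_def)
      moreover have "I \<ge> 0" unfolding I_def by (intro integral_nonneg_AE AE_I2 mult_nonneg_nonneg t0) simp
      ultimately show ?thesis by simp
    qed
    have L2u: "L2 u"
    proof (rule L2_continuous_tails[OF cu])
      show "L2_on {..R-1} u"
      proof (rule L2_on_mono[OF Pm_L2[of "R-1"] continuous_vfun_measurable[OF cu]])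
        fix x assume "x \<in> {..R-1}"
        then have "u x = smul (B (R - 1)) (Pm x)" using BR[of x] A0[of x] by (simp add: u_def smul_def prod_eq_iff)
        then show "norm (u x) \<le> norm (B (R-1)) * norm (Pm x)" by simp
      qed simp
      show "L2_on {R..} u"
        by (rule L2_on_mono[OF Pp_L2[of R] continuous_vfun_measurable[OF cu], of I]) (auto simp: uR)
    qed
    have "Dgraph q u (\<lambda>x. smul (- \<i> * W) (F x) + smul z (u x))"
      unfolding Dgraph_iff[OF q]
      by (intro conjI exI[of _ u] L2u u1 u2 L2_add L2_smul L2F) (simp add: aeeq_def)
    from C[OF this] have "L2norm u \<le> C * L2norm (\<lambda>x. smul (- \<i> * W) (F x))" .
    moreover have "L2norm (\<lambda>x. smul (- \<i> * W) (F x)) = norm W * L2norm F"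
      by (simp add: L2norm_def norm_mult power_mult_distrib real_sqrt_mult)
    ultimately have "L2norm u \<le> C * norm W * L2norm F" by simp
    then have "(L2norm u)\<^sup>2 \<le> (C * norm W * L2norm F)\<^sup>2" by (intro power_mono L2norm_nonneg)
    then have uF: "(LINT x|lborel. (norm (u x))\<^sup>2) \<le> (C * norm W)\<^sup>2 * (LINT x|lborel. (norm (F x))\<^sup>2)"
      by (simp only: L2norm_power2 power_mult_distrib)
    \<comment> \<open>The mass of \<open>u\<close> beyond \<open>R\<close> is quadratic in
      \<open>I\<close>, whereas the mass of \<open>F\<close> is at most \<open>I\<close> because t^2
      \<le> t. Cancelling one positive factor \<open>I\<close> leaves a bound for I U(R), and
      \<open>I\<close> itself dominates k |Psi_-(R)|^2.\<close>
    have "I\<^sup>2 * U R = (LINT x:{R..}|lborel. (norm (u x))\<^sup>2)"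
      unfolding U_def set_integral_mult_right[symmetric]
      by (intro set_lebesgue_integral_cong) (auto simp: uR power_mult_distrib)
    also have "\<dots> \<le> (LINT x|lborel. (norm (u x))\<^sup>2)"
      unfolding set_lebesgue_integral_def
      using set_integrable_UNIV_subset[of "\<lambda>x. (norm (u x))\<^sup>2" "{R..}"] L2u
      by (intro integral_mono) (auto simp: L2_def set_integrable_def indicator_def)
    finally have "I\<^sup>2 * U R \<le> (C * norm W)\<^sup>2 * (LINT x|lborel. (norm (F x))\<^sup>2)" using uF by linarith
    also have "\<dots> \<le> (C * norm W)\<^sup>2 * I"
    proof (intro mult_left_mono)
      show "(LINT x|lborel. (norm (F x))\<^sup>2) \<le> I"
        unfolding I_def
      proof (rule integral_mono)
        show "integrable lborel (\<lambda>x. (norm (F x))\<^sup>2)" using L2F by (simp add: L2_def)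
        fix x
        have "t x * t x \<le> t x" using t0[of x] by (intro mult_left_le) auto
        then have "(t x * t x) * (norm (Pm x))\<^sup>2 \<le> t x * (norm (Pm x))\<^sup>2" by (intro mult_right_mono) auto
        then show "(norm (F x))\<^sup>2 \<le> t x * (norm (Pm x))\<^sup>2" by (simp add: normF power2_eq_square mult_ac)
      qed (rule It)
    qed simp
    finally have IU: "I * (I * U R) \<le> I * (C * norm W)\<^sup>2" by (simp add: power2_eq_square mult_ac)
    have "k * (norm (Pm R))\<^sup>2 \<le> I"
    proof -
      have "k * (norm (Pm R))\<^sup>2 = (LINT x:{R-3/4..R-1/4}|lborel. (exp (- (2 * \<bar>Im z\<bar>)) / 4) * (norm (Pm R))\<^sup>2)"
        by (simp add: set_lebesgue_integral_def k_def)
      also have "\<dots> \<le> I"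
        unfolding I_def set_lebesgue_integral_def
      proof (rule integral_mono[OF _ It])
        show "integrable lborel (\<lambda>x. indicator {R-3/4..R-1/4} x *\<^sub>R ((exp (- (2 * \<bar>Im z\<bar>)) / 4) * (norm (Pm R))\<^sup>2))"
          using borel_integrable_atLeastAtMost'[of "R-3/4" "R-1/4" "\<lambda>x. (exp (- (2 * \<bar>Im z\<bar>)) / 4) * (norm (Pm R))\<^sup>2"]
          by (simp add: set_integrable_def)
        fix x
        show "indicator {R-3/4..R-1/4} x *\<^sub>R ((exp (- (2 * \<bar>Im z\<bar>)) / 4) * (norm (Pm R))\<^sup>2) \<le> t x * (norm (Pm x))\<^sup>2"
        proof (cases "x \<in> {R-3/4..R-1/4}")
          case True
          then have tx: "1/4 \<le> t x" by (auto simp: t_def)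
          have "exp (- (2 * \<bar>Im z\<bar>)) * (norm (Pm R))\<^sup>2 \<le> (norm (Pm x))\<^sup>2"
            using True by (intro wave_norm_ge[OF wave_m]) auto
          then have "1/4 * (exp (- (2 * \<bar>Im z\<bar>)) * (norm (Pm R))\<^sup>2) \<le> t x * (norm (Pm x))\<^sup>2"
            using tx by (intro mult_mono) auto
          then show ?thesis using True by simp
        next
          case False
          then show ?thesis using t0[of x] by simp
        qed
      qed
      finally show ?thesis .
    qed
    moreover have "k * (norm (Pm R))\<^sup>2 > 0" using \<open>k > 0\<close> Pm_nonzero[of R] by simp
    ultimately have "I > 0" by linarith
    then have "I * U R \<le> (C * norm W)\<^sup>2" using IU by (simp add: mult_le_cancel_left)
    moreover have "k * (norm (Pm R))\<^sup>2 * U R \<le> I * U R"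
      by (intro mult_right_mono U_nonneg) fact
    ultimately show ?thesis by linarith
  qed
  show ?thesis
  \<comment> \<open>The summand 1 makes the constant strictly positive even for \<open>C\<close> =
    0; its quotient by |W|^2 later serves as a decay length.\<close>
  proof (intro exI[of _ "((C * norm W)\<^sup>2 + 1) / k"] conjI allI)
    show "((C * norm W)\<^sup>2 + 1) / k > 0" using \<open>k > 0\<close> by (intro divide_pos_pos) (auto intro: add_nonneg_pos)
    show "(norm (Pm R))\<^sup>2 * U R \<le> ((C * norm W)\<^sup>2 + 1) / k" for R
      using main[of R] \<open>k > 0\<close> by (simp add: pos_le_divide_eq mult_ac)
  qed
qed

lemma kernel_decay:
  obtains C e where "C \<ge> 0" "e > 0"
    "\<And>x y. y \<le> x \<Longrightarrow> norm (Pp x) * norm (Pm y) \<le> C * exp (- (e * (x - y)))"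
proof -
  obtain A where "A > 0" and A: "\<And>R. (norm (Pm R))\<^sup>2 * U R \<le> A" using resolvent_estimate by blast
  define L where "L = A / (norm W)\<^sup>2"
  have "L > 0" using \<open>A > 0\<close> W_nonzero by (simp add: L_def)
  define c where "c = exp (- (2 * \<bar>Im z\<bar>))"
  have "c > 0" by (simp add: c_def)
  have UL: "U R \<le> L * (norm (Pp R))\<^sup>2" for R
  proof -
    have "norm W \<le> norm (Pm R) * norm (Pp R)" using norm_dt_le[of "Pm R" "Pp R"] dt_m_p by simp
    then have "(norm W)\<^sup>2 \<le> (norm (Pm R))\<^sup>2 * (norm (Pp R))\<^sup>2"
      using power_mono[of "norm W" "norm (Pm R) * norm (Pp R)" 2] by (simp add: power_mult_distrib)
    then have "(norm W)\<^sup>2 * U R \<le> (norm (Pp R))\<^sup>2 * ((norm (Pm R))\<^sup>2 * U R)"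
      using mult_right_mono[of "(norm W)\<^sup>2" "(norm (Pm R))\<^sup>2 * (norm (Pp R))\<^sup>2" "U R"] U_nonneg[of R]
      by (simp add: mult_ac)
    also have "\<dots> \<le> (norm (Pp R))\<^sup>2 * A" by (intro mult_left_mono A) simp
    finally show ?thesis using W_nonzero by (simp add: L_def field_simps)
  qed
  \<comment> \<open>\<open>UL\<close> reads U \<le> - L U', so the product with exp (x / L) has
    nonpositive derivative.\<close>
  have decr: "exp (x / L) * U x \<le> exp (y / L) * U y" if "y \<le> x" for x y
  proof (rule DERIV_nonpos_imp_nonincreasing[OF that, of "\<lambda>x. exp (x / L) * U x"])
    fix s
    have "((\<lambda>x. exp (x / L) * U x) has_real_derivative exp (s / L) * (- (norm (Pp s))\<^sup>2) + (exp (s / L) * (1 / L)) * U s) (at s)"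
      by (rule DERIV_mult'[OF _ U_deriv]) (use \<open>L > 0\<close> in \<open>auto intro!: derivative_eq_intros\<close>)
    moreover have "exp (s / L) * (- (norm (Pp s))\<^sup>2) + (exp (s / L) * (1 / L)) * U s = exp (s / L) * (U s / L - (norm (Pp s))\<^sup>2)"
      by (simp add: algebra_simps)
    moreover have "U s / L - (norm (Pp s))\<^sup>2 \<le> 0" using UL[of s] \<open>L > 0\<close> by (simp add: pos_divide_le_eq mult.commute)
    ultimately show "\<exists>y. ((\<lambda>x. exp (x / L) * U x) has_real_derivative y) (at s) \<and> y \<le> 0"
      by (intro exI conjI) (assumption, simp add: mult_le_0_iff)
  qed
  \<comment> \<open>Squared, the left side is at most U(x)/c times |Psi_-(y)|^2. The decay of
    \<open>U\<close> from \<open>y\<close> to \<open>x\<close> leaves |Psi_-(y)|^2 U(y), which is at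
    most \<open>A\<close>. The square root halves the rate 1/L.\<close>
  have "norm (Pp x) * norm (Pm y) \<le> sqrt (A / c) * exp (- (1 / (2 * L) * (x - y)))" if "y \<le> x" for x y
  proof (rule power2_le_imp_le)
    have "c * (norm (Pp x))\<^sup>2 \<le> U x" using U_lower[of x] by (simp add: c_def)
    also have "U x = exp (- (x / L)) * (exp (x / L) * U x)" by (simp add: exp_minus)
    also have "\<dots> \<le> exp (- (x / L)) * (exp (y / L) * U y)" by (intro mult_left_mono decr that) simp
    also have "\<dots> = exp (- ((x - y) / L)) * U y"
      by (simp only: mult.assoc[symmetric] exp_add[symmetric]) (simp add: diff_divide_distrib)
    finally have "c * (norm (Pp x))\<^sup>2 * (norm (Pm y))\<^sup>2 \<le> exp (- ((x - y) / L)) * U y * (norm (Pm y))\<^sup>2"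
      by (intro mult_right_mono) auto
    also have "\<dots> = exp (- ((x - y) / L)) * ((norm (Pm y))\<^sup>2 * U y)" by simp
    also have "\<dots> \<le> exp (- ((x - y) / L)) * A" by (intro mult_left_mono A) simp
    finally have "(norm (Pp x) * norm (Pm y))\<^sup>2 \<le> A / c * exp (- ((x - y) / L))"
      using \<open>c > 0\<close> by (simp add: pos_le_divide_eq power_mult_distrib mult_ac)
    also have "exp (- ((x - y) / L)) = (exp (- (1 / (2 * L) * (x - y))))\<^sup>2"
      using \<open>L > 0\<close> by (simp add: power2_eq_square exp_add[symmetric] field_simps)
    also have "A / c * (exp (- (1 / (2 * L) * (x - y))))\<^sup>2 = (sqrt (A / c) * exp (- (1 / (2 * L) * (x - y))))\<^sup>2"
      using \<open>A > 0\<close> \<open>c > 0\<close> by (simp add: power_mult_distrib)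
    finally show "(norm (Pp x) * norm (Pm y))\<^sup>2 \<le> (sqrt (A / c) * exp (- (1 / (2 * L) * (x - y))))\<^sup>2" .
    show "0 \<le> sqrt (A / c) * exp (- (1 / (2 * L) * (x - y)))" using \<open>A > 0\<close> \<open>c > 0\<close> by simp
  qed
  then show ?thesis
    using that[of "sqrt (A / c)" "1 / (2 * L)"] \<open>A > 0\<close> \<open>c > 0\<close> \<open>L > 0\<close> by simp
qed

end

section \<open>Boundedness\<close>

lemma bil_add_left: "bil (u + v) w = bil u w + bil v w"
  and bil_add_right: "bil u (v + w) = bil u v + bil u w"
  and bil_smul_left: "bil (smul c u) v = c * bil u v"
  and bil_smul_right: "bil u (smul c v) = c * bil u v"
  by (simp_all add: bil_def smul_def algebra_simps)

lemma Kv_Kv: "Kv (Kv v) = - v"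
  by (simp add: Kv_def prod_eq_iff)

lemma Kv_add: "Kv (u + v) = Kv u + Kv v"
  by (simp add: Kv_def)

lemma Kv_smul_of_real: "Kv (smul (of_real r) v) = smul (of_real r) (Kv v)"
  by (simp add: Kv_def smul_def)

lemma L2_Kv: "L2 F \<Longrightarrow> L2 (\<lambda>x. Kv (F x))"
  by (rule L2_mono[of F _ 1]) (auto simp: L2_def intro: borel_measurable_Kv)

lemma set_integral_bil_cong:
  assumes "L2 F" "L2 G" "aeeq F G" "p \<in> borel_measurable borel" "S \<in> sets borel"
  shows "(LINT y:S|lborel. bil (p y) (F y)) = (LINT y:S|lborel. bil (p y) (G y))"
proof (rule set_lebesgue_integral_cong_AE)
  show "AE x\<in>S in lborel. bil (p x) (F x) = bil (p x) (G x)"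
    using assms(3) unfolding aeeq_def by eventually_elim simp
qed (use assms L2_measurable in \<open>auto intro: borel_measurable_bil\<close>)

lemma set_integral_bil_vlin:
  assumes "set_integrable lborel S (\<lambda>y. bil (p y) (F y))" "set_integrable lborel S (\<lambda>y. bil (p y) (G y))"
  shows "(LINT y:S|lborel. bil (p y) (vlin a F b G y)) = a * (LINT y:S|lborel. bil (p y) (F y)) + b * (LINT y:S|lborel. bil (p y) (G y))"
proof -
  have "(LINT y:S|lborel. bil (p y) (vlin a F b G y)) = (LINT y:S|lborel. a * bil (p y) (F y) + b * bil (p y) (G y))"
    by (simp add: vlin_def bil_add_right bil_smul_right)
  also have "\<dots> = (LINT y:S|lborel. a * bil (p y) (F y)) + (LINT y:S|lborel. b * bil (p y) (G y))"
    by (rule set_integral_add(2)) (use assms in auto)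
  finally show ?thesis by simp
qed

text \<open>The scalar \<open>c\<close> stands for the norm of the outer factor at \<open>x\<close>.
  It must be moved inside before estimating, since only the product with the inner factor
  decays.\<close>

lemma kernel_integral_bound:
  assumes e: "e > 0" and F: "L2 F" and c: "c \<ge> 0" and C: "C \<ge> 0"
    and le: "\<And>y. y \<in> A \<Longrightarrow> c * norm (p y) \<le> C * expk e x y"
  shows "c * norm (LINT y:A|lborel. bil (p y) (F y)) \<le> C * (LINT y|lborel. expk e x y * norm (F y))"
proof -
  have "c * norm (LINT y:A|lborel. bil (p y) (F y)) \<le> c * (LINT y|lborel. norm (indicator A y *\<^sub>R bil (p y) (F y)))"
    unfolding set_lebesgue_integral_def by (intro mult_left_mono integral_norm_bound c)
  also have "\<dots> = (LINT y|lborel. c * norm (indicator A y *\<^sub>R bil (p y) (F y)))" by simp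
  also have "\<dots> \<le> (LINT y|lborel. C * (expk e x y * norm (F y)))"
  proof (rule integral_mono')
    show "integrable lborel (\<lambda>y. C * (expk e x y * norm (F y)))"
      using exp_kernel_integrable(1)[OF e F, of x] by simp
    fix y
    show "0 \<le> C * (expk e x y * norm (F y))" using C by simp
    show "c * norm (indicator A y *\<^sub>R bil (p y) (F y)) \<le> C * (expk e x y * norm (F y))"
    proof (cases "y \<in> A")
      case True
      have "c * norm (bil (p y) (F y)) \<le> c * (norm (p y) * norm (F y))" by (intro mult_left_mono norm_bil_le c)
      also have "\<dots> = (c * norm (p y)) * norm (F y)" by simp
      also have "\<dots> \<le> (C * expk e x y) * norm (F y)" by (intro mult_right_mono le True) simp
      finally show ?thesis using True by simp
    qed (use C in simp)
  qed
  finally show ?thesis by simp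
qed

text \<open>Common shape of T and S: the identity plus an integral operator whose values ignore null
  sets. The predicate \<open>A\<close> is arbitrary and so covers both the whole space and the
  J-orthogonal complement.\<close>

lemma bounded_linear_L2_identity_plus:
  assumes e: "e > 0" and C: "C \<ge> 0"
    and T: "\<And>F. T F = (\<lambda>x. F x + R F x)"
    and cong: "\<And>F G. L2 F \<Longrightarrow> L2 G \<Longrightarrow> aeeq F G \<Longrightarrow> R F = R G"
    and lin: "\<And>F G a b. L2 F \<Longrightarrow> L2 G \<Longrightarrow> R (vlin a F b G) = vlin a (R F) b (R G)"
    and meas: "\<And>F. L2 F \<Longrightarrow> R F \<in> borel_measurable borel"
    and bound: "\<And>F x. L2 F \<Longrightarrow> norm (R F x) \<le> C * (LINT y|lborel. expk e x y * norm (F y))"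
  shows "bounded_linear_L2 A T"
  unfolding bounded_linear_L2_def
proof (intro conjI allI impI)
  note RL = exp_kernel_L2_bound[OF e _ C meas bound]
  show "aeeq (T F) (T G)" if "L2 F \<and> A F \<and> L2 G \<and> A G \<and> aeeq F G" for F G
    using that cong[of F G] unfolding aeeq_def T by (auto elim!: AE_mp)
  show "L2 (T F)" if "L2 F \<and> A F" for F
    unfolding T by (intro L2_add RL(1)[of F]) (use that in auto)
  show "aeeq (T (vlin a F b G)) (vlin a (T F) b (T G))" if "L2 F \<and> A F \<and> L2 G \<and> A G" for F G a b
  proof -
    have "T (vlin a F b G) = vlin a (T F) b (T G)"
      unfolding T using that by (simp add: lin) (simp add: vlin_def smul_def algebra_simps)
    then show ?thesis by (simp add: aeeq_def)
  qed
  show "\<exists>C. \<forall>F. L2 F \<and> A F \<longrightarrow> L2norm (T F) \<le> C * L2norm F"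
    unfolding T by (intro exI[of _ "sqrt (2 + 2 * (C * (2 / e))\<^sup>2)"] allI impI, elim conjE) 
      (intro L2norm_add_le RL; assumption)
qed

context weyl_pair
begin

abbreviation Ps :: vfun where "Ps \<equiv> Psi_sum Pm Pp"
abbreviation Phi :: vfun where "Phi \<equiv> Phi1 z Pm Pp"
abbreviation Tz :: "vfun \<Rightarrow> vfun" where "Tz \<equiv> Top z Pm Pp"
abbreviation Sz :: "vfun \<Rightarrow> vfun" where "Sz \<equiv> Shat z Pm Pp"

definition N :: "real \<Rightarrow> real" where "N x = (norm (Ps x))\<^sup>2"

lemma Ps_eq: "Ps x = Pm x + Pp x"
  by (simp add: Psi_sum_def)

lemma wave_s: "wave_system q z Ps"
  unfolding Psi_sum_def by (rule wave_system_add[OF wave_m wave_p])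

lemmas cont_s = wave_system_continuous[OF wave_s]

lemma dt_m_s: "dt (Pm x) (Ps x) = W" and dt_s_p: "dt (Ps x) (Pp x) = W" and dt_p_s: "dt (Pp x) (Ps x) = - W"
  using dt_m_p[of x] by (simp_all add: dt_def Ps_eq algebra_simps)

lemma norm_W_le: "norm W \<le> norm (Pm x) * norm (Ps x)" "norm W \<le> norm (Pp x) * norm (Ps x)"
  using norm_dt_le[of "Pm x" "Ps x"] norm_dt_le[of "Ps x" "Pp x"] by (simp_all add: dt_m_s dt_s_p mult.commute)

lemma Ps_nonzero: "Ps x \<noteq> 0"
  using norm_W_le(1)[of x] W_nonzero by auto

lemma N_pos: "N x > 0" and N_nonzero: "N x \<noteq> 0"
  using Ps_nonzero[of x] by (auto simp: N_def)

lemma Phi_eq: "Phi x = smul (of_real (Im z / N x)) (Kv (Ps x))"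
  by (simp add: Phi1_def N_def)

lemma Kv_Phi_eq: "Kv (Phi x) = smul (- of_real (Im z / N x)) (Ps x)"
  unfolding Phi_eq Kv_smul_of_real Kv_Kv by (simp add: smul_def prod_eq_iff)

lemma norm_Phi: "norm (Phi x) = \<bar>Im z\<bar> / norm (Ps x)"
  unfolding Phi_eq N_def norm_smul norm_of_real norm_Kv
  using Ps_nonzero[of x] by (simp add: power2_eq_square)

lemma inverse_norm_Ps_le: "1 / norm (Ps x) \<le> norm (Pm x) / norm W" "1 / norm (Ps x) \<le> norm (Pp x) / norm W"
  using norm_W_le[of x] Ps_nonzero[of x] W_nonzero by (simp_all add: field_simps)

text \<open>Since |Phi| = |Im z| / |Psi|, the determinant bounds put Phi below both Weyl solutions.
  It is therefore square integrable on both half-lines.\<close>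

lemma norm_Phi_le: "norm (Phi x) \<le> \<bar>Im z\<bar> / norm W * norm (Pm x)" "norm (Phi x) \<le> \<bar>Im z\<bar> / norm W * norm (Pp x)"
  using mult_left_mono[OF inverse_norm_Ps_le(1)[of x], of "\<bar>Im z\<bar>"] mult_left_mono[OF inverse_norm_Ps_le(2)[of x], of "\<bar>Im z\<bar>"]
  by (simp_all add: norm_Phi)

lemma cont_N: "continuous_on UNIV N"
  unfolding N_def[abs_def] by (intro continuous_intros cont_s)

lemma cont_Phi: "continuous_on UNIV Phi"
  unfolding Phi_eq[abs_def] smul_def Kv_def by (intro continuous_intros cont_s cont_N) (simp_all add: N_nonzero)

lemma L2_Phi: "L2 Phi"
  by (rule L2_on_halves[OF L2_on_mono[OF Pm_L2[of 0]] L2_on_mono[OF Pp_L2[of 0]]])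
    (auto intro: norm_Phi_le continuous_vfun_measurable[OF cont_Phi])

lemma L2_Kv_Phi: "L2 (\<lambda>x. Kv (Phi x))"
  by (rule L2_Kv[OF L2_Phi])

text \<open>Each Phi is traded for whichever Weyl solution completes a decaying pair on the given
  side of the diagonal; one constant serves all six products.\<close>

lemma kernel_bounds:
  obtains C e where "C \<ge> 0" "e > 0"
    "\<And>x y. y \<le> x \<Longrightarrow> norm (Pp x) * norm (Pm y) \<le> C * expk e x y"
    "\<And>x y. x \<le> y \<Longrightarrow> norm (Pm x) * norm (Pp y) \<le> C * expk e x y"
    "\<And>x y. y \<le> x \<Longrightarrow> norm (Phi x) * norm (Pm y) \<le> C * expk e x y"
    "\<And>x y. x \<le> y \<Longrightarrow> norm (Phi x) * norm (Pp y) \<le> C * expk e x y"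
    "\<And>x y. y \<le> x \<Longrightarrow> norm (Pp x) * norm (Phi y) \<le> C * expk e x y"
    "\<And>x y. x \<le> y \<Longrightarrow> norm (Pm x) * norm (Phi y) \<le> C * expk e x y"
proof -
  obtain C e where "C \<ge> 0" "e > 0"
    and Ce: "\<And>x y. y \<le> x \<Longrightarrow> norm (Pp x) * norm (Pm y) \<le> C * exp (- (e * (x - y)))"
    using kernel_decay by metis
  define k where "k = \<bar>Im z\<bar> / norm W"
  have "k \<ge> 0" by (simp add: k_def)
  note Phk = norm_Phi_le[folded k_def]
  define D where "D = C * (1 + k)"
  have CD: "C \<le> D" "C * k \<le> D" "D \<ge> 0" using \<open>C \<ge> 0\<close> \<open>k \<ge> 0\<close> by (simp_all add: D_def distrib_left)
  have 1: "norm (Pp x) * norm (Pm y) \<le> D * expk e x y"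
    and 2: "k * (norm (Pp x) * norm (Pm y)) \<le> D * expk e x y" if "y \<le> x" for x y
  proof -
    show "norm (Pp x) * norm (Pm y) \<le> D * expk e x y"
      using order_trans[OF Ce[OF that] mult_right_mono[OF CD(1) exp_ge_zero]] that by simp
    have "k * (norm (Pp x) * norm (Pm y)) \<le> k * (C * exp (- (e * (x - y))))"
      by (intro mult_left_mono Ce that \<open>k \<ge> 0\<close>)
    also have "\<dots> = (C * k) * exp (- (e * (x - y)))" by simp
    also have "\<dots> \<le> D * exp (- (e * (x - y)))" by (intro mult_right_mono CD) simp
    finally show "k * (norm (Pp x) * norm (Pm y)) \<le> D * expk e x y" using that by simp
  qed
  show ?thesis
  proof (rule that[OF CD(3) \<open>e > 0\<close>])
    fix x y :: real
    assume yx: "y \<le> x"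
    show "norm (Pp x) * norm (Pm y) \<le> D * expk e x y" by (rule 1[OF yx])
    show "norm (Phi x) * norm (Pm y) \<le> D * expk e x y"
      using 2[OF yx] mult_right_mono[OF Phk(2)[of x] norm_ge_zero[of "Pm y"]] by (simp add: mult_ac)
    show "norm (Pp x) * norm (Phi y) \<le> D * expk e x y"
      using 2[OF yx] mult_left_mono[OF Phk(1)[of y] norm_ge_zero[of "Pp x"]] by (simp add: mult_ac)
  next
    fix x y :: real
    assume xy: "x \<le> y"
    show "norm (Pm x) * norm (Pp y) \<le> D * expk e x y"
      using 1[OF xy] by (simp add: mult_ac abs_minus_commute)
    show "norm (Phi x) * norm (Pp y) \<le> D * expk e x y"
      using 2[OF xy] mult_right_mono[OF Phk(1)[of x] norm_ge_zero[of "Pp y"]] by (simp add: mult_ac abs_minus_commute)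
    show "norm (Pm x) * norm (Phi y) \<le> D * expk e x y"
      using 2[OF xy] mult_left_mono[OF Phk(2)[of y] norm_ge_zero[of "Pm x"]] by (simp add: mult_ac abs_minus_commute)
  qed
qed

definition am :: "vfun \<Rightarrow> real \<Rightarrow> complex" where "am F x = (LINT y:{..x}|lborel. bil (Pm y) (F y))"
definition bp :: "vfun \<Rightarrow> real \<Rightarrow> complex" where "bp F x = (LINT y:{x..}|lborel. bil (Pp y) (F y))"
definition kl :: "vfun \<Rightarrow> real \<Rightarrow> complex" where "kl F x = (LINT y:{..x}|lborel. bil (Kv (Phi y)) (F y))"
definition kr :: "vfun \<Rightarrow> real \<Rightarrow> complex" where "kr F x = (LINT y:{x..}|lborel. bil (Kv (Phi y)) (F y))"

lemma Top_eq: "Tz F x = F x + smul (2 * (am F x - bp F x)) (Phi x)"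
  by (simp add: Top_def am_def bp_def set_lebesgue_integral_def)

lemma Shat_eq: "Sz F x = F x + (smul (2 * kl F x) (Kv (Pp x)) - smul (2 * kr F x) (Kv (Pm x)))"
  by (simp add: Shat_def kl_def kr_def set_lebesgue_integral_def)

lemma integrable_m: "L2 F \<Longrightarrow> set_integrable lborel {..x} (\<lambda>y. bil (Pm y) (F y))"
  and integrable_p: "L2 F \<Longrightarrow> set_integrable lborel {x..} (\<lambda>y. bil (Pp y) (F y))"
  and integrable_Kv_Phi: "L2 F \<Longrightarrow> S \<in> sets borel \<Longrightarrow> set_integrable lborel S (\<lambda>y. bil (Kv (Phi y)) (F y))"
  by (simp_all add: L2_on_bil_integrable L2_imp_L2_on Pm_L2 Pp_L2 L2_Kv_Phi)

lemma measurable_m: "L2 F \<Longrightarrow> (\<lambda>y. bil (Pm y) (F y)) \<in> borel_measurable borel"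
  and measurable_p: "L2 F \<Longrightarrow> (\<lambda>y. bil (Pp y) (F y)) \<in> borel_measurable borel"
  and measurable_Kv_Phi: "L2 F \<Longrightarrow> (\<lambda>y. bil (Kv (Phi y)) (F y)) \<in> borel_measurable borel"
  by (intro borel_measurable_bil borel_measurable_Kv continuous_vfun_measurable cont_m cont_p cont_Phi L2_measurable; assumption)+

lemma primitive_am: "L2 F \<Longrightarrow> primitive (am F) (\<lambda>x. bil (Pm x) (F x))"
  and primitive_bp: "L2 F \<Longrightarrow> primitive (bp F) (\<lambda>x. - bil (Pp x) (F x))"
  and primitive_kl: "L2 F \<Longrightarrow> primitive (kl F) (\<lambda>x. bil (Kv (Phi x)) (F x))"
  and primitive_kr: "L2 F \<Longrightarrow> primitive (kr F) (\<lambda>x. - bil (Kv (Phi x)) (F x))"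
  unfolding am_def[abs_def] bp_def[abs_def] kl_def[abs_def] kr_def[abs_def]
  by (intro primitive_indefinite_atMost primitive_indefinite_atLeast measurable_m measurable_p measurable_Kv_Phi
      integrable_m integrable_p integrable_Kv_Phi; simp)+

lemma cong_ops:
  assumes "L2 F" "L2 G" "aeeq F G"
  shows "am F = am G" "bp F = bp G" "kl F = kl G" "kr F = kr G"
  unfolding am_def[abs_def] bp_def[abs_def] kl_def[abs_def] kr_def[abs_def]
  by (intro ext set_integral_bil_cong[OF assms] borel_measurable_Kv continuous_vfun_measurable cont_m cont_p cont_Phi; simp)+

lemma vlin_ops:
  assumes "L2 F" "L2 G"
  shows "am (vlin a F b G) x = a * am F x + b * am G x" "bp (vlin a F b G) x = a * bp F x + b * bp G x"
    "kl (vlin a F b G) x = a * kl F x + b * kl G x" "kr (vlin a F b G) x = a * kr F x + b * kr G x"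
  unfolding am_def bp_def kl_def kr_def
  by (intro set_integral_bil_vlin integrable_m integrable_p integrable_Kv_Phi assms; simp)+

lemma bounded_linear_Top: "bounded_linear_L2 A (Tz)"
proof -
  obtain C e where Ce: "C \<ge> 0" "e > 0"
    "\<And>x y. y \<le> x \<Longrightarrow> norm (Phi x) * norm (Pm y) \<le> C * expk e x y"
    "\<And>x y. x \<le> y \<Longrightarrow> norm (Phi x) * norm (Pp y) \<le> C * expk e x y"
    using kernel_bounds by metis
  show ?thesis
  \<comment> \<open>The 4 is the prefactor 2 of T times the two half-line integrals.\<close>
  proof (rule bounded_linear_L2_identity_plus[where R = "\<lambda>F x. smul (2 * (am F x - bp F x)) (Phi x)" and C = "4 * C", OF Ce(2)])
    show "Tz F = (\<lambda>x. F x + smul (2 * (am F x - bp F x)) (Phi x))" for F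
      by (rule ext) (rule Top_eq)
  next
    fix F G assume "L2 F" "L2 G" "aeeq F G"
    then show "(\<lambda>x. smul (2 * (am F x - bp F x)) (Phi x)) = (\<lambda>x. smul (2 * (am G x - bp G x)) (Phi x))"
      by (simp add: cong_ops)
  next
    fix F G a b assume "L2 F" "L2 G"
    then show "(\<lambda>x. smul (2 * (am (vlin a F b G) x - bp (vlin a F b G) x)) (Phi x)) =
      vlin a (\<lambda>x. smul (2 * (am F x - bp F x)) (Phi x)) b (\<lambda>x. smul (2 * (am G x - bp G x)) (Phi x))"
      by (simp add: vlin_ops) (simp add: vlin_def smul_def algebra_simps)
  next
    fix F assume F: "L2 F"
    show "(\<lambda>x. smul (2 * (am F x - bp F x)) (Phi x)) \<in> borel_measurable borel"
      by (intro borel_measurable_smul borel_measurable_continuous_onI continuous_intros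
          primitive_continuous[OF primitive_am[OF F]] primitive_continuous[OF primitive_bp[OF F]] cont_Phi)
    fix x
    let ?E = "LINT y|lborel. expk e x y * norm (F y)"
    have "norm (Phi x) * norm (am F x) \<le> C * ?E" "norm (Phi x) * norm (bp F x) \<le> C * ?E"
      unfolding am_def bp_def
      by (intro kernel_integral_bound[OF Ce(2) F _ Ce(1)]; use Ce(3,4) in simp)+
    moreover have "norm (smul (2 * (am F x - bp F x)) (Phi x)) \<le> 2 * (norm (am F x) + norm (bp F x)) * norm (Phi x)"
      unfolding norm_smul norm_mult
      by (intro mult_right_mono mult_mono norm_triangle_ineq4) auto
    ultimately show "norm (smul (2 * (am F x - bp F x)) (Phi x)) \<le> 4 * C * ?E"
      by (simp add: algebra_simps)
  qed (use Ce(1) in simp)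
qed

lemma bounded_linear_Shat: "bounded_linear_L2 A (Sz)"
proof -
  obtain C e where Ce: "C \<ge> 0" "e > 0"
    "\<And>x y. y \<le> x \<Longrightarrow> norm (Pp x) * norm (Phi y) \<le> C * expk e x y"
    "\<And>x y. x \<le> y \<Longrightarrow> norm (Pm x) * norm (Phi y) \<le> C * expk e x y"
    using kernel_bounds by metis
  let ?R = "\<lambda>F x. smul (2 * kl F x) (Kv (Pp x)) - smul (2 * kr F x) (Kv (Pm x))"
  show ?thesis
  proof (rule bounded_linear_L2_identity_plus[where R = ?R and C = "4 * C", OF Ce(2)])
    show "Sz F = (\<lambda>x. F x + ?R F x)" for F
      by (rule ext) (rule Shat_eq)
  next
    fix F G assume "L2 F" "L2 G" "aeeq F G"
    then show "?R F = ?R G" by (simp add: cong_ops)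
  next
    fix F G a b assume "L2 F" "L2 G"
    then show "?R (vlin a F b G) = vlin a (?R F) b (?R G)"
      by (simp add: vlin_ops) (simp add: vlin_def smul_def algebra_simps)
  next
    fix F assume F: "L2 F"
    show "?R F \<in> borel_measurable borel"
      by (intro borel_measurable_diff borel_measurable_smul borel_measurable_Kv borel_measurable_continuous_onI continuous_intros
          primitive_continuous[OF primitive_kl[OF F]] primitive_continuous[OF primitive_kr[OF F]] cont_m cont_p)
    fix x
    let ?E = "LINT y|lborel. expk e x y * norm (F y)"
    have "norm (Pp x) * norm (kl F x) \<le> C * ?E" "norm (Pm x) * norm (kr F x) \<le> C * ?E"
      unfolding kl_def kr_def
      by (intro kernel_integral_bound[OF Ce(2) F _ Ce(1)]; use Ce(3,4) in simp)+
    moreover have "norm (?R F x) \<le> 2 * (norm (Pp x) * norm (kl F x)) + 2 * (norm (Pm x) * norm (kr F x))"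
      by (rule order_trans[OF norm_triangle_ineq4]) (simp add: norm_mult)
    ultimately show "norm (?R F x) \<le> 4 * C * ?E"
      by linarith
  qed (use Ce(1) in simp)
qed

end

section \<open>Kernels, ranges and inverses\<close>

lemma primitive_unique:
  assumes F: "primitive F f" and G: "primitive G f"
  shows "\<exists>c. \<forall>x. F x = G x + c"
proof (intro exI allI)
  fix x
  show "F x = G x + (F 0 - G 0)"
    using primitive_diff_eq[OF F, of 0 x] primitive_diff_eq[OF F, of x 0]
      primitive_diff_eq[OF G, of 0 x] primitive_diff_eq[OF G, of x 0]
    by (cases "0 \<le> x") (auto simp: algebra_simps)
qed

context weyl_pair
begin

section \<open>Left inverse: antiderivatives along T\<close>

definition N' :: "real \<Rightarrow> real" where
  "N' x = 2 * Im z * ((norm (fst (Ps x)))\<^sup>2 - (norm (snd (Ps x)))\<^sup>2)"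

lemma N_deriv: "(N has_real_derivative N' x) (at x)"
  unfolding N_def[abs_def] N'_def by (rule wave_norm_deriv[OF wave_s])

lemma cont_N': "continuous_on UNIV N'"
  unfolding N'_def[abs_def] by (intro continuous_intros cont_s)

lemma ac_deriv_N: "ac_deriv (\<lambda>x. of_real (N x)) (\<lambda>x. of_real (N' x))"
  by (intro ac_deriv_C1 continuous_intros cont_N' has_vector_derivative_of_real)
    (use N_deriv in \<open>simp add: has_real_derivative_iff_has_vector_derivative\<close>)

lemma ac_deriv_inverse_N: "ac_deriv (\<lambda>x. of_real (1 / N x)) (\<lambda>x. of_real (- N' x / (N x)\<^sup>2))"
proof (intro ac_deriv_C1 has_vector_derivative_of_real)
  fix x
  show "((\<lambda>x. 1 / N x) has_real_derivative - N' x / (N x)\<^sup>2) (at x)"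
    by (auto intro!: derivative_eq_intros N_deriv simp: N_nonzero power2_eq_square)
next
  show "continuous_on UNIV (\<lambda>x. complex_of_real (- N' x / (N x)\<^sup>2))"
    by (intro continuous_intros cont_N cont_N') (simp add: N_nonzero)
qed

lemma N_eq: "of_real (N x) = fst (Ps x) * cnj (fst (Ps x)) + snd (Ps x) * cnj (snd (Ps x))"
  using hp_self[of "Ps x"] by (simp add: N_def hp_def)

lemma N'_eq: "of_real (N' x) = 2 * of_real (Im z) * (fst (Ps x) * cnj (fst (Ps x)) - snd (Ps x) * cnj (snd (Ps x)))"
  unfolding N'_def complex_norm_square[symmetric] by simp

text \<open>Both sides are multiples of |psi_1|^2 - |psi_2|^2. Through this identity the sigma_1
  pairing recognises the derivative of \<open>N\<close>, which drives the quotient and product rules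
  in both compositions of T and S.\<close>

lemma bil_s_Kv_s: "2 * of_real (Im z) * bil (Ps x) (Kv (Ps x)) = - of_real (N' x)"
  unfolding N'_eq by (simp add: bil_def Kv_def algebra_simps)

lemma bil_s_Phi: "2 * bil (Ps x) (Phi x) = - of_real (N' x / N x)"
proof -
  have "2 * bil (Ps x) (Phi x) = (2 * of_real (Im z) * bil (Ps x) (Kv (Ps x))) / of_real (N x)"
    by (simp add: Phi_eq bil_smul_right)
  then show ?thesis by (simp add: bil_s_Kv_s)
qed

lemma bil_Kv_Phi: "bil (Kv (Phi x)) v = - of_real (Im z / N x) * bil (Ps x) v"
  unfolding Kv_Phi_eq bil_smul_left ..

definition h :: "vfun \<Rightarrow> real \<Rightarrow> complex" where "h F x = am F x - bp F x"

lemma primitive_h: "L2 F \<Longrightarrow> primitive (h F) (\<lambda>x. bil (Ps x) (F x))"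
  using primitive_diff[OF primitive_am primitive_bp, of F F]
  by (simp add: h_def[abs_def] Ps_eq bil_add_left)

lemma Top_h: "Tz F x = F x + smul (2 * h F x) (Phi x)"
  by (simp add: Top_eq h_def)

lemma L2_Top: "L2 F \<Longrightarrow> L2 (Tz F)"
  and L2_Shat: "L2 F \<Longrightarrow> L2 (Sz F)"
  using bounded_linear_Top[of "\<lambda>_. True"] bounded_linear_Shat[of "\<lambda>_. True"] by (auto simp: bounded_linear_L2_def)

text \<open>Kernel decay with the other argument frozen at 0, where the remaining factor is
  nonzero.\<close>

lemma Pp_tendsto_0: "((\<lambda>x. norm (Pp x)) \<longlongrightarrow> 0) at_top"
  and Pm_tendsto_0: "((\<lambda>x. norm (Pm x)) \<longlongrightarrow> 0) at_bot"
proof -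
  obtain C e where "C \<ge> 0" "e > 0"
    and Ce: "\<And>x y. y \<le> x \<Longrightarrow> norm (Pp x) * norm (Pm y) \<le> C * exp (- (e * (x - y)))"
    using kernel_decay by metis
  have "filterlim (\<lambda>x. - (e * x)) at_bot at_top"
    by (intro filterlim_uminus_at_bot_at_top[THEN filterlim_compose] filterlim_tendsto_pos_mult_at_top[OF tendsto_const \<open>e > 0\<close>] filterlim_ident)
  from filterlim_compose[OF exp_at_bot this] have t: "((\<lambda>x. exp (- (e * x))) \<longlongrightarrow> 0) at_top" .
  have "filterlim (\<lambda>x. e * x) at_bot at_bot"
    by (intro filterlim_tendsto_pos_mult_at_bot[OF tendsto_const \<open>e > 0\<close>] filterlim_ident)
  from filterlim_compose[OF exp_at_bot this] have b: "((\<lambda>x. exp (e * x)) \<longlongrightarrow> 0) at_bot" .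
  show "((\<lambda>x. norm (Pp x)) \<longlongrightarrow> 0) at_top"
  proof (rule Lim_null_comparison[rotated])
    show "((\<lambda>x. C / norm (Pm 0) * exp (- (e * x))) \<longlongrightarrow> 0) at_top"
      using tendsto_mult_left[OF t, of "C / norm (Pm 0)"] by simp
    show "\<forall>\<^sub>F x in at_top. norm (norm (Pp x)) \<le> C / norm (Pm 0) * exp (- (e * x))"
      using eventually_ge_at_top[of 0]
    proof eventually_elim
      fix x :: real assume "0 \<le> x"
      then show "norm (norm (Pp x)) \<le> C / norm (Pm 0) * exp (- (e * x))"
        using Ce[of 0 x] Pm_nonzero[of 0] by (simp add: pos_le_divide_eq)
    qed
  qed
  show "((\<lambda>x. norm (Pm x)) \<longlongrightarrow> 0) at_bot"
  proof (rule Lim_null_comparison[rotated])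
    show "((\<lambda>x. C / norm (Pp 0) * exp (e * x)) \<longlongrightarrow> 0) at_bot"
      using tendsto_mult_left[OF b, of "C / norm (Pp 0)"] by simp
    show "\<forall>\<^sub>F x in at_bot. norm (norm (Pm x)) \<le> C / norm (Pp 0) * exp (e * x)"
      using eventually_le_at_bot[of 0]
    proof eventually_elim
      fix x :: real assume "x \<le> 0"
      then show "norm (norm (Pm x)) \<le> C / norm (Pp 0) * exp (e * x)"
        using Ce[of x 0] Pp_nonzero[of 0] by (simp add: pos_le_divide_eq mult.commute)
    qed
  qed
qed

text \<open>The decaying Weyl solution at each end bounds 1 / |Psi| through the constant
  determinant, so |Psi| blows up at both ends.\<close>

lemma inverse_norm_Ps_tendsto_0: "((\<lambda>x. 1 / norm (Ps x)) \<longlongrightarrow> 0) at_top" "((\<lambda>x. 1 / norm (Ps x)) \<longlongrightarrow> 0) at_bot"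
proof -
  show "((\<lambda>x. 1 / norm (Ps x)) \<longlongrightarrow> 0) at_top"
    by (rule Lim_null_comparison[OF always_eventually tendsto_divide_zero[OF Pp_tendsto_0, of "norm W"]])
      (simp add: inverse_norm_Ps_le)
  show "((\<lambda>x. 1 / norm (Ps x)) \<longlongrightarrow> 0) at_bot"
    by (rule Lim_null_comparison[OF always_eventually tendsto_divide_zero[OF Pm_tendsto_0, of "norm W"]])
      (simp add: inverse_norm_Ps_le)
qed

lemma tendsto_0_if_bounded_div_norm_Ps:
  assumes "\<And>x. norm (f x :: complex) \<le> B / norm (Ps x)"
  shows "(f \<longlongrightarrow> 0) at_top" "(f \<longlongrightarrow> 0) at_bot"
proof -
  have B: "((\<lambda>x. B / norm (Ps x)) \<longlongrightarrow> 0) at_top" "((\<lambda>x. B / norm (Ps x)) \<longlongrightarrow> 0) at_bot"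
    using tendsto_mult_left[OF inverse_norm_Ps_tendsto_0(1), of B] tendsto_mult_left[OF inverse_norm_Ps_tendsto_0(2), of B] by simp_all
  show "(f \<longlongrightarrow> 0) at_top"
    by (rule Lim_null_comparison[OF always_eventually B(1)]) (use assms in blast)
  show "(f \<longlongrightarrow> 0) at_bot"
    by (rule Lim_null_comparison[OF always_eventually B(2)]) (use assms in blast)
qed

text \<open>The integrals in T need not be bounded by themselves. These products are, and a further
  factor 1 / |Psi| then makes the boundary terms vanish.\<close>

lemma product_bounds:
  assumes F: "L2 F"
  obtains B where "B \<ge> 0" "\<And>x. norm (Pp x) * norm (am F x) \<le> B" "\<And>x. norm (Pm x) * norm (bp F x) \<le> B"
    "\<And>x. norm (Phi x) * norm (h F x) \<le> B"
proof -
  obtain C e where Ce: "C \<ge> 0" "e > 0"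
    "\<And>x y. y \<le> x \<Longrightarrow> norm (Pp x) * norm (Pm y) \<le> C * expk e x y"
    "\<And>x y. x \<le> y \<Longrightarrow> norm (Pm x) * norm (Pp y) \<le> C * expk e x y"
    "\<And>x y. y \<le> x \<Longrightarrow> norm (Phi x) * norm (Pm y) \<le> C * expk e x y"
    "\<And>x y. x \<le> y \<Longrightarrow> norm (Phi x) * norm (Pp y) \<le> C * expk e x y"
    using kernel_bounds by metis
  define E where "E x = (LINT y|lborel. expk e x y * norm (F y))" for x
  define D where "D = C * (2 / e + (LINT y|lborel. (norm (F y))\<^sup>2))"
  have ED: "C * E x \<le> D" for x
    unfolding D_def E_def by (intro mult_left_mono exp_kernel_integrable(2)[OF Ce(2) F] Ce(1))
  have "0 \<le> D" unfolding D_def using Ce by (intro mult_nonneg_nonneg add_nonneg_nonneg) auto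
  have b: "norm (Pp x) * norm (am F x) \<le> C * E x" "norm (Pm x) * norm (bp F x) \<le> C * E x"
    "norm (Phi x) * norm (am F x) \<le> C * E x" "norm (Phi x) * norm (bp F x) \<le> C * E x" for x
    unfolding am_def bp_def E_def
    by (intro kernel_integral_bound[OF Ce(2) F _ Ce(1)]; use Ce(3-) in simp)+
  show ?thesis
  proof (rule that[of "2 * D"])
    show "2 * D \<ge> 0" using \<open>0 \<le> D\<close> by simp
    show "norm (Pp x) * norm (am F x) \<le> 2 * D" "norm (Pm x) * norm (bp F x) \<le> 2 * D" for x
      using b(1,2)[of x] ED[of x] \<open>0 \<le> D\<close> by linarith+
    fix x
    have "norm (Phi x) * norm (h F x) \<le> norm (Phi x) * (norm (am F x) + norm (bp F x))"
      unfolding h_def by (intro mult_left_mono norm_triangle_ineq4) simp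
    then show "norm (Phi x) * norm (h F x) \<le> 2 * D"
      using b(3,4)[of x] ED[of x] by (simp add: distrib_left)
  qed
qed

definition kap :: "vfun \<Rightarrow> real \<Rightarrow> complex" where "kap F x = - of_real (Im z) * (h F x * of_real (1 / N x))"

text \<open>In norm, \<open>kap\<close> is the bounded product |Phi| |h| divided once more by
  |Psi|.\<close>

lemma kap_tendsto_0: "L2 F \<Longrightarrow> (kap F \<longlongrightarrow> 0) at_top" "L2 F \<Longrightarrow> (kap F \<longlongrightarrow> 0) at_bot"
proof -
  assume F: "L2 F"
  obtain B where B: "\<And>x. norm (Phi x) * norm (h F x) \<le> B" using product_bounds[OF F] by metis
  have "norm (kap F x) \<le> B / norm (Ps x)" for x
  proof -
    have "norm (kap F x) = (norm (Phi x) * norm (h F x)) / norm (Ps x)"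
      using N_pos[of x] unfolding norm_Phi
      by (simp add: kap_def norm_mult norm_divide N_def power2_eq_square)
    also have "\<dots> \<le> B / norm (Ps x)" by (intro divide_right_mono B) simp
    finally show ?thesis .
  qed
  from tendsto_0_if_bounded_div_norm_Ps[OF this]
  show "(kap F \<longlongrightarrow> 0) at_top" "(kap F \<longlongrightarrow> 0) at_bot" by this
qed

lemma primitive_kap:
  assumes F: "L2 F"
  shows "primitive (kap F) (\<lambda>x. bil (Kv (Phi x)) (Tz F x))"
proof (rule primitive_cong[OF primitive_cmult[OF primitive_mult[OF primitive_h[OF F] ac_deriv_primitive[OF ac_deriv_inverse_N]], of "- of_real (Im z)"]])
  fix x
  have "bil (Kv (Phi x)) (Tz F x) = - of_real (Im z / N x) * (bil (Ps x) (F x) + h F x * (2 * bil (Ps x) (Phi x)))"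
    unfolding bil_Kv_Phi Top_h bil_add_right bil_smul_right by (simp only: distrib_left mult_ac)
  also have "\<dots> = - of_real (Im z) * (bil (Ps x) (F x) * of_real (1 / N x) + h F x * of_real (- N' x / (N x)\<^sup>2))"
    unfolding bil_s_Phi using N_nonzero[of x] by (simp add: power2_eq_square field_simps)
  finally show "- of_real (Im z) * (bil (Ps x) (F x) * of_real (1 / N x) + h F x * of_real (- N' x / (N x)\<^sup>2)) =
     bil (Kv (Phi x)) (Tz F x)" ..
qed (simp add: kap_def)

lemma kl_Top: "L2 F \<Longrightarrow> kl (Tz F) x = kap F x"
  and kr_Top: "L2 F \<Longrightarrow> kr (Tz F) x = - kap F x"
  and Jorth_Top_Kv: "L2 F \<Longrightarrow> Jorth (Tz F) (Kop Phi)"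
proof -
  assume F: "L2 F"
  note p = primitive_kap[OF F]
  show "kl (Tz F) x = kap F x"
    unfolding kl_def using primitive_integral_atMost[OF p integrable_Kv_Phi[OF L2_Top[OF F]] kap_tendsto_0(2)[OF F]] by simp
  show "kr (Tz F) x = - kap F x"
    unfolding kr_def using primitive_integral_atLeast[OF p integrable_Kv_Phi[OF L2_Top[OF F]] kap_tendsto_0(1)[OF F]] by simp
  show "Jorth (Tz F) (Kop Phi)"
    unfolding Jorth_def Jprod_def Kop_def
    using primitive_integral_UNIV[OF p L2_bil_integrable[OF L2_Kv_Phi L2_Top[OF F]] kap_tendsto_0(2)[OF F] kap_tendsto_0(1)[OF F]] by simp
qed

text \<open>Because \<open>kl\<close> and \<open>kr\<close> of T F are \<open>kap\<close> and its
  negative, the two K Psi terms of S merge into 2 \<open>kap\<close> K Psi, which equals - 2 h Phi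
  and cancels the correction in T. The equality holds at every point.\<close>

lemma Shat_Top: 
  assumes F: "L2 F"
  shows "Sz (Tz F) = F"
proof
  fix x
  show "Sz (Tz F) x = F x"
    unfolding Shat_eq kl_Top[OF F] kr_Top[OF F] Top_h Phi_eq
    by (simp add: kap_def smul_def Ps_eq Kv_add prod_eq_iff algebra_simps)
      (simp add: Kv_def algebra_simps diff_divide_distrib add_divide_distrib)
qed

section \<open>Orthogonality of the range of T to Phi\<close>

definition rm :: "real \<Rightarrow> complex" where "rm x = hp (Pm x) (Ps x) * of_real (1 / N x)"
definition rp :: "real \<Rightarrow> complex" where "rp x = hp (Pp x) (Ps x) * of_real (1 / N x)"

lemma rm_plus_rp: "rm x + rp x = 1"
proof -
  have "hp (Pm x) (Ps x) + hp (Pp x) (Ps x) = of_real (N x)"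
    unfolding N_eq by (simp add: hp_def Ps_eq algebra_simps)
  then show ?thesis using N_nonzero[of x] by (simp add: rm_def rp_def add_divide_distrib[symmetric])
qed

lemma norm_rm_le: "norm (rm x) \<le> norm (Pm x) / norm (Ps x)"
  and norm_rp_le: "norm (rp x) \<le> norm (Pp x) / norm (Ps x)"
proof -
  have "norm (hp v (Ps x)) / N x \<le> norm v / norm (Ps x)" for v
    using norm_hp_le[of v "Ps x"] Ps_nonzero[of x] by (simp add: N_def power2_eq_square field_simps)
  then show "norm (rm x) \<le> norm (Pm x) / norm (Ps x)" "norm (rp x) \<le> norm (Pp x) / norm (Ps x)"
    using N_pos[of x] by (simp_all add: rm_def rp_def norm_mult norm_divide)
qed

text \<open>\<open>rm\<close> and \<open>rp\<close> are the coefficients of the Hermitian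
  projections of the Weyl solutions onto Psi and sum to 1. The limit on the left is that of 1 -
  \<open>rm\<close>.\<close>

lemma rp_tendsto: "(rp \<longlongrightarrow> 0) at_top" "(rp \<longlongrightarrow> 1) at_bot"
proof -
  have Pp: "((\<lambda>x. norm (Pp x) / norm (Ps x)) \<longlongrightarrow> 0) at_top"
    using tendsto_mult[OF Pp_tendsto_0 inverse_norm_Ps_tendsto_0(1)] by simp
  show "(rp \<longlongrightarrow> 0) at_top"
    by (rule Lim_null_comparison[OF always_eventually Pp]) (use norm_rp_le in blast)
  have Pm: "((\<lambda>x. norm (Pm x) / norm (Ps x)) \<longlongrightarrow> 0) at_bot"
    using tendsto_mult[OF Pm_tendsto_0 inverse_norm_Ps_tendsto_0(2)] by simp
  have "(rm \<longlongrightarrow> 0) at_bot"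
    by (rule Lim_null_comparison[OF always_eventually Pm]) (use norm_rm_le in blast)
  then have "((\<lambda>x. 1 - rm x) \<longlongrightarrow> 1 - 0) at_bot" by (intro tendsto_intros)
  moreover have "(\<lambda>x. 1 - rm x) = rp" using rm_plus_rp by (auto simp: algebra_simps)
  ultimately show "(rp \<longlongrightarrow> 1) at_bot" by simp
qed

text \<open>The derivative of \<open>rm\<close>, the negative of that of \<open>rp\<close>, and up
  to a constant the integrand in the J-product of Phi with itself.\<close>

definition om :: "real \<Rightarrow> complex" where
  "om x = 4 * of_real (Im z) * W * (cnj (fst (Ps x)) * cnj (snd (Ps x)) / (of_real (N x))\<^sup>2)"

text \<open>In the quotient rule the numerator collapses to a multiple of det (P, Psi), which is
  constant for solutions of the same system.\<close>

lemma primitive_hp_div_N: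
  assumes P: "wave_system q z P"
  shows "primitive (\<lambda>x. hp (P x) (Ps x) * of_real (1 / N x))
    (\<lambda>x. 4 * of_real (Im z) * dt (P x) (Ps x) * (cnj (fst (Ps x)) * cnj (snd (Ps x)) / (of_real (N x))\<^sup>2))"
proof (rule primitive_cong[OF primitive_mult[OF ac_deriv_primitive[OF ac_deriv_hp[OF P wave_s]] ac_deriv_primitive[OF ac_deriv_inverse_N]] refl])
  fix x
  let ?d = "of_real (2 * Im z) * (fst (P x) * cnj (fst (Ps x)) - snd (P x) * cnj (snd (Ps x))) :: complex"
  let ?n = "complex_of_real (N x)"
  have "?d * of_real (1 / N x) + hp (P x) (Ps x) * of_real (- N' x / (N x)\<^sup>2)
     = (?d * ?n - hp (P x) (Ps x) * of_real (N' x)) / ?n\<^sup>2"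
    using N_nonzero[of x] by (simp add: power2_eq_square field_simps)
  also have "?d * ?n - hp (P x) (Ps x) * of_real (N' x)
     = 4 * of_real (Im z) * dt (P x) (Ps x) * (cnj (fst (Ps x)) * cnj (snd (Ps x)))"
    unfolding N_eq N'_eq hp_def dt_def by (simp add: algebra_simps)
  finally show "?d * of_real (1 / N x) + hp (P x) (Ps x) * of_real (- N' x / (N x)\<^sup>2)
     = 4 * of_real (Im z) * dt (P x) (Ps x) * (cnj (fst (Ps x)) * cnj (snd (Ps x)) / ?n\<^sup>2)" by simp
qed

lemma primitive_rm: "primitive rm om" and primitive_rp: "primitive rp (\<lambda>x. - om x)"
  using primitive_hp_div_N[OF wave_m] primitive_hp_div_N[OF wave_p]
  by (simp_all add: rm_def[abs_def] rp_def[abs_def] om_def[abs_def] dt_m_s dt_p_s)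

lemma bil_Phi_Phi: "2 * W * bil (Phi x) (Phi x) = - of_real (Im z) * om x"
  by (simp add: Phi_eq bil_def smul_def Kv_def om_def power2_eq_square)

text \<open>A multiple of \<open>rp\<close> is an antiderivative of the integrand, and
  \<open>rp\<close> falls from 1 to 0 along the line.\<close>

lemma Jprod_Phi_Phi: "2 * W * Jprod Phi Phi = - of_real (Im z)"
proof -
  have pr: "primitive (\<lambda>x. of_real (Im z) / (2 * W) * rp x) (\<lambda>x. bil (Phi x) (Phi x))"
  proof (rule primitive_cong[OF primitive_cmult[OF primitive_rp, of "of_real (Im z) / (2 * W)"] refl])
    fix x
    have "2 * W * bil (Phi x) (Phi x) = 2 * W * (of_real (Im z) / (2 * W) * - om x)"
      unfolding bil_Phi_Phi using W_nonzero by simp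
    then show "of_real (Im z) / (2 * W) * - om x = bil (Phi x) (Phi x)" using W_nonzero by (simp only: mult_cancel_left) simp
  qed
  have "Jprod Phi Phi = of_real (Im z) / (2 * W) * 0 - of_real (Im z) / (2 * W) * 1"
    unfolding Jprod_def by (rule primitive_integral_UNIV[OF pr L2_bil_integrable[OF L2_Phi L2_Phi]])
      (intro tendsto_mult tendsto_const rp_tendsto)+
  then show ?thesis using W_nonzero by simp
qed

lemma Jorth_Top_Phi: 
  assumes F: "L2 F"
  shows "Jorth (Tz F) Phi"
proof -
  \<comment> \<open>The crosswise pairing is essential at infinity: \<open>rp\<close> supplies the
    factor |Psi_+| that keeps \<open>am\<close> bounded, and \<open>rm\<close> the factor |Psi_-|
    for \<open>bp\<close>.\<close>
  define g where "g x = of_real (Im z) / W * (rp x * am F x + rm x * bp F x)" for x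
  have pr: "primitive g (\<lambda>x. bil (Phi x) (Tz F x))"
    unfolding g_def[abs_def]
  proof (rule primitive_cong[OF primitive_cmult[OF primitive_add[OF primitive_mult[OF primitive_rp primitive_am[OF F]]
          primitive_mult[OF primitive_rm primitive_bp[OF F]]], of "of_real (Im z) / W"] refl])
    fix x
    have W: "fst (Pm x) * snd (Pp x) - snd (Pm x) * fst (Pp x) = W" using dt_m_p[of x] by (simp add: dt_def)
    \<comment> \<open>Cramer's rule: the expansion of \<open>W\<close> K Psi in the basis Psi_-,
      Psi_+, paired with \<open>F\<close>.\<close>
    have 1: "hp (Pp x) (Ps x) * bil (Pm x) (F x) - hp (Pm x) (Ps x) * bil (Pp x) (F x) = W * bil (Kv (Ps x)) (F x)"
      unfolding W[symmetric] by (simp add: hp_def bil_def Kv_def algebra_simps)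
    have "W * bil (Phi x) (Tz F x) = of_real (Im z / N x) * (W * bil (Kv (Ps x)) (F x)) + h F x * (2 * W * bil (Phi x) (Phi x))"
      unfolding Top_h bil_add_right bil_smul_right
      by (simp add: Phi_eq bil_smul_left algebra_simps)
    also have "\<dots> = of_real (Im z) * (- om x * am F x + rp x * bil (Pm x) (F x) + (om x * bp F x + rm x * - bil (Pp x) (F x)))"
      unfolding 1[symmetric] bil_Phi_Phi rp_def rm_def h_def by (simp add: algebra_simps diff_divide_distrib)
    finally show "of_real (Im z) / W * (- om x * am F x + rp x * bil (Pm x) (F x) + (om x * bp F x + rm x * - bil (Pp x) (F x)))
       = bil (Phi x) (Tz F x)"
      using W_nonzero by (simp add: field_simps)
  qed
  obtain B where B: "\<And>x. norm (Pp x) * norm (am F x) \<le> B" "\<And>x. norm (Pm x) * norm (bp F x) \<le> B"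
    using product_bounds[OF F] by metis
  have "norm (g x) \<le> (\<bar>Im z\<bar> / norm W * (2 * B)) / norm (Ps x)" for x
  proof -
    have "norm (rp x * am F x + rm x * bp F x) \<le> norm (rp x) * norm (am F x) + norm (rm x) * norm (bp F x)"
      using norm_triangle_ineq[of "rp x * am F x" "rm x * bp F x"] by (simp add: norm_mult)
    also have "\<dots> \<le> norm (Pp x) / norm (Ps x) * norm (am F x) + norm (Pm x) / norm (Ps x) * norm (bp F x)"
      by (intro add_mono mult_right_mono norm_rp_le norm_rm_le) auto
    also have "\<dots> = (norm (Pp x) * norm (am F x) + norm (Pm x) * norm (bp F x)) / norm (Ps x)"
      by (simp add: add_divide_distrib)
    also have "\<dots> \<le> (2 * B) / norm (Ps x)"
      using B[of x] by (intro divide_right_mono) auto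
    finally have "\<bar>Im z\<bar> / norm W * norm (rp x * am F x + rm x * bp F x) \<le> \<bar>Im z\<bar> / norm W * ((2 * B) / norm (Ps x))"
      by (intro mult_left_mono) auto
    then show ?thesis by (simp add: g_def norm_mult norm_divide)
  qed
  note lim = tendsto_0_if_bounded_div_norm_Ps[OF this]
  show ?thesis
    unfolding Jorth_def Jprod_def
    using primitive_integral_UNIV[OF pr L2_bil_integrable[OF L2_Phi L2_Top[OF F]] lim(2,1)] by simp
qed

section \<open>S on the J-orthogonal complement of K Phi, and the right inverse\<close>

lemma kr_eq_if_Jorth:
  assumes G: "L2 G" and J: "Jorth G (Kop Phi)"
  shows "kr G x = - kl G x"
  using J integral_split_at[OF L2_bil_integrable[OF L2_Kv_Phi G], of x]
  by (simp add: Jorth_def Jprod_def Kop_def kl_def kr_def add_eq_0_iff)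

text \<open>J-orthogonality makes the half-line integrals opposite, so S acquires the one-term form
  of T, with K Psi as vector and \<open>kl\<close> as coefficient.\<close>

lemma Shat_if_Jorth:
  assumes G: "L2 G" and J: "Jorth G (Kop Phi)"
  shows "Sz G x = G x + smul (2 * kl G x) (Kv (Ps x))"
  unfolding Shat_eq kr_eq_if_Jorth[OF G J] Ps_eq Kv_add by (simp add: smul_def prod_eq_iff algebra_simps)

text \<open>Both \<open>h\<close> of S G and - (1 / Im z) \<open>kl\<close> N are antiderivatives of
  the same function. No boundary value compares them, so they agree only up to a constant, and this
  constant becomes the multiple of Phi.\<close>

lemma Top_Shat:
  assumes G: "L2 G" and J: "Jorth G (Kop Phi)"
  shows "\<exists>c. \<forall>x. Tz (Sz G) x = G x + smul c (Phi x)"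
proof -
  let ?F = "Sz G"
  let ?e = "complex_of_real (Im z)"
  have e0: "?e \<noteq> 0" using Im_z_nonzero by simp
  have "primitive (\<lambda>x. - (1 / ?e) * (kl G x * of_real (N x))) (\<lambda>x. bil (Ps x) (?F x))"
  proof (rule primitive_cong[OF primitive_cmult[OF primitive_mult[OF primitive_kl[OF G] ac_deriv_primitive[OF ac_deriv_N]], of "- (1 / ?e)"] refl])
    fix x
    have "bil (Ps x) (?F x) = bil (Ps x) (G x) + 2 * kl G x * bil (Ps x) (Kv (Ps x))"
      unfolding Shat_if_Jorth[OF G J] bil_add_right bil_smul_right ..
    then have "?e * bil (Ps x) (?F x) = ?e * bil (Ps x) (G x) + kl G x * (2 * ?e * bil (Ps x) (Kv (Ps x)))"
      by (simp add: algebra_simps)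
    also have "\<dots> = ?e * bil (Ps x) (G x) - kl G x * of_real (N' x)"
      unfolding bil_s_Kv_s by simp
    finally show "- (1 / ?e) * (bil (Kv (Phi x)) (G x) * of_real (N x) + kl G x * of_real (N' x)) = bil (Ps x) (?F x)"
      unfolding bil_Kv_Phi using e0 N_nonzero[of x] by (simp add: field_simps)
  qed
  from primitive_unique[OF primitive_h[OF L2_Shat[OF G]] this]
  obtain c where c: "\<And>x. h ?F x = - (1 / ?e) * (kl G x * of_real (N x)) + c" by blast
  have "Tz ?F x = G x + smul (2 * c) (Phi x)" for x
  proof -
    have "2 * h ?F x * of_real (Im z / N x) = - (2 * kl G x) + 2 * c * of_real (Im z / N x)"
      unfolding c using e0 N_nonzero[of x] by (simp add: field_simps)
    moreover have "smul (2 * h ?F x) (Phi x) = smul (2 * h ?F x * of_real (Im z / N x)) (Kv (Ps x))"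
      "smul (2 * c) (Phi x) = smul (2 * c * of_real (Im z / N x)) (Kv (Ps x))"
      unfolding Phi_eq by (simp_all add: smul_def)
    ultimately have "Tz ?F x = ?F x + smul (- (2 * kl G x) + 2 * c * of_real (Im z / N x)) (Kv (Ps x))"
      "smul (2 * c) (Phi x) = smul (2 * c * of_real (Im z / N x)) (Kv (Ps x))"
      unfolding Top_h by simp_all
    then show ?thesis
      unfolding Shat_if_Jorth[OF G J, of x] by (simp add: smul_def prod_eq_iff algebra_simps)
  qed
  then show ?thesis by blast
qed

lemma Top_Shat_eq:
  assumes G: "L2 G" and J: "Jorth G (Kop Phi)" and JP: "Jorth G Phi"
  shows "Tz (Sz G) = G"
proof -
  obtain c where c: "\<And>x. Tz (Sz G) x = G x + smul c (Phi x)"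
    using Top_Shat[OF G J] by blast
  have "0 = Jprod (Tz (Sz G)) Phi"
    using Jorth_Top_Phi[OF L2_Shat[OF G]] by (simp add: Jorth_def)
  also have "\<dots> = Jprod G Phi + c * Jprod Phi Phi"
    unfolding Jprod_def c bil_add_right bil_smul_right
    using L2_bil_integrable[OF L2_Phi G] L2_bil_integrable[OF L2_Phi L2_Phi] by simp
  finally have "c * Jprod Phi Phi = 0" using JP by (simp add: Jorth_def)
  moreover have "Jprod Phi Phi \<noteq> 0" using Jprod_Phi_Phi Im_z_nonzero by auto
  ultimately have "c = 0" by simp
  then show ?thesis using c by (auto simp: smul_def zero_prod_def[symmetric])
qed

text \<open>The integrand is a multiple of the derivative of 1/N, and 1/N vanishes at both ends. The
  value is exactly what makes S annihilate Phi.\<close>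

lemma kl_Phi: "kl Phi x = - of_real (Im z / 2 / N x)"
  and Jorth_Phi_Kv: "Jorth Phi (Kop Phi)"
proof -
  define g where "g x = complex_of_real (- (Im z / 2)) * of_real (1 / N x)" for x
  have pr: "primitive g (\<lambda>x. bil (Kv (Phi x)) (Phi x))"
    unfolding g_def[abs_def]
  proof (rule primitive_cong[OF primitive_cmult[OF ac_deriv_primitive[OF ac_deriv_inverse_N], of "complex_of_real (- (Im z / 2))"] refl])
    fix x
    have "bil (Kv (Phi x)) (Phi x) = - of_real (Im z / N x / 2) * (2 * bil (Ps x) (Phi x))"
      unfolding bil_Kv_Phi by simp
    then show "complex_of_real (- (Im z / 2)) * of_real (- N' x / (N x)\<^sup>2) = bil (Kv (Phi x)) (Phi x)"
      unfolding bil_s_Phi by (simp add: power2_eq_square)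
  qed
  have lim: "((\<lambda>x. 1 / N x) \<longlongrightarrow> 0) F" if "((\<lambda>x. 1 / norm (Ps x)) \<longlongrightarrow> 0) F" for F
    using tendsto_mult[OF that that] by (simp add: N_def power2_eq_square)
  have gl: "(g \<longlongrightarrow> 0) F" if "((\<lambda>x. 1 / norm (Ps x)) \<longlongrightarrow> 0) F" for F
    using tendsto_mult_left[OF tendsto_of_real[OF lim[OF that]], of "complex_of_real (- (Im z / 2))"]
    by (simp add: g_def[abs_def])
  note gl' = gl[OF inverse_norm_Ps_tendsto_0(1)] gl[OF inverse_norm_Ps_tendsto_0(2)]
  show "kl Phi x = - of_real (Im z / 2 / N x)"
    unfolding kl_def using primitive_integral_atMost[OF pr integrable_Kv_Phi[OF L2_Phi] gl'(2)] by (simp add: g_def)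
  show "Jorth Phi (Kop Phi)"
    unfolding Jorth_def Jprod_def Kop_def
    using primitive_integral_UNIV[OF pr L2_bil_integrable[OF L2_Kv_Phi L2_Phi] gl'(2,1)] by simp
qed

lemma Shat_Phi: "Sz Phi x = 0"
  unfolding Shat_if_Jorth[OF L2_Phi Jorth_Phi_Kv] kl_Phi Phi_eq by (simp add: smul_def prod_eq_iff)

end

section \<open>Intertwining\<close>

lemma aeeq_refl: "aeeq F F" and aeeq_sym: "aeeq F G \<Longrightarrow> aeeq G F"
  by (auto simp: aeeq_def elim!: AE_mp)

lemma aeeq_trans: "aeeq F G \<Longrightarrow> aeeq G H \<Longrightarrow> aeeq F H"
  unfolding aeeq_def by (elim AE_mp[where Q = "\<lambda>x. F x = H x"] AE_mp) (auto elim!: AE_mp)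

lemma Dgraph_aeeq:
  assumes D: "Dgraph q F G" and F: "aeeq F F'" "L2 F'" and G: "aeeq G G'" "L2 G'"
  shows "Dgraph q F' G'"
proof -
  obtain Ft d1 d2 where Ft: "AC_loc2 Ft" "aeeq F Ft" and
    ae: "AE x in lborel.
           ((\<lambda>t. fst (Ft t)) has_vector_derivative d1 x) (at x) \<and>
           ((\<lambda>t. snd (Ft t)) has_vector_derivative d2 x) (at x) \<and>
           G x = (\<i> * (d1 x - q x * snd (Ft x)), \<i> * (- cnj (q x) * fst (Ft x) - d2 x))"
    using D unfolding Dgraph_def by blast
  have "AE x in lborel.
           ((\<lambda>t. fst (Ft t)) has_vector_derivative d1 x) (at x) \<and>
           ((\<lambda>t. snd (Ft t)) has_vector_derivative d2 x) (at x) \<and>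
           G' x = (\<i> * (d1 x - q x * snd (Ft x)), \<i> * (- cnj (q x) * fst (Ft x) - d2 x))"
    using ae G(1)[unfolded aeeq_def] by eventually_elim simp
  moreover have "aeeq F' Ft" using aeeq_trans[OF aeeq_sym[OF F(1)] Ft(2)] .
  ultimately show ?thesis using Ft(1) F(2) G(2) unfolding Dgraph_def by blast
qed

lemma Dgraph_add_smul:
  assumes q: "L1loc q" and D: "Dgraph q F G" and D': "Dgraph q F' G'"
  shows "Dgraph q (\<lambda>x. F x + smul c (F' x)) (\<lambda>x. G x + smul c (G' x))"
proof -
  obtain Ft where L: "L2 F" "L2 G" "aeeq F Ft" and
     1: "dirac_fst q Ft G" and
     2: "dirac_snd q Ft G" using D unfolding Dgraph_iff[OF q] by blast
  obtain Ft' where L': "L2 F'" "L2 G'" "aeeq F' Ft'" and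
     11: "dirac_fst q Ft' G'" and
     22: "dirac_snd q Ft' G'" using D' unfolding Dgraph_iff[OF q] by blast
  show ?thesis
    unfolding Dgraph_iff[OF q]
  proof (intro conjI exI[of _ "\<lambda>x. Ft x + smul c (Ft' x)"] L2_add L2_smul L L')
    show "aeeq (\<lambda>x. F x + smul c (F' x)) (\<lambda>x. Ft x + smul c (Ft' x))"
      using L(3) L'(3) unfolding aeeq_def by eventually_elim simp
    show "ac_deriv (\<lambda>x. fst (Ft x + smul c (Ft' x))) (\<lambda>x. - \<i> * fst (G x + smul c (G' x)) + q x * snd (Ft x + smul c (Ft' x)))"
      by (rule ac_deriv_cong[OF ac_deriv_add[OF 1 ac_deriv_cmult[OF 11, of c]]]) (simp_all add: smul_def algebra_simps)
    show "ac_deriv (\<lambda>x. snd (Ft x + smul c (Ft' x))) (\<lambda>x. \<i> * snd (G x + smul c (G' x)) - cnj (q x) * fst (Ft x + smul c (Ft' x)))"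
      by (rule ac_deriv_cong[OF ac_deriv_add[OF 2 ac_deriv_cmult[OF 22, of c]]]) (simp_all add: smul_def algebra_simps)
  qed
qed

lemma Dgraph_wave:
  assumes q: "L1loc q" and P: "wave_system q z P" and L2: "L2 P"
  shows "Dgraph q P (\<lambda>x. smul z (P x))"
  unfolding Dgraph_iff[OF q]
proof (intro conjI exI[of _ P] L2 L2_smul aeeq_refl)
  show "ac_deriv (\<lambda>x. fst (P x)) (\<lambda>x. - \<i> * fst (smul z (P x)) + q x * snd (P x))"
    by (rule ac_deriv_cong[OF wave_system_fst[OF P]]) (simp_all add: smul_def)
  show "ac_deriv (\<lambda>x. snd (P x)) (\<lambda>x. \<i> * snd (smul z (P x)) - cnj (q x) * fst (P x))"
    by (rule ac_deriv_cong[OF wave_system_snd[OF P]]) (simp_all add: smul_def)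
qed

text \<open>T and S see \<open>F\<close> only inside integrals and in the additive term, so this
  representative may replace it; its continuity makes those integrals continuously
  differentiable.\<close>

lemma Dgraph_continuous_representative:
  assumes q: "L1loc q" and D: "Dgraph q F G"
  obtains Ft where "aeeq F Ft" "L2 F" "L2 G" "L2 Ft" "continuous_on UNIV Ft"
    "dirac_fst q Ft G"
    "dirac_snd q Ft G"
proof -
  obtain Ft where L: "L2 F" "L2 G" "aeeq F Ft" and
     1: "dirac_fst q Ft G" and
     2: "dirac_snd q Ft G" using D unfolding Dgraph_iff[OF q] by blast
  have c: "continuous_on UNIV Ft" by (rule ac_deriv_continuous_vfun[OF 1 2])
  show ?thesis
    by (rule that[OF L(3,1,2) L2_cong_AE[OF L(1) continuous_vfun_measurable[OF c] L(3)] c 1 2])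
qed

lemma primitive_dt_wave:
  assumes P: "wave_system q w P"
    and F: "dirac_fst q F G"
      "dirac_snd q F G"
  shows "primitive (\<lambda>x. dt (P x) (F x)) (\<lambda>x. \<i> * bil (P x) (G x) - \<i> * w * bil (P x) (F x))"
  by (rule primitive_cong[OF ac_deriv_primitive[OF ac_deriv_dt[OF wave_system_fst[OF P] wave_system_snd[OF P] F]] refl])
    (simp add: bil_def algebra_simps)

lemma set_integral_lagrange:
  assumes "set_integrable lborel S (\<lambda>y. bil (p y) (F y))" "set_integrable lborel S (\<lambda>y. bil (p y) (G y))"
  shows "set_integrable lborel S (\<lambda>x. \<i> * bil (p x) (G x) - \<i> * w * bil (p x) (F x))"
    "(LINT x:S|lborel. \<i> * bil (p x) (G x) - \<i> * w * bil (p x) (F x)) =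
       \<i> * (LINT y:S|lborel. bil (p y) (G y)) - \<i> * w * (LINT y:S|lborel. bil (p y) (F y))"
proof -
  have i: "set_integrable lborel S (\<lambda>x. \<i> * bil (p x) (G x))" "set_integrable lborel S (\<lambda>x. \<i> * w * bil (p x) (F x))"
    using assms by auto
  show "set_integrable lborel S (\<lambda>x. \<i> * bil (p x) (G x) - \<i> * w * bil (p x) (F x))"
    by (rule set_integral_diff(1)[OF i])
  show "(LINT x:S|lborel. \<i> * bil (p x) (G x) - \<i> * w * bil (p x) (F x)) =
       \<i> * (LINT y:S|lborel. bil (p y) (G y)) - \<i> * w * (LINT y:S|lborel. bil (p y) (F y))"
    using set_integral_diff(2)[OF i] by simp
qed

text \<open>The determinant is integrable on the half-line together with its derivative, so its
  boundary value at minus infinity is 0. This expresses the integral against M(q) F through the one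
  against \<open>F\<close> plus a local term at \<open>x\<close>.\<close>

lemma lagrange_atMost:
  assumes P: "wave_system q w P"
    and F: "dirac_fst q F G"
      "dirac_snd q F G"
    and L2: "L2 F" "L2 G" "L2_on {..x} P"
  shows "(LINT y:{..x}|lborel. bil (P y) (G y)) = w * (LINT y:{..x}|lborel. bil (P y) (F y)) - \<i> * dt (P x) (F x)"
    and "((\<lambda>x. dt (P x) (F x)) \<longlongrightarrow> 0) at_bot"
proof -
  note pr = primitive_dt_wave[OF P F]
  have i: "set_integrable lborel {..x} (\<lambda>y. bil (P y) (F y))" "set_integrable lborel {..x} (\<lambda>y. bil (P y) (G y))"
    "set_integrable lborel {..x} (\<lambda>y. dt (P y) (F y))"
    by (intro L2_on_bil_integrable L2_on_dt_integrable L2 L2_imp_L2_on; simp)+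
  note s = set_integral_lagrange[OF i(1,2), of w]
  show t: "((\<lambda>x. dt (P x) (F x)) \<longlongrightarrow> 0) at_bot"
    by (rule primitive_tendsto_0_at_bot[OF pr s(1) i(3)])
  have "\<i> * (LINT y:{..x}|lborel. bil (P y) (G y)) - \<i> * w * (LINT y:{..x}|lborel. bil (P y) (F y)) = dt (P x) (F x)"
    using primitive_integral_atMost[OF pr s(1) t] s(2) by simp
  then have "\<i> * (LINT y:{..x}|lborel. bil (P y) (G y)) = \<i> * (w * (LINT y:{..x}|lborel. bil (P y) (F y)) - \<i> * dt (P x) (F x))"
    by (simp add: algebra_simps)
  then show "(LINT y:{..x}|lborel. bil (P y) (G y)) = w * (LINT y:{..x}|lborel. bil (P y) (F y)) - \<i> * dt (P x) (F x)"
    by (simp only: mult_cancel_left) simp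
qed

lemma lagrange_atLeast:
  assumes P: "wave_system q w P"
    and F: "dirac_fst q F G"
      "dirac_snd q F G"
    and L2: "L2 F" "L2 G" "L2_on {x..} P"
  shows "(LINT y:{x..}|lborel. bil (P y) (G y)) = w * (LINT y:{x..}|lborel. bil (P y) (F y)) + \<i> * dt (P x) (F x)"
    and "((\<lambda>x. dt (P x) (F x)) \<longlongrightarrow> 0) at_top"
proof -
  note pr = primitive_dt_wave[OF P F]
  have i: "set_integrable lborel {x..} (\<lambda>y. bil (P y) (F y))" "set_integrable lborel {x..} (\<lambda>y. bil (P y) (G y))"
    "set_integrable lborel {x..} (\<lambda>y. dt (P y) (F y))"
    by (intro L2_on_bil_integrable L2_on_dt_integrable L2 L2_imp_L2_on; simp)+
  note s = set_integral_lagrange[OF i(1,2), of w]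
  show t: "((\<lambda>x. dt (P x) (F x)) \<longlongrightarrow> 0) at_top"
    by (rule primitive_tendsto_0_at_top[OF pr s(1) i(3)])
  have "\<i> * (LINT y:{x..}|lborel. bil (P y) (G y)) - \<i> * w * (LINT y:{x..}|lborel. bil (P y) (F y)) = - dt (P x) (F x)"
    using primitive_integral_atLeast[OF pr s(1) t] s(2) by simp
  then have "\<i> * (LINT y:{x..}|lborel. bil (P y) (G y)) = \<i> * (w * (LINT y:{x..}|lborel. bil (P y) (F y)) + \<i> * dt (P x) (F x))"
    by (simp add: algebra_simps)
  then show "(LINT y:{x..}|lborel. bil (P y) (G y)) = w * (LINT y:{x..}|lborel. bil (P y) (F y)) + \<i> * dt (P x) (F x)"
    by (simp only: mult_cancel_left) simp
qed

text \<open>The line is cut at 0: the local determinant terms of the two half-lines cancel, which is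
  the J-symmetry of the operator tested against an eigenfunction.\<close>

lemma Jprod_eigenfunction:
  assumes P: "wave_system q w P" and L2P: "L2 P"
    and F: "dirac_fst q F G"
      "dirac_snd q F G"
    and L2: "L2 F" "L2 G"
  shows "Jprod G P = w * Jprod F P"
proof -
  have "L2_on {..0} P" "L2_on {0..} P" using L2P by (auto intro: L2_imp_L2_on)
  then show ?thesis
    unfolding Jprod_def
      integral_split_at[OF L2_bil_integrable[OF L2P L2(1)], of 0] integral_split_at[OF L2_bil_integrable[OF L2P L2(2)], of 0]
    using lagrange_atMost(1)[OF P F L2, of 0] lagrange_atLeast(1)[OF P F L2, of 0] by (simp add: algebra_simps)
qed

lemma Jprod_cong:
  assumes "L2 F" "L2 G" "aeeq F G" "L2 P"
  shows "Jprod F P = Jprod G P"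
  using set_integral_bil_cong[OF assms(1-3), of P UNIV] assms(4)
  by (simp add: Jprod_def set_lebesgue_integral_def L2_def)

lemma Jprod_vlin:
  assumes "L2 F" "L2 G" "L2 P"
  shows "Jprod (vlin a F b G) P = a * Jprod F P + b * Jprod G P"
  using set_integral_bil_vlin[of UNIV P F G a b] assms
  by (simp add: Jprod_def set_lebesgue_integral_def set_integrable_def L2_bil_integrable)

context weyl_pair
begin

section \<open>The transformed potential\<close>

abbreviation qt :: "real \<Rightarrow> complex" where "qt \<equiv> q1 q z Pm Pp"

lemma qt_eq: "qt x = q x + 4 * of_real (Im z) * fst (Ps x) * cnj (snd (Ps x)) / of_real (N x)"
  by (simp add: q1_def N_def)

lemma L1loc_qt: "L1loc qt"
  unfolding qt_eq[abs_def]
  by (intro L1loc_add[OF q] L1loc_continuous continuous_intros cont_s cont_N) (simp add: N_nonzero)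

text \<open>K Psi solves the system of \<open>q\<close> at conj z. Dividing by \<open>N\<close> adds
  a term with - N'/N: one part of it moves conj z back to z, the other is the change of
  potential.\<close>

lemma wave_Phi: "wave_system qt z Phi"
proof -
  let ?e = "complex_of_real (Im z)"
  let ?n = "\<lambda>x. complex_of_real (N x)"
  let ?a = "\<lambda>x. fst (Ps x)" and ?b = "\<lambda>x. snd (Ps x)"
  note K = wave_system_Kv[OF wave_s]
  have z: "\<i> * cnj z = \<i> * z + 2 * ?e" by (simp add: complex_eq_iff)
  have n0: "?n x \<noteq> 0" for x by (simp add: N_nonzero)
  \<comment> \<open>Two forms of N', eliminating |psi_2|^2 or |psi_1|^2. Each component takes the
    form whose \<open>N\<close> term cancels the shift 2 Im z and whose other term contains the
    potential correction.\<close>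
  have n1: "of_real (N' x) = 4 * ?e * (?a x * cnj (?a x)) - 2 * ?e * ?n x"
    and n2: "of_real (N' x) = 2 * ?e * ?n x - 4 * ?e * (?b x * cnj (?b x))" for x
    unfolding N'_eq N_eq by (simp_all add: algebra_simps)
  have inv: "complex_of_real (1 / N x) = 1 / ?n x" "complex_of_real (- N' x / (N x)\<^sup>2) = - of_real (N' x) / (?n x)\<^sup>2" for x
    by simp_all
  have "ac_deriv (\<lambda>x. fst (Phi x)) (\<lambda>x. - \<i> * z * fst (Phi x) + qt x * snd (Phi x))"
  proof (rule ac_deriv_cong[OF ac_deriv_cmult[OF ac_deriv_mult[OF ac_deriv_inverse_N wave_system_fst[OF K]], of ?e]])
    fix x
    show "?e * (of_real (1 / N x) * fst (Kv (Ps x))) = fst (Phi x)" by (simp add: Phi_eq smul_def)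
    have "?e * (- (4 * ?e * (?a x * cnj (?a x)) - 2 * ?e * ?n x) / (?n x)\<^sup>2 * cnj (?b x) + 1 / ?n x * (- (\<i> * z + 2 * ?e) * cnj (?b x) + q x * - cnj (?a x)))
      = - \<i> * z * (?e / ?n x * cnj (?b x)) + (q x + 4 * ?e * ?a x * cnj (?b x) / ?n x) * (?e / ?n x * - cnj (?a x))"
      using n0[of x] by (simp add: field_simps power2_eq_square)
    then show "?e * (of_real (- N' x / (N x)\<^sup>2) * fst (Kv (Ps x)) + of_real (1 / N x) * (- \<i> * cnj z * fst (Kv (Ps x)) + q x * snd (Kv (Ps x))))
      = - \<i> * z * fst (Phi x) + qt x * snd (Phi x)"
      unfolding inv n1 qt_eq Phi_eq mult_minus_left z smul_def Kv_def fst_conv snd_conv unfolding of_real_divide .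
  qed
  moreover have "ac_deriv (\<lambda>x. snd (Phi x)) (\<lambda>x. \<i> * z * snd (Phi x) - cnj (qt x) * fst (Phi x))"
  proof (rule ac_deriv_cong[OF ac_deriv_cmult[OF ac_deriv_mult[OF ac_deriv_inverse_N wave_system_snd[OF K]], of ?e]])
    fix x
    show "?e * (of_real (1 / N x) * snd (Kv (Ps x))) = snd (Phi x)" by (simp add: Phi_eq smul_def)
    have cq: "cnj (qt x) = cnj (q x) + 4 * ?e * cnj (?a x) * ?b x / ?n x" by (simp add: qt_eq)
    have "?e * (- (2 * ?e * ?n x - 4 * ?e * (?b x * cnj (?b x))) / (?n x)\<^sup>2 * - cnj (?a x) + 1 / ?n x * ((\<i> * z + 2 * ?e) * - cnj (?a x) - cnj (q x) * cnj (?b x)))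
      = \<i> * z * (?e / ?n x * - cnj (?a x)) - (cnj (q x) + 4 * ?e * cnj (?a x) * ?b x / ?n x) * (?e / ?n x * cnj (?b x))"
      using n0[of x] by (simp add: field_simps power2_eq_square)
    then show "?e * (of_real (- N' x / (N x)\<^sup>2) * snd (Kv (Ps x)) + of_real (1 / N x) * (\<i> * cnj z * snd (Kv (Ps x)) - cnj (q x) * fst (Kv (Ps x))))
      = \<i> * z * snd (Phi x) - cnj (qt x) * fst (Phi x)"
      unfolding inv n2 cq Phi_eq z smul_def Kv_def fst_conv snd_conv unfolding of_real_divide .
  qed
  ultimately show ?thesis by (simp add: wave_system_def)
qed

lemma wave_Kv_Phi: "wave_system qt (cnj z) (\<lambda>x. Kv (Phi x))"
  by (rule wave_system_Kv[OF wave_Phi])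

text \<open>Differentiating \<open>h\<close> produces the sigma_1 pairing, while Lagrange's identity
  produces the determinant. Their mismatch, multiplied by Phi, is precisely the difference of
  potentials; this dictates the formula for the new potential.\<close>

lemma Phi_times_bil_dt:
  "2 * (bil (Ps x) v * fst (Phi x)) = (qt x - q x) * snd v - 2 * (dt (Ps x) v * fst (Phi x))"
  "2 * (bil (Ps x) v * snd (Phi x)) = 2 * (dt (Ps x) v * snd (Phi x)) - cnj (qt x - q x) * fst v"
  by (simp_all add: Phi_eq qt_eq smul_def Kv_def bil_def dt_def algebra_simps)

lemma Kv_s_times_bil_dt:
  "2 * (bil (Kv (Phi x)) v * fst (Kv (Ps x))) = - ((qt x - q x) * snd v) - 2 * (dt (Kv (Phi x)) v * fst (Kv (Ps x)))"
  "2 * (bil (Kv (Phi x)) v * snd (Kv (Ps x))) = 2 * (dt (Kv (Phi x)) v * snd (Kv (Ps x))) + cnj (qt x - q x) * fst v"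
  unfolding Kv_Phi_eq by (simp_all add: qt_eq smul_def Kv_def bil_def dt_def algebra_simps)

lemma Dgraph_Top:
  assumes D: "Dgraph q F G"
  shows "Dgraph qt (Tz F) (Tz G)"
proof -
  obtain Ft where eq: "aeeq F Ft" and L2: "L2 F" "L2 G" "L2 Ft" and c: "continuous_on UNIV Ft" and
    1: "dirac_fst q Ft G" and
    2: "dirac_snd q Ft G"
    by (rule Dgraph_continuous_representative[OF q D])
  \<comment> \<open>The half-lines contribute local terms with opposite signs. As \<open>h\<close>
    is a difference, these add up to the determinant with Psi.\<close>
  have hG: "h G x = z * h Ft x - \<i> * dt (Ps x) (Ft x)" for x
    unfolding h_def am_def bp_def
      lagrange_atMost(1)[OF wave_m 1 2 L2(3,2) Pm_L2, of x] lagrange_atLeast(1)[OF wave_p 1 2 L2(3,2) Pp_L2, of x]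
    by (simp add: Ps_eq dt_def algebra_simps)
  have "continuous_on UNIV (\<lambda>x. bil (Ps x) (Ft x))"
    unfolding bil_def by (intro continuous_intros cont_s c)
  then have h': "ac_deriv (h Ft) (\<lambda>x. bil (Ps x) (Ft x))"
    by (rule primitive_ac_deriv[OF primitive_h[OF L2(3)]])
  let ?T = "Tz Ft"
  have "ac_deriv (\<lambda>x. fst (?T x)) (\<lambda>x. - \<i> * fst (Tz G x) + qt x * snd (?T x))"
  proof (rule ac_deriv_cong[OF ac_deriv_add[OF 1 ac_deriv_cmult[OF ac_deriv_mult[OF h' wave_system_fst[OF wave_Phi]], of 2]]])
    fix x
    show "fst (Ft x) + 2 * (h Ft x * fst (Phi x)) = fst (?T x)" by (simp add: Top_h smul_def)
    show "- \<i> * fst (G x) + q x * snd (Ft x) + 2 * (bil (Ps x) (Ft x) * fst (Phi x) + h Ft x * (- \<i> * z * fst (Phi x) + qt x * snd (Phi x)))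
      = - \<i> * fst (Tz G x) + qt x * snd (?T x)"
      unfolding distrib_left[of 2] Phi_times_bil_dt(1) Top_h hG by (simp add: smul_def algebra_simps)
  qed
  moreover have "ac_deriv (\<lambda>x. snd (?T x)) (\<lambda>x. \<i> * snd (Tz G x) - cnj (qt x) * fst (?T x))"
  proof (rule ac_deriv_cong[OF ac_deriv_add[OF 2 ac_deriv_cmult[OF ac_deriv_mult[OF h' wave_system_snd[OF wave_Phi]], of 2]]])
    fix x
    show "snd (Ft x) + 2 * (h Ft x * snd (Phi x)) = snd (?T x)" by (simp add: Top_h smul_def)
    show "\<i> * snd (G x) - cnj (q x) * fst (Ft x) + 2 * (bil (Ps x) (Ft x) * snd (Phi x) + h Ft x * (\<i> * z * snd (Phi x) - cnj (qt x) * fst (Phi x)))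
      = \<i> * snd (Tz G x) - cnj (qt x) * fst (?T x)"
      unfolding distrib_left[of 2] Phi_times_bil_dt(2) Top_h hG by (simp add: smul_def algebra_simps)
  qed
  moreover have "aeeq (Tz F) ?T"
    using eq cong_ops[OF L2(1,3) eq] unfolding aeeq_def by (auto simp: Top_eq elim!: AE_mp)
  ultimately show ?thesis
    unfolding Dgraph_iff[OF L1loc_qt] using L2_Top L2 by blast
qed

text \<open>Phi and K Phi are eigenfunctions of the transformed operator, so it maps elements of its
  domain in either J-orthogonal complement back into that complement.\<close>

lemma Dgraph_qt_Jprod:
  assumes D: "Dgraph qt E H"
  shows "Jprod H (Kop Phi) = cnj z * Jprod E (Kop Phi)" "Jprod H Phi = z * Jprod E Phi"
proof -
  obtain Et where eq: "aeeq E Et" and L2: "L2 E" "L2 H" "L2 Et" and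
    12: "dirac_fst qt Et H"
    "dirac_snd qt Et H"
    by (rule Dgraph_continuous_representative[OF L1loc_qt D])
  show "Jprod H (Kop Phi) = cnj z * Jprod E (Kop Phi)"
    using Jprod_eigenfunction[OF wave_Kv_Phi L2_Kv_Phi 12 L2(3,2)] Jprod_cong[OF L2(1,3) eq L2_Kv_Phi] by (simp add: Kop_def)
  show "Jprod H Phi = z * Jprod E Phi"
    using Jprod_eigenfunction[OF wave_Phi L2_Phi 12 L2(3,2)] Jprod_cong[OF L2(1,3) eq L2_Phi] by simp
qed

lemma Dgraph_Shat:
  assumes D: "Dgraph qt E H" and J: "Jorth E (Kop Phi)"
  shows "Dgraph q (Sz E) (Sz H)"
proof -
  obtain Et where eq: "aeeq E Et" and L2: "L2 E" "L2 H" "L2 Et" and c: "continuous_on UNIV Et" and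
    1: "dirac_fst qt Et H" and
    2: "dirac_snd qt Et H"
    by (rule Dgraph_continuous_representative[OF L1loc_qt D])
  \<comment> \<open>The one-term form of S is wanted for \<open>H\<close> as well as for
    \<open>E\<close>, so that Lagrange's identity on the left half-line alone is enough.\<close>
  have JH: "Jorth H (Kop Phi)" using Dgraph_qt_Jprod(1)[OF D] J by (simp add: Jorth_def)
  have JE: "Jorth Et (Kop Phi)"
    using J Jprod_cong[OF L2(1,3) eq L2_Kv_Phi] by (simp add: Jorth_def Kop_def)
  note SH = Shat_if_Jorth[OF L2(2) JH] and SE = Shat_if_Jorth[OF L2(3) JE]
  have kH: "kl H x = cnj z * kl Et x - \<i> * dt (Kv (Phi x)) (Et x)" for x
    unfolding kl_def by (rule lagrange_atMost(1)[OF wave_Kv_Phi 1 2 L2(3,2) L2_imp_L2_on[OF L2_Kv_Phi]]) simp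
  have "continuous_on UNIV (\<lambda>x. bil (Kv (Phi x)) (Et x))"
    unfolding bil_def Kv_def by (simp, intro continuous_intros cont_Phi c)
  then have k': "ac_deriv (kl Et) (\<lambda>x. bil (Kv (Phi x)) (Et x))"
    by (rule primitive_ac_deriv[OF primitive_kl[OF L2(3)]])
  note K = wave_system_Kv[OF wave_s]
  let ?S = "Sz Et"
  have "ac_deriv (\<lambda>x. fst (?S x)) (\<lambda>x. - \<i> * fst (Sz H x) + q x * snd (?S x))"
  proof (rule ac_deriv_cong[OF ac_deriv_add[OF 1 ac_deriv_cmult[OF ac_deriv_mult[OF k' wave_system_fst[OF K]], of 2]]])
    fix x
    show "fst (Et x) + 2 * (kl Et x * fst (Kv (Ps x))) = fst (?S x)" by (simp add: SE smul_def)
    show "- \<i> * fst (H x) + qt x * snd (Et x) + 2 * (bil (Kv (Phi x)) (Et x) * fst (Kv (Ps x)) + kl Et x * (- \<i> * cnj z * fst (Kv (Ps x)) + q x * snd (Kv (Ps x))))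
      = - \<i> * fst (Sz H x) + q x * snd (?S x)"
      unfolding distrib_left[of 2] Kv_s_times_bil_dt(1) SE SH kH by (simp add: smul_def algebra_simps)
  qed
  moreover have "ac_deriv (\<lambda>x. snd (?S x)) (\<lambda>x. \<i> * snd (Sz H x) - cnj (q x) * fst (?S x))"
  proof (rule ac_deriv_cong[OF ac_deriv_add[OF 2 ac_deriv_cmult[OF ac_deriv_mult[OF k' wave_system_snd[OF K]], of 2]]])
    fix x
    show "snd (Et x) + 2 * (kl Et x * snd (Kv (Ps x))) = snd (?S x)" by (simp add: SE smul_def)
    show "\<i> * snd (H x) - cnj (qt x) * fst (Et x) + 2 * (bil (Kv (Phi x)) (Et x) * snd (Kv (Ps x)) + kl Et x * (\<i> * cnj z * snd (Kv (Ps x)) - cnj (q x) * fst (Kv (Ps x))))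
      = \<i> * snd (Sz H x) - cnj (q x) * fst (?S x)"
      unfolding distrib_left[of 2] Kv_s_times_bil_dt(2) SE SH kH by (simp add: smul_def algebra_simps)
  qed
  moreover have "aeeq (Sz E) ?S"
    using eq cong_ops[OF L2(1,3) eq] unfolding aeeq_def by (auto simp: Shat_eq elim!: AE_mp)
  ultimately show ?thesis
    unfolding Dgraph_iff[OF q] using L2_Shat L2 by blast
qed


section \<open>Operator identities up to equality almost everywhere\<close>

lemma Shat_vlin:
  assumes "L2 F" "L2 G"
  shows "Sz (vlin a F b G) = vlin a (Sz F) b (Sz G)"
proof
  fix x
  show "Sz (vlin a F b G) x = vlin a (Sz F) b (Sz G) x"
    unfolding Shat_eq vlin_ops[OF assms] unfolding vlin_def Shat_eq by (simp add: smul_def prod_eq_iff algebra_simps)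
qed

lemma Top_aeeq: "L2 F \<Longrightarrow> L2 G \<Longrightarrow> aeeq F G \<Longrightarrow> aeeq (Tz F) (Tz G)"
  and Shat_aeeq: "L2 F \<Longrightarrow> L2 G \<Longrightarrow> aeeq F G \<Longrightarrow> aeeq (Sz F) (Sz G)"
proof -
  assume FG: "L2 F" "L2 G" "aeeq F G"
  show "aeeq (Tz F) (Tz G)"
    using FG(3) unfolding aeeq_def Top_eq cong_ops[OF FG] by eventually_elim simp
  show "aeeq (Sz F) (Sz G)"
    using FG(3) unfolding aeeq_def Shat_eq cong_ops[OF FG] by eventually_elim simp
qed

lemma L2_vzero: "L2 vzero"
  by (simp add: L2_def vzero_def)

lemma Top_vzero: "Tz vzero x = 0" and Shat_vzero: "Sz vzero x = 0"
  by (simp_all add: Top_def Shat_def vzero_def bil_def smul_def zero_prod_def)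

lemma Jorth_aeeq:
  assumes "L2 F" "L2 G" "aeeq F G" "L2 P"
  shows "Jorth F P \<longleftrightarrow> Jorth G P"
  unfolding Jorth_def Jprod_cong[OF assms] ..

lemma L2_Kop_Phi: "L2 (Kop Phi)"
  using L2_Kv_Phi by (simp add: Kop_def)

text \<open>The inclusion of domains from left to right uses S: applied to the graph of the
  transformed operator at T F it returns \<open>F\<close> with image S H. Moreover \<open>H\<close>
  inherits both orthogonality relations from T F, hence T S H = H.\<close>

lemma Top_intertwines:
  assumes F: "L2 F" and H: "L2 H"
  shows "Dgraph qt (Tz F) H \<longleftrightarrow> (\<exists>G. Dgraph q F G \<and> aeeq H (Tz G))"
proof
  assume D: "Dgraph qt (Tz F) H"
  have "Dgraph q F (Sz H)"
    using Dgraph_Shat[OF D Jorth_Top_Kv[OF F]] unfolding Shat_Top[OF F] .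
  moreover have "Jorth H (Kop Phi)" "Jorth H Phi"
    using Dgraph_qt_Jprod[OF D] Jorth_Top_Kv[OF F] Jorth_Top_Phi[OF F] by (simp_all add: Jorth_def)
  then have "Tz (Sz H) = H" by (rule Top_Shat_eq[OF H])
  then have "aeeq H (Tz (Sz H))" by (simp add: aeeq_refl)
  ultimately show "\<exists>G. Dgraph q F G \<and> aeeq H (Tz G)" by blast
next
  assume "\<exists>G. Dgraph q F G \<and> aeeq H (Tz G)"
  then obtain G where D: "Dgraph q F G" and G: "aeeq H (Tz G)" by blast
  show "Dgraph qt (Tz F) H"
    by (rule Dgraph_aeeq[OF Dgraph_Top[OF D] aeeq_refl L2_Top[OF F] aeeq_sym[OF G] H])
qed

text \<open>Here T S F returns \<open>F\<close> only up to a multiple of Phi. As Phi is an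
  eigenfunction annihilated by S, this ambiguity can be corrected inside the graph.\<close>

lemma Shat_intertwines:
  assumes F: "L2 F" and H: "L2 H"
  shows "(\<exists>G. Dgraph qt F G \<and> Jorth G (Kop Phi) \<and> aeeq H (Sz G)) \<longleftrightarrow>
    Jorth F (Kop Phi) \<and> Dgraph q (Sz F) H"
proof
  assume "\<exists>G. Dgraph qt F G \<and> Jorth G (Kop Phi) \<and> aeeq H (Sz G)"
  then obtain G where D: "Dgraph qt F G" and J: "Jorth G (Kop Phi)" and G: "aeeq H (Sz G)" by blast
  \<comment> \<open>Orthogonality is given for the image \<open>G\<close> and wanted for
    \<open>F\<close>; passing back divides by the eigenvalue conj z.\<close>
  have "cnj z \<noteq> 0" using Im_z_nonzero by auto
  then have JF: "Jorth F (Kop Phi)" using Dgraph_qt_Jprod(1)[OF D] J by (simp add: Jorth_def)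
  show "Jorth F (Kop Phi) \<and> Dgraph q (Sz F) H"
    using JF Dgraph_aeeq[OF Dgraph_Shat[OF D JF] aeeq_refl L2_Shat[OF F] aeeq_sym[OF G] H] by blast
next
  assume A: "Jorth F (Kop Phi) \<and> Dgraph q (Sz F) H"
  then obtain c where c: "\<And>x. Tz (Sz F) x = F x + smul c (Phi x)"
    using Top_Shat[OF F] by blast
  let ?T = "Tz H"
  \<comment> \<open>The witness is T H - c z Phi: the image of T S F is T H, and the surplus c Phi
    is removed together with its image.\<close>
  have "Dgraph qt (\<lambda>x. Tz (Sz F) x + smul (- c) (Phi x)) (\<lambda>x. ?T x + smul (- c) (smul z (Phi x)))"
    using A by (intro Dgraph_add_smul L1loc_qt Dgraph_Top Dgraph_wave wave_Phi L2_Phi) blast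
  moreover have "(\<lambda>x. Tz (Sz F) x + smul (- c) (Phi x)) = F"
    unfolding c by (simp add: smul_def prod_eq_iff fun_eq_iff)
  moreover have G: "(\<lambda>x. ?T x + smul (- c) (smul z (Phi x))) = vlin 1 ?T (- c * z) Phi"
    by (simp add: vlin_def smul_def mult.assoc)
  ultimately have D: "Dgraph qt F (vlin 1 ?T (- c * z) Phi)" by simp
  have "Jprod (vlin 1 ?T (- c * z) Phi) (Kop Phi) = 0"
    unfolding Jprod_vlin[OF L2_Top[OF H] L2_Phi L2_Kop_Phi]
    using Jorth_Top_Kv[OF H] Jorth_Phi_Kv by (simp add: Jorth_def)
  moreover have "Sz (vlin 1 ?T (- c * z) Phi) = H"
    unfolding Shat_vlin[OF L2_Top[OF H] L2_Phi] Shat_Top[OF H]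
    by (simp add: vlin_def Shat_Phi smul_def prod_eq_iff fun_eq_iff)
  ultimately show "\<exists>G. Dgraph qt F G \<and> Jorth G (Kop Phi) \<and> aeeq H (Sz G)"
    using D by (intro exI[of _ "vlin 1 ?T (- c * z) Phi"]) (simp add: Jorth_def aeeq_refl)
qed

lemma Top_kernel:
  assumes F: "L2 F" and T: "aeeq (Tz F) vzero"
  shows "aeeq F vzero"
  using Shat_aeeq[OF L2_Top[OF F] L2_vzero T] unfolding Shat_Top[OF F]
  by (simp add: aeeq_def Shat_vzero) (simp add: vzero_def zero_prod_def)

lemma Top_range:
  assumes G: "L2 G"
  shows "Jorth G Phi \<and> Jorth G (Kop Phi) \<longleftrightarrow> (\<exists>F. L2 F \<and> aeeq G (Tz F))"
proof
  assume "Jorth G Phi \<and> Jorth G (Kop Phi)"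
  then have "Tz (Sz G) = G" by (intro Top_Shat_eq G) auto
  then show "\<exists>F. L2 F \<and> aeeq G (Tz F)"
    by (intro exI[of _ "Sz G"]) (simp add: L2_Shat G aeeq_refl)
next
  assume "\<exists>F. L2 F \<and> aeeq G (Tz F)"
  then obtain F where F: "L2 F" "aeeq G (Tz F)" by blast
  then show "Jorth G Phi \<and> Jorth G (Kop Phi)"
    using Jorth_aeeq[OF G L2_Top[OF F(1)] F(2)] Jorth_Top_Phi Jorth_Top_Kv L2_Phi L2_Kop_Phi by blast
qed

text \<open>If S F = 0, then 0 = T S F = F + c Phi; conversely Phi is J-orthogonal to K Phi and
  killed by S.\<close>

lemma Shat_kernel:
  assumes F: "L2 F"
  shows "Jorth F (Kop Phi) \<and> aeeq (Sz F) vzero \<longleftrightarrow> (\<exists>c. aeeq F (\<lambda>x. smul c (Phi x)))"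
proof
  assume A: "Jorth F (Kop Phi) \<and> aeeq (Sz F) vzero"
  then obtain c where c: "\<And>x. Tz (Sz F) x = F x + smul c (Phi x)"
    using Top_Shat[OF F] by blast
  have "aeeq (Tz (Sz F)) (Tz vzero)"
    using A by (intro Top_aeeq L2_Shat F L2_vzero) auto
  then have "aeeq F (\<lambda>x. smul (- c) (Phi x))"
    unfolding aeeq_def c Top_vzero by eventually_elim (simp add: smul_def prod_eq_iff add_eq_0_iff2)
  then show "\<exists>c. aeeq F (\<lambda>x. smul c (Phi x))" by blast
next
  assume "\<exists>c. aeeq F (\<lambda>x. smul c (Phi x))"
  then obtain c where c: "aeeq F (\<lambda>x. smul c (Phi x))" by blast
  have v: "(\<lambda>x. smul c (Phi x)) = vlin c Phi 0 Phi" by (simp add: vlin_def smul_def)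
  have "Jorth (vlin c Phi 0 Phi) (Kop Phi)"
    using Jorth_Phi_Kv Jprod_vlin[OF L2_Phi L2_Phi L2_Kop_Phi] by (simp add: Jorth_def)
  then have 1: "Jorth F (Kop Phi)"
    using Jorth_aeeq[OF F L2_smul[OF L2_Phi] c L2_Kop_Phi] unfolding v by blast
  have "aeeq (Sz F) (Sz (vlin c Phi 0 Phi))"
    using Shat_aeeq[OF F L2_smul[OF L2_Phi] c] unfolding v .
  then have "aeeq (Sz F) vzero"
    unfolding Shat_vlin[OF L2_Phi L2_Phi] by (simp add: vlin_def Shat_Phi smul_def vzero_def)
  with 1 show "Jorth F (Kop Phi) \<and> aeeq (Sz F) vzero" by blast
qed

lemma Shat_range:
  assumes G: "L2 G"
  shows "\<exists>F. L2 F \<and> Jorth F (Kop Phi) \<and> aeeq G (Sz F)"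
  by (intro exI[of _ "Tz G"]) (simp add: L2_Top G Jorth_Top_Kv Shat_Top aeeq_refl)

end

text \<open>Equality of operators is stated as coincidence of graphs modulo a.e. equality, which
  includes equality of domains. In the product of S with the transformed operator, the orthogonality
  of \<open>G\<close> expresses that \<open>G\<close> lies in the domain of S.\<close>

theorem theorem6p14:
  fixes q :: "real \<Rightarrow> complex" and z1 :: complex and Pm Pp :: vfun
  assumes hq: "L1loc q"
    and hz1: "z1 \<in> resolvent_set q"
    and hPm: "wave_fun q z1 Pm" and hPp: "wave_fun q z1 Pp"
    and hPm_L2: "\<forall>R. L2_on {..R} Pm"
    and hPp_L2: "\<forall>R. L2_on {R..} Pp"
  shows
    "bounded_linear_L2 (\<lambda>F. True) (Top z1 Pm Pp)
   \<and> bounded_linear_L2 (\<lambda>F. Jorth F (Kop (Phi1 z1 Pm Pp))) (Shat z1 Pm Pp)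
   \<and> (\<forall>F H. L2 F \<and> L2 H \<longrightarrow>
         (Dgraph (q1 q z1 Pm Pp) (Top z1 Pm Pp F) H
          \<longleftrightarrow> (\<exists>G. Dgraph q F G \<and> aeeq H (Top z1 Pm Pp G))))
   \<and> (\<forall>F H. L2 F \<and> L2 H \<longrightarrow>
         ((\<exists>G. Dgraph (q1 q z1 Pm Pp) F G \<and> Jorth G (Kop (Phi1 z1 Pm Pp))
               \<and> aeeq H (Shat z1 Pm Pp G))
          \<longleftrightarrow> (Jorth F (Kop (Phi1 z1 Pm Pp)) \<and> Dgraph q (Shat z1 Pm Pp F) H)))
   \<and> (\<forall>F. L2 F \<and> aeeq (Top z1 Pm Pp F) vzero \<longrightarrow> aeeq F vzero)
   \<and> (\<forall>G. L2 G \<longrightarrow>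
         ((Jorth G (Phi1 z1 Pm Pp) \<and> Jorth G (Kop (Phi1 z1 Pm Pp)))
          \<longleftrightarrow> (\<exists>F. L2 F \<and> aeeq G (Top z1 Pm Pp F))))
   \<and> (\<forall>F. L2 F \<longrightarrow>
         ((Jorth F (Kop (Phi1 z1 Pm Pp)) \<and> aeeq (Shat z1 Pm Pp F) vzero)
          \<longleftrightarrow> (\<exists>c. aeeq F (\<lambda>x. smul c (Phi1 z1 Pm Pp x)))))
   \<and> (\<forall>G. L2 G \<longrightarrow>
         (\<exists>F. L2 F \<and> Jorth F (Kop (Phi1 z1 Pm Pp)) \<and> aeeq G (Shat z1 Pm Pp F)))
   \<and> (\<forall>F. L2 F \<longrightarrow> aeeq (Shat z1 Pm Pp (Top z1 Pm Pp F)) F)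
   \<and> (\<forall>G. L2 G \<and> Jorth G (Phi1 z1 Pm Pp) \<and> Jorth G (Kop (Phi1 z1 Pm Pp)) \<longrightarrow>
         aeeq (Top z1 Pm Pp (Shat z1 Pm Pp G)) G)"
proof -
  interpret weyl_pair q z1 Pm Pp
  proof
    show "wave_system q z1 Pm" "wave_system q z1 Pp"
      by (intro wave_fun_wave_system hq hPm hPp)+
    show "\<exists>x. Pm x \<noteq> 0" "\<exists>x. Pp x \<noteq> 0"
      using hPm hPp by (auto simp: wave_fun_def vzero_def zero_prod_def fun_eq_iff)
  qed (use hq hz1 hPm_L2 hPp_L2 in auto)
  show ?thesis
    by (intro conjI allI impI bounded_linear_Top bounded_linear_Shat)
      (simp_all add: Top_intertwines Shat_intertwines Top_kernel Top_range Shat_kernel Shat_range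
        Shat_Top Top_Shat_eq aeeq_refl)
qed

end
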